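(* Let $R$ be a Koszul $\Bbbk$-algebra and let $M$ be an indecomposable linear $R$-module of infinite projective dimension. Consider the following statements: (1) The module $M$ is periodic. (2) There exist $n\geqslant 1$ and $\eta\in\Delta^n_M$ such that some lifting of $\eta$ is an isomorphism. (3) There exist $n\geqslant 1$ and $\eta\in\Delta^n_M$ such that some lifting of $\eta$ is a monomorphism. (4) The module $M$ is eventually periodic. Then (1) implies (2), (2) is equivalent to (3), and (3) implies (4). Moreover, if $R$ is selfinjective, then (1)–(4) are all equivalent.
   Context: $\Bbbk$ is a field; modules are right modules. A Koszul $\Bbbk$-algebra is a graded algebra $R=R_0\oplus R_1\oplus\cdots$ with $R_0=\Bbbk\times\cdots\times\Bbbk$ such that $R_0=R/\mathfrak r$, $\mathfrak r=\bigoplus_{i>0}R_i$, is a linear $R$-module. Only graded modules having graded projective resolutions with finitely generated terms are considered. A graded module $M$ generated in degree $0$ is linear if it has a graded projective resolution $(P_M^\bullet,d_M^\bullet)$ in which, for each $n$, $P_M^n$ is generated in degree $n$ (a linear resolution). A homomorphism $f\colon M\to N$ of graded modules has degree $i$ if $f(M_k)\subseteq N_{i+k}$ for all $k$. $\Delta_M^n=\operatorname{Ext}^n_R(M,M)_{-n}$ denotes the set of classes in $\operatorname{Ext}^n_R(M,M)$ represented by degree $-n$ homomorphisms $\eta\colon P_M^n\to M$ (with $\eta d_M^{n+1}=0$). The liftings of such an $\eta$ are degree $-n$ homomorphisms $l^i\colon P_M^{n+i}\to P_M^i$, $i\ge0$, with $d_M^0l^0=\eta$ and $d_M^{i}l^{i}=l^{i-1}d_M^{n+i}$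 for $i\ge1$; they are given by matrices with entries in $R_0$. $\Omega^nM$ is the $n$-th syzygy of $M$ in its minimal projective resolution. $M$ is periodic if $\Omega^nM\cong M$ as $R$-modules for some $n\ge1$, and eventually periodic if $\Omega^{a+n}M\cong\Omega^aM$ for some $a\ge0$ and $n\ge1$. *)

theory Defs
  imports "HOL-Algebra.Algebra"
begin

section \<open>Right modules over a noncommutative ring\<close>

text \<open>
  The record \<^type>\<open>module_ext\<close> of HOL-Algebra is reused, but \<^term>\<open>r \<odot>\<^bsub>M\<^esub> x\<close> stands for
  the right action \<open>x r\<close>; this is visible in the associativity law only. As for the library
  locale \<^locale>\<open>module\<close>, the fields \<^const>\<open>mult\<close> and \<^const>\<open>one\<close> of a module are irrelevant.
\<close>

locale right_module = R?: ring R + M?: abelian_group M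
  for R :: "('r, 'c) ring_scheme" (structure) and M :: "('r, 'm, 'd) module_scheme" (structure) +
  assumes act_closed:
      "\<lbrakk>r \<in> carrier R; x \<in> carrier M\<rbrakk> \<Longrightarrow> r \<odot>\<^bsub>M\<^esub> x \<in> carrier M"
    and act_add_ring:
      "\<lbrakk>r \<in> carrier R; s \<in> carrier R; x \<in> carrier M\<rbrakk> \<Longrightarrow>
       (r \<oplus>\<^bsub>R\<^esub> s) \<odot>\<^bsub>M\<^esub> x = r \<odot>\<^bsub>M\<^esub> x \<oplus>\<^bsub>M\<^esub> s \<odot>\<^bsub>M\<^esub> x"
    and act_add_module:
      "\<lbrakk>r \<in> carrier R; x \<in> carrier M; y \<in> carrier M\<rbrakk> \<Longrightarrow>
       r \<odot>\<^bsub>M\<^esub> (x \<oplus>\<^bsub>M\<^esub> y) = r \<odot>\<^bsub>M\<^esub> x \<oplus>\<^bsub>M\<^esub> r \<odot>\<^bsub>M\<^esub> y"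
    and act_mult:
      "\<lbrakk>r \<in> carrier R; s \<in> carrier R; x \<in> carrier M\<rbrakk> \<Longrightarrow>
       (r \<otimes>\<^bsub>R\<^esub> s) \<odot>\<^bsub>M\<^esub> x = s \<odot>\<^bsub>M\<^esub> (r \<odot>\<^bsub>M\<^esub> x)"
    and act_one:
      "x \<in> carrier M \<Longrightarrow> \<one>\<^bsub>R\<^esub> \<odot>\<^bsub>M\<^esub> x = x"

text \<open>Homomorphisms are considered on the carrier only; their values elsewhere are arbitrary.\<close>

definition rmod_hom ::
  "('r, 'c) ring_scheme \<Rightarrow> ('r, 'm, 'd) module_scheme \<Rightarrow> ('r, 'n, 'e) module_scheme \<Rightarrow> ('m \<Rightarrow> 'n) set"
  where "rmod_hom R M N =
    {f. f \<in> carrier M \<rightarrow> carrier N \<and>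
        (\<forall>x\<in>carrier M. \<forall>y\<in>carrier M. f (x \<oplus>\<^bsub>M\<^esub> y) = f x \<oplus>\<^bsub>N\<^esub> f y) \<and>
        (\<forall>r\<in>carrier R. \<forall>x\<in>carrier M. f (r \<odot>\<^bsub>M\<^esub> x) = r \<odot>\<^bsub>N\<^esub> f x)}"

definition rmod_isomorphic ::
  "('r, 'c) ring_scheme \<Rightarrow> ('r, 'm, 'd) module_scheme \<Rightarrow> ('r, 'n, 'e) module_scheme \<Rightarrow> bool"
  where "rmod_isomorphic R M N \<longleftrightarrow> (\<exists>f\<in>rmod_hom R M N. bij_betw f (carrier M) (carrier N))"

definition rmod_span ::
  "('r, 'c) ring_scheme \<Rightarrow> ('r, 'm, 'd) module_scheme \<Rightarrow> 'm set \<Rightarrow> 'm set"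
  where "rmod_span R M S = \<Inter>{N. submodule N R M \<and> S \<subseteq> N}"

definition finitely_generated ::
  "('r, 'c) ring_scheme \<Rightarrow> ('r, 'm, 'd) module_scheme \<Rightarrow> bool"
  where "finitely_generated R M \<longleftrightarrow>
    (\<exists>S. finite S \<and> S \<subseteq> carrier M \<and> rmod_span R M S = carrier M)"

definition indecomposable ::
  "('r, 'c) ring_scheme \<Rightarrow> ('r, 'm, 'd) module_scheme \<Rightarrow> bool"
  where "indecomposable R M \<longleftrightarrow>
    carrier M \<noteq> {\<zero>\<^bsub>M\<^esub>} \<and>
    (\<forall>A B. submodule A R M \<and> submodule B R M \<and>
           A \<inter> B = {\<zero>\<^bsub>M\<^esub>} \<and> A <+>\<^bsub>M\<^esub> B = carrier M \<longrightarrow>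
           A = {\<zero>\<^bsub>M\<^esub>} \<or> B = {\<zero>\<^bsub>M\<^esub>})"

text \<open>
  A formula cannot quantify over modules of all types, so the test modules below live on fixed
  types. For a projective module \<open>P\<close> the decisive lifting problem is that of the identity of \<open>P\<close>
  along the canonical epimorphism onto \<open>P\<close> from the free module on the set \<open>P\<close>, which consists of
  the finitely supported functions from \<open>P\<close> to \<open>R\<close>; hence nothing is lost. For injective modules
  nothing is lost by Baer's criterion.
\<close>

definition projective_module ::
  "('r, 'c) ring_scheme \<Rightarrow> ('r, 'p, 'd) module_scheme \<Rightarrow> bool"
  where "projective_module R P \<longleftrightarrow>
    right_module R P \<and>
    (\<forall>(B :: ('r, 'p \<Rightarrow> 'r) module) (C :: ('r, 'p) module) g f.
       right_module R B \<and> right_module R C \<and>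
       g \<in> rmod_hom R B C \<and> g ` carrier B = carrier C \<and> f \<in> rmod_hom R P C \<longrightarrow>
       (\<exists>h\<in>rmod_hom R P B. \<forall>x\<in>carrier P. g (h x) = f x))"

definition injective_module ::
  "('r, 'c) ring_scheme \<Rightarrow> ('r, 'i, 'd) module_scheme \<Rightarrow> bool"
  where "injective_module R I \<longleftrightarrow>
    right_module R I \<and>
    (\<forall>(A :: ('r, 'r) module) (B :: ('r, 'r) module) g f.
       right_module R A \<and> right_module R B \<and>
       g \<in> rmod_hom R A B \<and> inj_on g (carrier A) \<and> f \<in> rmod_hom R A I \<longrightarrow>
       (\<exists>h\<in>rmod_hom R B I. \<forall>x\<in>carrier A. h (g x) = f x))"

definition right_regular :: "('r, 'c) ring_scheme \<Rightarrow> ('r, 'r) module"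
  where "right_regular R =
    \<lparr>carrier = carrier R, monoid.mult = monoid.mult R, monoid.one = monoid.one R,
     ring.zero = ring.zero R, ring.add = ring.add R, smult = (\<lambda>r x. x \<otimes>\<^bsub>R\<^esub> r)\<rparr>"

definition selfinjective :: "('r, 'c) ring_scheme \<Rightarrow> bool"
  where "selfinjective R \<longleftrightarrow> injective_module R (right_regular R)"


section \<open>Gradings\<close>

text \<open>
  One record serves for graded algebras (over the field of scalars) and for graded right modules.
  Gradings are indexed by the integers; those of algebras vanish in negative degrees.
\<close>

record ('a, 'b) graded = "('a, 'b) module" +
  homog :: "int \<Rightarrow> 'b set"

definition decomposes ::
  "('b, 'd) ring_scheme \<Rightarrow> (int \<Rightarrow> 'b set) \<Rightarrow> 'b \<Rightarrow> (int \<Rightarrow> 'b) \<Rightarrow> bool"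
  where "decomposes M A x f \<longleftrightarrow>
    (\<forall>i. f i \<in> A i) \<and> finite {i. f i \<noteq> \<zero>\<^bsub>M\<^esub>} \<and> x = finsum M f {i. f i \<noteq> \<zero>\<^bsub>M\<^esub>}"

definition direct_sum_decomposition ::
  "('b, 'd) ring_scheme \<Rightarrow> (int \<Rightarrow> 'b set) \<Rightarrow> bool"
  where "direct_sum_decomposition M A \<longleftrightarrow>
    (\<forall>i. additive_subgroup (A i) M) \<and> (\<forall>x\<in>carrier M. \<exists>!f. decomposes M A x f)"

definition component :: "('a, 'b, 'd) graded_scheme \<Rightarrow> int \<Rightarrow> 'b \<Rightarrow> 'b"
  where "component M i x = (THE f. decomposes M (homog M) x f) i"

definition graded_algebra ::
  "('k, 'e) ring_scheme \<Rightarrow> ('k, 'r, 'c) graded_scheme \<Rightarrow> bool"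
  where "graded_algebra K R \<longleftrightarrow>
    field K \<and> ring R \<and> module K R \<and>
    (\<forall>a\<in>carrier K. \<forall>x\<in>carrier R. \<forall>y\<in>carrier R.
       a \<odot>\<^bsub>R\<^esub> (x \<otimes>\<^bsub>R\<^esub> y) = (a \<odot>\<^bsub>R\<^esub> x) \<otimes>\<^bsub>R\<^esub> y \<and>
       a \<odot>\<^bsub>R\<^esub> (x \<otimes>\<^bsub>R\<^esub> y) = x \<otimes>\<^bsub>R\<^esub> (a \<odot>\<^bsub>R\<^esub> y)) \<and>
    direct_sum_decomposition R (homog R) \<and>
    (\<forall>i<0. homog R i = {\<zero>\<^bsub>R\<^esub>}) \<and>
    (\<forall>i. \<forall>a\<in>carrier K. \<forall>x\<in>homog R i. a \<odot>\<^bsub>R\<^esub> x \<in> homog R i) \<and>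
    (\<forall>i j. \<forall>x\<in>homog R i. \<forall>y\<in>homog R j. x \<otimes>\<^bsub>R\<^esub> y \<in> homog R (i + j)) \<and>
    \<one>\<^bsub>R\<^esub> \<in> homog R 0"

text \<open>The ideal \<open>\<rr> = R\<^sub>1 \<oplus> R\<^sub>2 \<oplus> \<dots>\<close>.\<close>

definition irrelevant_ideal :: "('k, 'r, 'c) graded_scheme \<Rightarrow> 'r set"
  where "irrelevant_ideal R = {r \<in> carrier R. component R 0 r = \<zero>\<^bsub>R\<^esub>}"

definition graded_module ::
  "('k, 'r, 'c) graded_scheme \<Rightarrow> ('r, 'm, 'd) graded_scheme \<Rightarrow> bool"
  where "graded_module R M \<longleftrightarrow>
    right_module R M \<and> direct_sum_decomposition M (homog M) \<and>
    (\<forall>i j. \<forall>x\<in>homog M i. \<forall>r\<in>homog R j. r \<odot>\<^bsub>M\<^esub> x \<in> homog M (i + j))"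

definition generated_in_degree ::
  "('k, 'r, 'c) graded_scheme \<Rightarrow> ('r, 'm, 'd) graded_scheme \<Rightarrow> int \<Rightarrow> bool"
  where "generated_in_degree R M n \<longleftrightarrow> rmod_span R M (homog M n) = carrier M"

definition graded_hom ::
  "('k, 'r, 'c) graded_scheme \<Rightarrow> int \<Rightarrow> ('r, 'm, 'd) graded_scheme \<Rightarrow> ('r, 'n, 'e) graded_scheme
     \<Rightarrow> ('m \<Rightarrow> 'n) set"
  where "graded_hom R i M N = {f \<in> rmod_hom R M N. \<forall>k. f ` homog M k \<subseteq> homog N (i + k)}"


section \<open>Graded projective resolutions\<close>

text \<open>
  A resolution of \<open>M\<close> consists of terms \<open>P n\<close>, an augmentation \<open>\<epsilon> : P 0 \<rightarrow> M\<close> (the map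
  \<open>d\<^sup>0\<close>) and differentials \<open>d n : P n \<rightarrow> P (n - 1)\<close> for \<open>n \<ge> 1\<close>; the value \<open>d 0\<close> is not used.
  The terms are finitely generated by convention.
\<close>

definition graded_projective_resolution ::
  "('k, 'r, 'c) graded_scheme \<Rightarrow> ('r, 'm, 'd) graded_scheme \<Rightarrow> (nat \<Rightarrow> ('r, 'p) graded)
     \<Rightarrow> ('p \<Rightarrow> 'm) \<Rightarrow> (nat \<Rightarrow> 'p \<Rightarrow> 'p) \<Rightarrow> bool"
  where "graded_projective_resolution R M P \<epsilon> d \<longleftrightarrow>
    graded_module R M \<and>
    (\<forall>n. graded_module R (P n) \<and> projective_module R (P n) \<and> finitely_generated R (P n)) \<and>
    \<epsilon> \<in> graded_hom R 0 (P 0) M \<and>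
    (\<forall>n. d (Suc n) \<in> graded_hom R 0 (P (Suc n)) (P n)) \<and>
    \<epsilon> ` carrier (P 0) = carrier M \<and>
    d 1 ` carrier (P 1) = a_kernel (P 0) M \<epsilon> \<and>
    (\<forall>n. d (Suc (Suc n)) ` carrier (P (Suc (Suc n))) = a_kernel (P (Suc n)) (P n) (d (Suc n)))"

text \<open>A graded projective resolution is minimal if all its differentials vanish modulo \<open>\<rr>\<close>.\<close>

definition minimal_resolution ::
  "('k, 'r, 'c) graded_scheme \<Rightarrow> ('r, 'm, 'd) graded_scheme \<Rightarrow> (nat \<Rightarrow> ('r, 'p) graded)
     \<Rightarrow> ('p \<Rightarrow> 'm) \<Rightarrow> (nat \<Rightarrow> 'p \<Rightarrow> 'p) \<Rightarrow> bool"
  where "minimal_resolution R M P \<epsilon> d \<longleftrightarrow>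
    graded_projective_resolution R M P \<epsilon> d \<and>
    (\<forall>n. d (Suc n) ` carrier (P (Suc n)) \<subseteq>
         rmod_span R (P n) {r \<odot>\<^bsub>P n\<^esub> x | r x. r \<in> irrelevant_ideal R \<and> x \<in> carrier (P n)})"

definition linear_resolution ::
  "('k, 'r, 'c) graded_scheme \<Rightarrow> ('r, 'm, 'd) graded_scheme \<Rightarrow> (nat \<Rightarrow> ('r, 'p) graded)
     \<Rightarrow> ('p \<Rightarrow> 'm) \<Rightarrow> (nat \<Rightarrow> 'p \<Rightarrow> 'p) \<Rightarrow> bool"
  where "linear_resolution R M P \<epsilon> d \<longleftrightarrow>
    graded_projective_resolution R M P \<epsilon> d \<and> (\<forall>n. generated_in_degree R (P n) (int n))"

text \<open>
  A finitely generated projective module is isomorphic to a direct summand of some \<open>R\<^sup>m\<close>, hence to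
  a module whose elements are sequences in \<open>R\<close>. Therefore it is no restriction that the resolutions
  in the next two definitions have terms of this kind.
\<close>

definition linear_module ::
  "('k, 'r, 'c) graded_scheme \<Rightarrow> ('r, 'm, 'd) graded_scheme \<Rightarrow> bool"
  where "linear_module R M \<longleftrightarrow>
    graded_module R M \<and> generated_in_degree R M 0 \<and>
    (\<exists>(P :: nat \<Rightarrow> ('r, nat \<Rightarrow> 'r) graded) \<epsilon> d. linear_resolution R M P \<epsilon> d)"

definition infinite_projective_dimension ::
  "('k, 'r, 'c) graded_scheme \<Rightarrow> ('r, 'm, 'd) graded_scheme \<Rightarrow> bool"
  where "infinite_projective_dimension R M \<longleftrightarrow>
    \<not> (\<exists>(P :: nat \<Rightarrow> ('r, nat \<Rightarrow> 'r) graded) \<epsilon> d m.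
          graded_projective_resolution R M P \<epsilon> d \<and> (\<forall>n>m. carrier (P n) = {\<zero>\<^bsub>P n\<^esub>}))"


section \<open>Koszul algebras\<close>

text \<open>The algebra \<open>R\<^sub>0\<close> is isomorphic to \<open>K \<times> \<dots> \<times> K\<close> (with \<open>m \<ge> 1\<close> factors).\<close>

definition split_degree_zero ::
  "('k, 'e) ring_scheme \<Rightarrow> ('k, 'r, 'c) graded_scheme \<Rightarrow> bool"
  where "split_degree_zero K R \<longleftrightarrow>
    (\<exists>(m::nat) h. m \<ge> 1 \<and>
       bij_betw h ({..<m} \<rightarrow>\<^sub>E carrier K) (homog R 0) \<and>
       h (\<lambda>i\<in>{..<m}. \<one>\<^bsub>K\<^esub>) = \<one>\<^bsub>R\<^esub> \<and>
       (\<forall>u \<in> {..<m} \<rightarrow>\<^sub>E carrier K. \<forall>v \<in> {..<m} \<rightarrow>\<^sub>E carrier K.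
          h (\<lambda>i\<in>{..<m}. u i \<oplus>\<^bsub>K\<^esub> v i) = h u \<oplus>\<^bsub>R\<^esub> h v \<and>
          h (\<lambda>i\<in>{..<m}. u i \<otimes>\<^bsub>K\<^esub> v i) = h u \<otimes>\<^bsub>R\<^esub> h v) \<and>
       (\<forall>a \<in> carrier K. \<forall>u \<in> {..<m} \<rightarrow>\<^sub>E carrier K.
          h (\<lambda>i\<in>{..<m}. a \<otimes>\<^bsub>K\<^esub> u i) = a \<odot>\<^bsub>R\<^esub> h u))"

text \<open>
  \<open>R\<^sub>0 = R/\<rr>\<close> as a graded right \<open>R\<close>-module concentrated in degree \<open>0\<close>: an element \<open>r\<close> of \<open>R\<close>
  acts through its component of degree \<open>0\<close>.
\<close>

definition degree_zero_module :: "('k, 'r, 'c) graded_scheme \<Rightarrow> ('r, 'r) graded"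
  where "degree_zero_module R =
    \<lparr>carrier = homog R 0, monoid.mult = monoid.mult R, monoid.one = monoid.one R,
     ring.zero = ring.zero R, ring.add = ring.add R, smult = (\<lambda>r x. x \<otimes>\<^bsub>R\<^esub> component R 0 r),
     homog = (\<lambda>i. if i = 0 then homog R 0 else {\<zero>\<^bsub>R\<^esub>})\<rparr>"

definition koszul_algebra ::
  "('k, 'e) ring_scheme \<Rightarrow> ('k, 'r, 'c) graded_scheme \<Rightarrow> bool"
  where "koszul_algebra K R \<longleftrightarrow>
    graded_algebra K R \<and> split_degree_zero K R \<and> linear_module R (degree_zero_module R)"


section \<open>Extensions and their liftings\<close>

definition cocycles ::
  "('k, 'r, 'c) graded_scheme \<Rightarrow> ('r, 'm, 'd) graded_scheme \<Rightarrow> (nat \<Rightarrow> ('r, 'p) graded)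
     \<Rightarrow> (nat \<Rightarrow> 'p \<Rightarrow> 'p) \<Rightarrow> nat \<Rightarrow> ('p \<Rightarrow> 'm) set"
  where "cocycles R M P d n =
    {\<eta> \<in> rmod_hom R (P n) M. \<forall>x\<in>carrier (P (Suc n)). \<eta> (d (Suc n) x) = \<zero>\<^bsub>M\<^esub>}"

text \<open>The class of a cocycle in \<open>Ext\<^sup>n(M, M)\<close>, as the set of all cocycles cohomologous to it.\<close>

definition ext_class ::
  "('k, 'r, 'c) graded_scheme \<Rightarrow> ('r, 'm, 'd) graded_scheme \<Rightarrow> (nat \<Rightarrow> ('r, 'p) graded)
     \<Rightarrow> (nat \<Rightarrow> 'p \<Rightarrow> 'p) \<Rightarrow> nat \<Rightarrow> ('p \<Rightarrow> 'm) \<Rightarrow> ('p \<Rightarrow> 'm) set"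
  where "ext_class R M P d n \<eta> =
    {\<theta> \<in> cocycles R M P d n.
       case n of
         0 \<Rightarrow> \<forall>x\<in>carrier (P 0). \<theta> x = \<eta> x
       | Suc k \<Rightarrow> \<exists>\<zeta>\<in>rmod_hom R (P k) M. \<forall>x\<in>carrier (P n). \<theta> x = \<eta> x \<oplus>\<^bsub>M\<^esub> \<zeta> (d n x)}"

definition degree_cocycles ::
  "('k, 'r, 'c) graded_scheme \<Rightarrow> ('r, 'm, 'd) graded_scheme \<Rightarrow> (nat \<Rightarrow> ('r, 'p) graded)
     \<Rightarrow> (nat \<Rightarrow> 'p \<Rightarrow> 'p) \<Rightarrow> nat \<Rightarrow> ('p \<Rightarrow> 'm) set"
  where "degree_cocycles R M P d n = cocycles R M P d n \<inter> graded_hom R (- int n) (P n) M"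

text \<open>\<open>\<Delta>\<^sup>n = Ext\<^sup>n(M, M)\<^sub>-\<^sub>n\<close>\<close>

definition Delta ::
  "('k, 'r, 'c) graded_scheme \<Rightarrow> ('r, 'm, 'd) graded_scheme \<Rightarrow> (nat \<Rightarrow> ('r, 'p) graded)
     \<Rightarrow> (nat \<Rightarrow> 'p \<Rightarrow> 'p) \<Rightarrow> nat \<Rightarrow> ('p \<Rightarrow> 'm) set set"
  where "Delta R M P d n = ext_class R M P d n ` degree_cocycles R M P d n"

definition liftings ::
  "('k, 'r, 'c) graded_scheme \<Rightarrow> (nat \<Rightarrow> ('r, 'p) graded) \<Rightarrow> ('p \<Rightarrow> 'm) \<Rightarrow> (nat \<Rightarrow> 'p \<Rightarrow> 'p)
     \<Rightarrow> nat \<Rightarrow> ('p \<Rightarrow> 'm) \<Rightarrow> (nat \<Rightarrow> 'p \<Rightarrow> 'p) \<Rightarrow> bool"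
  where "liftings R P \<epsilon> d n \<eta> l \<longleftrightarrow>
    (\<forall>i. l i \<in> graded_hom R (- int n) (P (n + i)) (P i)) \<and>
    (\<forall>x\<in>carrier (P n). \<epsilon> (l 0 x) = \<eta> x) \<and>
    (\<forall>i. \<forall>x\<in>carrier (P (n + Suc i)). d (Suc i) (l (Suc i) x) = l i (d (n + Suc i) x))"


text \<open>
  The liftings \<open>l i\<close> of all degrees \<open>i\<close> are eligible, with respect to a representative of degree
  \<open>-n\<close> of the class \<open>E\<close>.
\<close>

definition some_lifting_isomorphism ::
  "('k, 'r, 'c) graded_scheme \<Rightarrow> ('r, 'm, 'd) graded_scheme \<Rightarrow> (nat \<Rightarrow> ('r, 'p) graded)
     \<Rightarrow> ('p \<Rightarrow> 'm) \<Rightarrow> (nat \<Rightarrow> 'p \<Rightarrow> 'p) \<Rightarrow> bool"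
  where "some_lifting_isomorphism R M P \<epsilon> d \<longleftrightarrow>
    (\<exists>n\<ge>1. \<exists>E\<in>Delta R M P d n. \<exists>\<eta>\<in>E \<inter> degree_cocycles R M P d n. \<exists>l i.
       liftings R P \<epsilon> d n \<eta> l \<and> bij_betw (l i) (carrier (P (n + i))) (carrier (P i)))"

definition some_lifting_monomorphism ::
  "('k, 'r, 'c) graded_scheme \<Rightarrow> ('r, 'm, 'd) graded_scheme \<Rightarrow> (nat \<Rightarrow> ('r, 'p) graded)
     \<Rightarrow> ('p \<Rightarrow> 'm) \<Rightarrow> (nat \<Rightarrow> 'p \<Rightarrow> 'p) \<Rightarrow> bool"
  where "some_lifting_monomorphism R M P \<epsilon> d \<longleftrightarrow>
    (\<exists>n\<ge>1. \<exists>E\<in>Delta R M P d n. \<exists>\<eta>\<in>E \<inter> degree_cocycles R M P d n. \<exists>l i.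
       liftings R P \<epsilon> d n \<eta> l \<and> inj_on (l i) (carrier (P (n + i))))"


section \<open>Syzygies and periodicity\<close>

text \<open>
  For \<open>n \<ge> 1\<close>, the \<open>n\<close>-th syzygy as the image of \<open>d n\<close> in \<open>P (n - 1)\<close>. By
  \<open>linear_resolution_minimal\<close> below a linear resolution is minimal, so that this is \<open>\<Omega>\<^sup>n M\<close> for
  the terms and differentials of a linear resolution of \<open>M\<close>.
\<close>

definition syzygy :: "(nat \<Rightarrow> ('r, 'p) graded) \<Rightarrow> (nat \<Rightarrow> 'p \<Rightarrow> 'p) \<Rightarrow> nat \<Rightarrow> ('r, 'p) graded"
  where "syzygy P d n =
    (P (n - 1))\<lparr>carrier := d n ` carrier (P n),
                homog := (\<lambda>i. homog (P (n - 1)) i \<inter> d n ` carrier (P n))\<rparr>"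

definition periodic ::
  "('k, 'r, 'c) graded_scheme \<Rightarrow> ('r, 'm, 'd) graded_scheme \<Rightarrow> (nat \<Rightarrow> ('r, 'p) graded)
     \<Rightarrow> (nat \<Rightarrow> 'p \<Rightarrow> 'p) \<Rightarrow> bool"
  where "periodic R M P d \<longleftrightarrow> (\<exists>n\<ge>1. rmod_isomorphic R (syzygy P d n) M)"

text \<open>The case distinction is due to \<open>\<Omega>\<^sup>0 M = M\<close> living on a different type.\<close>

definition eventually_periodic ::
  "('k, 'r, 'c) graded_scheme \<Rightarrow> ('r, 'm, 'd) graded_scheme \<Rightarrow> (nat \<Rightarrow> ('r, 'p) graded)
     \<Rightarrow> (nat \<Rightarrow> 'p \<Rightarrow> 'p) \<Rightarrow> bool"
  where "eventually_periodic R M P d \<longleftrightarrow>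
    (\<exists>a. \<exists>n\<ge>1. if a = 0 then rmod_isomorphic R (syzygy P d (a + n)) M
                else rmod_isomorphic R (syzygy P d (a + n)) (syzygy P d a))"


section \<open>Linear resolutions are minimal\<close>

lemma decomposes_component:
  assumes "direct_sum_decomposition M (homog M)" "x \<in> carrier M"
  shows "decomposes M (homog M) x (\<lambda>i. component M i x)"
proof -
  have ex: "\<exists>!f. decomposes M (homog M) x f"
    using assms unfolding direct_sum_decomposition_def by blast
  from theI'[OF ex] show ?thesis
    unfolding component_def by simp
qed

lemma component_eqI:
  assumes "direct_sum_decomposition M (homog M)" "x \<in> carrier M" "decomposes M (homog M) x f"
  shows "component M i x = f i"
proof -
  have ex: "\<exists>!f. decomposes M (homog M) x f"
    using assms unfolding direct_sum_decomposition_def by blast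
  with assms(3) have "(THE f. decomposes M (homog M) x f) = f"
    by (simp add: the1_equality)
  then show ?thesis
    unfolding component_def by simp
qed

lemma homog_subset:
  "direct_sum_decomposition M (homog M) \<Longrightarrow> homog M i \<subseteq> carrier M"
  unfolding direct_sum_decomposition_def using additive_subgroup.a_subset by blast

lemma component_homog:
  assumes M: "abelian_group M" and D: "direct_sum_decomposition M (homog M)" and x: "x \<in> homog M i"
  shows "component M j x = (if j = i then x else \<zero>\<^bsub>M\<^esub>)"
proof -
  interpret M: abelian_group M by fact
  let ?f = "\<lambda>j. if j = i then x else \<zero>\<^bsub>M\<^esub>"
  have xc: "x \<in> carrier M" using homog_subset[OF D] x by auto
  have z: "\<zero>\<^bsub>M\<^esub> \<in> homog M j" for j
    using D unfolding direct_sum_decomposition_def by (meson additive_subgroup.zero_closed)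
  have s: "{j. ?f j \<noteq> \<zero>\<^bsub>M\<^esub>} = (if x = \<zero>\<^bsub>M\<^esub> then {} else {i})" by auto
  have "decomposes M (homog M) x ?f"
    unfolding decomposes_def s using x z xc
    by (auto simp: M.finsum_empty M.finsum_insert)
  from component_eqI[OF D xc this] show ?thesis .
qed

lemma component_add:
  assumes M: "abelian_group M" and D: "direct_sum_decomposition M (homog M)"
    and x: "x \<in> carrier M" and y: "y \<in> carrier M"
  shows "component M j (x \<oplus>\<^bsub>M\<^esub> y) = component M j x \<oplus>\<^bsub>M\<^esub> component M j y"
proof -
  interpret M: abelian_group M by fact
  let ?f = "\<lambda>i. component M i x" and ?g = "\<lambda>i. component M i y"
  let ?h = "\<lambda>i. ?f i \<oplus>\<^bsub>M\<^esub> ?g i"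
  have f: "decomposes M (homog M) x ?f" and g: "decomposes M (homog M) y ?g"
    by (rule decomposes_component[OF D x], rule decomposes_component[OF D y])
  have fc: "?f i \<in> carrier M" and gc: "?g i \<in> carrier M" for i
    using f g homog_subset[OF D] unfolding decomposes_def by blast+
  let ?F = "{i. ?f i \<noteq> \<zero>\<^bsub>M\<^esub>}" and ?G = "{i. ?g i \<noteq> \<zero>\<^bsub>M\<^esub>}" and ?H = "{i. ?h i \<noteq> \<zero>\<^bsub>M\<^esub>}"
  let ?U = "?F \<union> ?G"
  have fin: "finite ?U" using f g unfolding decomposes_def by simp
  have HU: "?H \<subseteq> ?U" by auto
  have ext: "finsum M u A = finsum M u ?U"
    if "A \<subseteq> ?U" "\<And>i. u i \<in> carrier M" "\<And>i. i \<in> ?U - A \<Longrightarrow> u i = \<zero>\<^bsub>M\<^esub>" for u A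
    by (rule M.add.finprod_mono_neutral_cong_left) (use that fin in auto)
  have "finsum M ?f ?F = finsum M ?f ?U" by (rule ext) (use fc in auto)
  moreover have "finsum M ?g ?G = finsum M ?g ?U" by (rule ext) (use gc in auto)
  moreover have "x = finsum M ?f ?F" "y = finsum M ?g ?G"
    using f g unfolding decomposes_def by blast+
  ultimately have xU: "x = finsum M ?f ?U" and yU: "y = finsum M ?g ?U" by metis+
  have hU: "finsum M ?h ?U = finsum M ?f ?U \<oplus>\<^bsub>M\<^esub> finsum M ?g ?U"
    by (rule M.finsum_addf) (use fc gc in auto)
  have "finsum M ?h ?H = finsum M ?h ?U" by (rule ext[OF HU]) (use fc gc in auto)
  with hU xU yU have "x \<oplus>\<^bsub>M\<^esub> y = finsum M ?h ?H" by metis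
  moreover have "?h i \<in> homog M i" for i
    using f g D unfolding decomposes_def direct_sum_decomposition_def
    by (meson additive_subgroup.a_closed)
  ultimately have "decomposes M (homog M) (x \<oplus>\<^bsub>M\<^esub> y) ?h"
    using finite_subset[OF HU fin] unfolding decomposes_def by blast
  from component_eqI[OF D _ this] x y show ?thesis by simp
qed

lemma component_zero:
  assumes M: "abelian_group M" and D: "direct_sum_decomposition M (homog M)"
  shows "component M j \<zero>\<^bsub>M\<^esub> = \<zero>\<^bsub>M\<^esub>"
proof -
  have "\<zero>\<^bsub>M\<^esub> \<in> homog M j"
    using D unfolding direct_sum_decomposition_def by (meson additive_subgroup.zero_closed)
  from component_homog[OF M D this, of j] show ?thesis by simp
qed

lemma component_minus:
  assumes M: "abelian_group M" and D: "direct_sum_decomposition M (homog M)"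
    and x: "x \<in> carrier M"
  shows "component M j (\<ominus>\<^bsub>M\<^esub> x) = \<ominus>\<^bsub>M\<^esub> component M j x"
proof -
  interpret M: abelian_group M by fact
  have c: "component M j y \<in> carrier M" if "y \<in> carrier M" for y
    using decomposes_component[OF D that] homog_subset[OF D] unfolding decomposes_def by blast
  have "component M j (\<ominus>\<^bsub>M\<^esub> x) \<oplus>\<^bsub>M\<^esub> component M j x = \<zero>\<^bsub>M\<^esub>"
    using component_add[OF M D, of "\<ominus>\<^bsub>M\<^esub> x" x j] component_zero[OF M D] x
    by (simp add: M.l_neg)
  then show ?thesis using c x by (simp add: M.minus_equality)
qed

lemma finsum_in_subgroup:
  assumes M: "abelian_group M" and H: "additive_subgroup H M"
    and A: "finite A" "\<And>i. i \<in> A \<Longrightarrow> f i \<in> H"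
  shows "finsum M f A \<in> H"
proof -
  interpret M: abelian_group M by fact
  have sub: "H \<subseteq> carrier M" by (rule additive_subgroup.a_subset[OF H])
  from A show ?thesis
  proof (induction A rule: finite_induct)
    case empty
    then show ?case by (simp add: additive_subgroup.zero_closed[OF H])
  next
    case (insert i A)
    then have "f \<in> A \<rightarrow> carrier M" "f i \<in> carrier M" using sub by auto
    with insert show ?case
      by (simp add: M.finsum_insert additive_subgroup.a_closed[OF H])
  qed
qed

lemma (in abelian_group) additive_subgroupI':
  assumes "H \<subseteq> carrier G" "\<zero> \<in> H" "\<And>x y. \<lbrakk>x \<in> H; y \<in> H\<rbrakk> \<Longrightarrow> x \<oplus> y \<in> H"
    "\<And>x. x \<in> H \<Longrightarrow> \<ominus> x \<in> H"
  shows "additive_subgroup H G"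
  by (rule additive_subgroupI, rule add.subgroupI) (use assms in \<open>auto simp: a_inv_def\<close>)

lemma submodule_iff:
  "submodule N R M \<longleftrightarrow>
     additive_subgroup N M \<and> (\<forall>r\<in>carrier R. \<forall>x\<in>N. r \<odot>\<^bsub>M\<^esub> x \<in> N)"
  unfolding submodule_def submodule_axioms_def additive_subgroup_def by blast

lemma submodule_rmod_span:
  assumes M: "right_module R M" and S: "S \<subseteq> carrier M"
  shows "submodule (rmod_span R M S) R M" "S \<subseteq> rmod_span R M S"
    "\<And>N. \<lbrakk>submodule N R M; S \<subseteq> N\<rbrakk> \<Longrightarrow> rmod_span R M S \<subseteq> N"
proof -
  interpret right_module R M by fact
  have c: "submodule (carrier M) R M"
    unfolding submodule_iff
    by (auto intro!: M.additive_subgroupI' act_closed)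
  show "submodule (rmod_span R M S) R M"
    unfolding submodule_iff
  proof (intro conjI ballI M.additive_subgroupI')
    show "rmod_span R M S \<subseteq> carrier M"
      unfolding rmod_span_def using c S by blast
  qed (auto simp: rmod_span_def submodule_iff
      intro: additive_subgroup.zero_closed additive_subgroup.a_closed
        additive_subgroup.a_inv_closed)
qed (auto simp: rmod_span_def)

lemma homog_above_in_radical:
  assumes A: "graded_algebra K R" and P: "graded_module R P" and gen: "generated_in_degree R P n"
    and z: "z \<in> homog P (n + 1)"
  shows "z \<in> rmod_span R P {r \<odot>\<^bsub>P\<^esub> x | r x. r \<in> irrelevant_ideal R \<and> x \<in> carrier P}"
proof -
  interpret right_module R P using P unfolding graded_module_def by blast
  have abP: "abelian_group P" and abR: "abelian_group R"
    by (rule M.abelian_group_axioms, rule R.abelian_group_axioms)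
  have rm: "right_module R P" by (rule right_module_axioms)
  have D: "direct_sum_decomposition P (homog P)" and DR: "direct_sum_decomposition R (homog R)"
    and deg: "\<And>i j x r. \<lbrakk>x \<in> homog P i; r \<in> homog R j\<rbrakk> \<Longrightarrow> r \<odot>\<^bsub>P\<^esub> x \<in> homog P (i + j)"
    and neg: "\<And>i. i < 0 \<Longrightarrow> homog R i = {\<zero>\<^bsub>R\<^esub>}"
    using A P unfolding graded_module_def graded_algebra_def by blast+
  have sgP: "additive_subgroup (homog P i) P" for i
    using D unfolding direct_sum_decomposition_def by blast
  note subP = homog_subset[OF D] and subR = homog_subset[OF DR]
  let ?S = "{r \<odot>\<^bsub>P\<^esub> x | r x. r \<in> irrelevant_ideal R \<and> x \<in> carrier P}"
  let ?N = "rmod_span R P ?S"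
  have Ssub: "?S \<subseteq> carrier P" by (auto simp: irrelevant_ideal_def act_closed)
  have smN: "submodule ?N R P" and SN: "?S \<subseteq> ?N"
    using submodule_rmod_span[OF rm Ssub] by auto
  have sgN: "additive_subgroup ?N P" using smN unfolding submodule_iff by blast
  have homR: "r \<in> irrelevant_ideal R" if "r \<in> homog R i" "i > 0" for r i
    using that subR component_homog[OF abR DR that(1), of 0] unfolding irrelevant_ideal_def by auto
  have act0: "r \<odot>\<^bsub>P\<^esub> \<zero>\<^bsub>P\<^esub> = \<zero>\<^bsub>P\<^esub>" if "r \<in> carrier R" for r
    using act_add_module[OF that M.zero_closed M.zero_closed] act_closed[OF that M.zero_closed]
    by (metis M.add.l_cancel_one M.l_zero M.zero_closed)
  have act0': "\<zero>\<^bsub>R\<^esub> \<odot>\<^bsub>P\<^esub> x = \<zero>\<^bsub>P\<^esub>" if "x \<in> carrier P" for x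
    using act_add_ring[OF R.zero_closed R.zero_closed that] act_closed[OF R.zero_closed that]
    by (metis M.add.l_cancel_one R.l_zero R.zero_closed)
  have cmp: "component P i x \<in> carrier P" "component P i x \<in> homog P i" if "x \<in> carrier P" for i x
    using decomposes_component[OF D that] subP unfolding decomposes_def by blast+
  have act_sum: "finsum R f A \<odot>\<^bsub>P\<^esub> x = finsum P (\<lambda>i. f i \<odot>\<^bsub>P\<^esub> x) A"
    if "finite A" "\<And>i. i \<in> A \<Longrightarrow> f i \<in> carrier R" "x \<in> carrier P" for f and A :: "int set" and x
    using that(1,2)
  proof (induction A rule: finite_induct)
    case (insert i A)
    then have "f \<in> A \<rightarrow> carrier R" "(\<lambda>i. f i \<odot>\<^bsub>P\<^esub> x) \<in> A \<rightarrow> carrier P"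
      using act_closed that(3) by auto
    with insert that(3) show ?case
      by (simp add: R.finsum_insert M.finsum_insert act_add_ring act_closed R.finsum_closed)
  qed (simp add: act0' that)
  have sum_act: "r \<odot>\<^bsub>P\<^esub> finsum P f A = finsum P (\<lambda>i. r \<odot>\<^bsub>P\<^esub> f i) A"
    if "finite A" "\<And>i. i \<in> A \<Longrightarrow> f i \<in> carrier P" "r \<in> carrier R" for f and A :: "int set" and r
    using that(1,2)
  proof (induction A rule: finite_induct)
    case (insert i A)
    then have "f \<in> A \<rightarrow> carrier P" "(\<lambda>i. r \<odot>\<^bsub>P\<^esub> f i) \<in> A \<rightarrow> carrier P"
      using act_closed that(3) by auto
    with insert that(3) show ?case
      by (simp add: M.finsum_insert act_add_module act_closed M.finsum_closed)
  qed (simp add: act0 that)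
  define U where "U = {w \<in> carrier P. \<forall>j\<le>n. component P j w = \<zero>\<^bsub>P\<^esub>}"
  have sgU: "additive_subgroup U P"
  proof (rule M.additive_subgroupI')
    show "\<zero>\<^bsub>P\<^esub> \<in> U"
      using component_zero[OF abP D] unfolding U_def by simp
  qed (auto simp: U_def component_add[OF abP D] component_minus[OF abP D])
  have homU: "x \<in> U" if "x \<in> homog P i" "i > n" for x i
    using that subP component_homog[OF abP D that(1)] unfolding U_def by auto
  have smU: "r \<odot>\<^bsub>P\<^esub> w \<in> U" if w: "w \<in> U" and r: "r \<in> carrier R" for r w
  proof -
    have wc: "w \<in> carrier P" using w unfolding U_def by blast
    let ?f = "\<lambda>i. component P i w" and ?g = "\<lambda>i. component R i r"
    have f: "decomposes P (homog P) w ?f" and g: "decomposes R (homog R) r ?g"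
      by (rule decomposes_component[OF D wc], rule decomposes_component[OF DR r])
    let ?F = "{i. ?f i \<noteq> \<zero>\<^bsub>P\<^esub>}" and ?G = "{i. ?g i \<noteq> \<zero>\<^bsub>R\<^esub>}"
    have finF: "finite ?F" and finG: "finite ?G" and weq: "w = finsum P ?f ?F"
      and req: "r = finsum R ?g ?G" and gh: "\<And>i. ?g i \<in> homog R i"
      using f g unfolding decomposes_def by blast+
    have gc: "?g i \<in> carrier R" for i using gh subR by blast
    have Fn: "i > n" if "i \<in> ?F" for i
      using w that unfolding U_def by (metis (mono_tags, lifting) mem_Collect_eq not_le_imp_less)
    have Gn: "i \<ge> 0" if "i \<in> ?G" for i
      using gh[of i] neg[of i] that by force
    have "r \<odot>\<^bsub>P\<^esub> ?f i \<in> U" if i: "i \<in> ?F" for i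
    proof -
      have "?g j \<odot>\<^bsub>P\<^esub> ?f i \<in> U" if "j \<in> ?G" for j
        using deg[OF cmp(2)[OF wc] gh, of j i] Fn[OF i] Gn[OF that] homU by auto
      then have "finsum P (\<lambda>j. ?g j \<odot>\<^bsub>P\<^esub> ?f i) ?G \<in> U"
        by (intro finsum_in_subgroup[OF abP sgU finG])
      moreover have "finsum R ?g ?G \<odot>\<^bsub>P\<^esub> ?f i = finsum P (\<lambda>j. ?g j \<odot>\<^bsub>P\<^esub> ?f i) ?G"
        by (rule act_sum[OF finG gc cmp(1)[OF wc]])
      ultimately show ?thesis using req by simp
    qed
    then have "finsum P (\<lambda>i. r \<odot>\<^bsub>P\<^esub> ?f i) ?F \<in> U"
      by (intro finsum_in_subgroup[OF abP sgU finF])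
    moreover have "r \<odot>\<^bsub>P\<^esub> finsum P ?f ?F = finsum P (\<lambda>i. r \<odot>\<^bsub>P\<^esub> ?f i) ?F"
      by (rule sum_act[OF finF cmp(1)[OF wc] r])
    ultimately show ?thesis using weq by simp
  qed
  define V where "V = {y. \<exists>p\<in>homog P n. \<exists>w\<in>?N \<inter> U. y = p \<oplus>\<^bsub>P\<^esub> w}"
  have sgNU: "additive_subgroup (?N \<inter> U) P"
    using sgN sgU
    by (intro M.additive_subgroupI')
      (auto intro: additive_subgroup.zero_closed additive_subgroup.a_closed
        additive_subgroup.a_inv_closed dest: additive_subgroup.a_Hcarr)
  have sgV: "additive_subgroup V P"
  proof -
    have "V = homog P n <+>\<^bsub>P\<^esub> (?N \<inter> U)"
      unfolding V_def set_add_def set_mult_def by auto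
    then show ?thesis using M.add_additive_subgroups[OF sgP[of n] sgNU] by simp
  qed
  have NUc: "w \<in> carrier P" if "w \<in> ?N \<inter> U" for w
    using that unfolding U_def by blast
  have inV: "w \<in> V" if "w \<in> ?N \<inter> U" for w
  proof -
    have "w = \<zero>\<^bsub>P\<^esub> \<oplus>\<^bsub>P\<^esub> w" using NUc[OF that] by simp
    then show ?thesis unfolding V_def using additive_subgroup.zero_closed[OF sgP[of n]] that by blast
  qed
  have homV: "p \<in> V" if "p \<in> homog P n" for p
  proof -
    have "p = p \<oplus>\<^bsub>P\<^esub> \<zero>\<^bsub>P\<^esub>" using subP that by (simp add: subset_iff)
    then show ?thesis unfolding V_def using additive_subgroup.zero_closed[OF sgNU] that by blast
  qed
  have actp: "r \<odot>\<^bsub>P\<^esub> p \<in> V" if p: "p \<in> homog P n" and r: "r \<in> carrier R" for r p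
  proof -
    have pc: "p \<in> carrier P" using p subP by blast
    let ?g = "\<lambda>i. component R i r"
    have g: "decomposes R (homog R) r ?g" by (rule decomposes_component[OF DR r])
    let ?G = "{i. ?g i \<noteq> \<zero>\<^bsub>R\<^esub>}"
    have finG: "finite ?G" and req: "r = finsum R ?g ?G" and gh: "\<And>i. ?g i \<in> homog R i"
      using g unfolding decomposes_def by blast+
    have gc: "?g i \<in> carrier R" for i using gh subR by blast
    have "?g j \<odot>\<^bsub>P\<^esub> p \<in> V" if "j \<in> ?G" for j
    proof -
      have "j \<ge> 0" using gh[of j] neg[of j] that by force
      have h: "?g j \<odot>\<^bsub>P\<^esub> p \<in> homog P (n + j)" by (rule deg[OF p gh])
      then have hc: "?g j \<odot>\<^bsub>P\<^esub> p \<in> carrier P" using subP by blast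
      show ?thesis
      proof (cases "j = 0")
        case True
        then show ?thesis using homV h by simp
      next
        case False
        with \<open>j \<ge> 0\<close> have "j > 0" by simp
        then have "?g j \<odot>\<^bsub>P\<^esub> p \<in> ?N \<inter> U"
          using homU[OF h] SN homR[OF gh] pc by auto
        then show ?thesis by (rule inV)
      qed
    qed
    then have "finsum P (\<lambda>j. ?g j \<odot>\<^bsub>P\<^esub> p) ?G \<in> V"
      by (intro finsum_in_subgroup[OF abP sgV finG])
    moreover have "finsum R ?g ?G \<odot>\<^bsub>P\<^esub> p = finsum P (\<lambda>j. ?g j \<odot>\<^bsub>P\<^esub> p) ?G"
      by (rule act_sum[OF finG gc pc])
    ultimately show ?thesis using req by simp
  qed
  have smV: "submodule V R P"
    unfolding submodule_iff
  proof (intro conjI ballI sgV)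
    fix r y assume r: "r \<in> carrier R" and "y \<in> V"
    then obtain p w where p: "p \<in> homog P n" and w: "w \<in> ?N \<inter> U" and y: "y = p \<oplus>\<^bsub>P\<^esub> w"
      unfolding V_def by blast
    have pc: "p \<in> carrier P" using p subP by blast
    have "r \<odot>\<^bsub>P\<^esub> w \<in> ?N \<inter> U"
      using w r smU smN unfolding submodule_iff by blast
    then show "r \<odot>\<^bsub>P\<^esub> y \<in> V"
      using act_add_module[OF r pc NUc[OF w]] y actp[OF p r] inV
        additive_subgroup.a_closed[OF sgV] by simp
  qed
  have "homog P n \<subseteq> V" using homV by blast
  then have "carrier P \<subseteq> V"
    using submodule_rmod_span(3)[OF rm subP smV] gen unfolding generated_in_degree_def by blast
  with z subP have "z \<in> V" by blast
  then obtain p w where p: "p \<in> homog P n" and w: "w \<in> ?N \<inter> U" and zpw: "z = p \<oplus>\<^bsub>P\<^esub> w"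
    unfolding V_def by blast
  have pc: "p \<in> carrier P" using p subP by blast
  have "\<zero>\<^bsub>P\<^esub> = component P n z"
    using component_homog[OF abP D z, of n] by simp
  also have "\<dots> = component P n p \<oplus>\<^bsub>P\<^esub> component P n w"
    unfolding zpw by (rule component_add[OF abP D pc NUc[OF w]])
  also have "\<dots> = p"
    using component_homog[OF abP D p, of n] w pc unfolding U_def by simp
  finally have "z = w" using zpw NUc[OF w] M.l_zero by metis
  with w show ?thesis by blast
qed

theorem linear_resolution_minimal:
  assumes A: "graded_algebra K R" and L: "linear_resolution R M P \<epsilon> d"
  shows "minimal_resolution R M P \<epsilon> d"
  unfolding minimal_resolution_def
proof (intro conjI allI)
  show res: "graded_projective_resolution R M P \<epsilon> d"
    using L unfolding linear_resolution_def by blast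
  fix n
  have gP: "graded_module R (P n)" "graded_module R (P (Suc n))"
    and dh: "d (Suc n) \<in> graded_hom R 0 (P (Suc n)) (P n)"
    using res unfolding graded_projective_resolution_def by auto
  have gen: "generated_in_degree R (P n) (int n)" "generated_in_degree R (P (Suc n)) (int (Suc n))"
    using L unfolding linear_resolution_def by blast+
  interpret Q: right_module R "P n" using gP unfolding graded_module_def by blast
  interpret T: right_module R "P (Suc n)" using gP unfolding graded_module_def by blast
  have D: "direct_sum_decomposition (P (Suc n)) (homog (P (Suc n)))"
    using gP unfolding graded_module_def by blast
  let ?S = "{r \<odot>\<^bsub>P n\<^esub> x | r x. r \<in> irrelevant_ideal R \<and> x \<in> carrier (P n)}"
  let ?N = "rmod_span R (P n) ?S"
  have Ssub: "?S \<subseteq> carrier (P n)" by (auto simp: irrelevant_ideal_def Q.act_closed)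
  have smN: "submodule ?N R (P n)"
    using submodule_rmod_span[OF Q.right_module_axioms Ssub] by auto
  then have sgN: "additive_subgroup ?N (P n)"
    and actN: "\<And>r x. \<lbrakk>r \<in> carrier R; x \<in> ?N\<rbrakk> \<Longrightarrow> r \<odot>\<^bsub>P n\<^esub> x \<in> ?N"
    unfolding submodule_iff by blast+
  have dcl: "\<And>x. x \<in> carrier (P (Suc n)) \<Longrightarrow> d (Suc n) x \<in> carrier (P n)"
    and dadd: "\<And>x y. \<lbrakk>x \<in> carrier (P (Suc n)); y \<in> carrier (P (Suc n))\<rbrakk> \<Longrightarrow>
        d (Suc n) (x \<oplus>\<^bsub>P (Suc n)\<^esub> y) = d (Suc n) x \<oplus>\<^bsub>P n\<^esub> d (Suc n) y"
    and dact: "\<And>r x. \<lbrakk>r \<in> carrier R; x \<in> carrier (P (Suc n))\<rbrakk> \<Longrightarrow>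
        d (Suc n) (r \<odot>\<^bsub>P (Suc n)\<^esub> x) = r \<odot>\<^bsub>P n\<^esub> d (Suc n) x"
    using dh unfolding graded_hom_def rmod_hom_def by auto
  have ddeg: "d (Suc n) x \<in> homog (P n) k" if "x \<in> homog (P (Suc n)) k" for k x
    using dh that unfolding graded_hom_def by (simp add: image_subset_iff)
  have d0: "d (Suc n) \<zero>\<^bsub>P (Suc n)\<^esub> = \<zero>\<^bsub>P n\<^esub>"
    using dadd[OF T.M.zero_closed T.M.zero_closed] dcl[OF T.M.zero_closed]
    by (metis Q.M.add.l_cancel_one T.M.l_zero T.M.zero_closed)
  have dneg: "d (Suc n) (\<ominus>\<^bsub>P (Suc n)\<^esub> x) = \<ominus>\<^bsub>P n\<^esub> d (Suc n) x"
    if "x \<in> carrier (P (Suc n))" for x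
    using dadd[of "\<ominus>\<^bsub>P (Suc n)\<^esub> x" x] that dcl d0
    by (simp add: T.M.l_neg Q.M.minus_equality)
  let ?V = "{x \<in> carrier (P (Suc n)). d (Suc n) x \<in> ?N}"
  have "submodule ?V R (P (Suc n))"
    unfolding submodule_iff
  proof (intro conjI ballI T.M.additive_subgroupI')
    show "\<zero>\<^bsub>P (Suc n)\<^esub> \<in> ?V"
      using d0 additive_subgroup.zero_closed[OF sgN] by simp
  next
    fix x y assume "x \<in> ?V" "y \<in> ?V"
    then show "x \<oplus>\<^bsub>P (Suc n)\<^esub> y \<in> ?V"
      using dadd additive_subgroup.a_closed[OF sgN] by simp
  next
    fix x assume "x \<in> ?V"
    then show "\<ominus>\<^bsub>P (Suc n)\<^esub> x \<in> ?V"
      using dneg additive_subgroup.a_inv_closed[OF sgN] by simp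
  next
    fix r x assume "r \<in> carrier R" "x \<in> ?V"
    then show "r \<odot>\<^bsub>P (Suc n)\<^esub> x \<in> ?V"
      using dact actN T.act_closed by simp
  qed auto
  moreover have "homog (P (Suc n)) (int (Suc n)) \<subseteq> ?V"
    using homog_subset[OF D] homog_above_in_radical[OF A gP(1) gen(1)] ddeg
    by (auto simp: add.commute)
  ultimately have "carrier (P (Suc n)) \<subseteq> ?V"
    using submodule_rmod_span(3)[OF T.right_module_axioms homog_subset[OF D]] gen(2)
    unfolding generated_in_degree_def by blast
  then show "d (Suc n) ` carrier (P (Suc n)) \<subseteq> ?N" by blast
qed

end

theory Submission
  imports Defs
begin

text \<open>
  Since \<open>R\<^sub>0 = K \<times> \<dots> \<times> K\<close>, a term \<open>P n\<close> of a linear resolution is \<open>(P n)\<^sub>n \<otimes> R\<close> over \<open>R\<^sub>0\<close>, so a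
  homogeneous map between two terms is injective (bijective) as soon as it is so on the finite-dimensional
  generating spaces \<open>(P n)\<^sub>n\<close>.

  If one lifting is a monomorphism, so are all later ones, because the differential embeds \<open>(P j)\<^sub>j\<close> into
  \<open>P (j - 1)\<close>. Comparing dimensions of generating spaces, some later lifting is an isomorphism, and the
  preceding one restricts to an isomorphism of syzygies.

  Conversely, lifting an ungraded isomorphism \<open>\<Omega>\<^sup>a\<^sup>+\<^sup>n M \<cong> \<Omega>\<^sup>a M\<close> to the projective covers and taking the part of
  degree \<open>-n\<close> gives an isomorphism \<open>P (a + n) \<cong> P a\<close> compatible with the next syzygies. For \<open>a = 0\<close> its
  composite with the augmentation is the class sought in (2). If \<open>R\<close> is selfinjective, then the induced
  isomorphism of syzygies and its inverse extend to \<open>F : P (a + n - 1) \<rightarrow> P (a - 1)\<close> and \<open>G\<close> backwards. The map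
  \<open>G F - 1\<close> has degree \<open>0\<close> and kills a syzygy, and such a map is zero: this is where indecomposability and
  infinite projective dimension enter. So \<open>a\<close> can be lowered down to \<open>0\<close>.
\<close>

section \<open>Linear algebra over a field\<close>

text \<open>One obstacle is that the notions are tested on fixed types: projectivity on modules over
  one function type, injectivity on modules of the type of \<open>R\<close>, projective dimension on
  resolutions by sequences. Each is converted once into a form that works for all types.
  Projectivity becomes a homogeneous dual basis, that is, coordinates for a decomposition into
  modules \<open>e i R\<close>; selfinjectivity becomes the extension of functionals by one
  generator at a time; a section of the augmentation is carried over to a resolution of the required
  type. The other obstacle is that periodicity is an ungraded statement, while liftings have degree
  \<open>- n\<close>. It is overcome by minimality: the syzygy inside \<open>P n\<close> has no
  nonzero element of degree \<open>n\<close>, so that a map which is the identity modulo the syzygy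
  is the identity on lowest components. Taking lowest components is compatible with arbitrary
  homomorphisms, because the algebra has no negative degrees.\<close>

lemma (in abelian_group) minus_eq_zero_iff:
  "\<lbrakk>x \<in> carrier G; y \<in> carrier G\<rbrakk> \<Longrightarrow> x \<ominus> y = \<zero> \<longleftrightarrow> x = y"
  by (metis a_minus_def minus_equality minus_minus r_neg a_inv_closed)

context module
begin

definition lincomb :: "('c \<Rightarrow> 'a) \<Rightarrow> 'c set \<Rightarrow> 'c"
  where "lincomb a B = (\<Oplus>\<^bsub>M\<^esub>b\<in>B. a b \<odot>\<^bsub>M\<^esub> b)"

definition lin_hull :: "'c set \<Rightarrow> 'c set"
  where "lin_hull B = {lincomb a B | a. a \<in> B \<rightarrow> carrier R}"

text \<open>A family instead of a set, because elimination replaces all vectors at once: the index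
  set survives, and distinctness of the new vectors does not have to be tracked.\<close>

definition indep_family :: "'i set \<Rightarrow> ('i \<Rightarrow> 'c) \<Rightarrow> bool"
  where "indep_family J c \<longleftrightarrow> c \<in> J \<rightarrow> carrier M \<and>
    (\<forall>a\<in>J \<rightarrow> carrier R. (\<Oplus>\<^bsub>M\<^esub>j\<in>J. a j \<odot>\<^bsub>M\<^esub> c j) = \<zero>\<^bsub>M\<^esub> \<longrightarrow> (\<forall>j\<in>J. a j = \<zero>))"

lemma lincomb_insert:
  assumes "finite B" "b \<notin> B" "insert b B \<subseteq> carrier M" "a \<in> insert b B \<rightarrow> carrier R"
  shows "lincomb a (insert b B) = a b \<odot>\<^bsub>M\<^esub> b \<oplus>\<^bsub>M\<^esub> lincomb a B"
  unfolding lincomb_def using assms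
  by (intro M.finsum_insert) (auto simp: Pi_def subset_iff)

lemma lincomb_closed: "\<lbrakk>B \<subseteq> carrier M; a \<in> B \<rightarrow> carrier R\<rbrakk> \<Longrightarrow> lincomb a B \<in> carrier M"
  unfolding lincomb_def by (intro M.finsum_closed) auto

lemma lin_hull_closed: "\<lbrakk>B \<subseteq> carrier M; x \<in> lin_hull B\<rbrakk> \<Longrightarrow> x \<in> carrier M"
  unfolding lin_hull_def using lincomb_closed by auto

lemma lin_hull_add:
  assumes B: "B \<subseteq> carrier M" and "x \<in> lin_hull B" "y \<in> lin_hull B"
  shows "x \<oplus>\<^bsub>M\<^esub> y \<in> lin_hull B"
proof -
  obtain a a' where a: "a \<in> B \<rightarrow> carrier R" "x = lincomb a B" and
    a': "a' \<in> B \<rightarrow> carrier R" "y = lincomb a' B"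
    using assms unfolding lin_hull_def by auto
  have "x \<oplus>\<^bsub>M\<^esub> y = (\<Oplus>\<^bsub>M\<^esub>b\<in>B. a b \<odot>\<^bsub>M\<^esub> b \<oplus>\<^bsub>M\<^esub> a' b \<odot>\<^bsub>M\<^esub> b)"
    unfolding a a' lincomb_def using a a' B by (intro M.finsum_addf[symmetric]) auto
  also have "\<dots> = lincomb (\<lambda>b. a b \<oplus> a' b) B"
    unfolding lincomb_def using a a' B
    by (intro M.finsum_cong') (auto simp: smult_l_distr Pi_def subset_iff)
  finally show ?thesis
    unfolding lin_hull_def using a a' by (intro CollectI exI[of _ "\<lambda>b. a b \<oplus> a' b"]) auto
qed

lemma lin_hull_smult:
  assumes B: "finite B" "B \<subseteq> carrier M" and "x \<in> lin_hull B" and r: "r \<in> carrier R"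
  shows "r \<odot>\<^bsub>M\<^esub> x \<in> lin_hull B"
proof -
  obtain a where a: "a \<in> B \<rightarrow> carrier R" "x = lincomb a B"
    using assms unfolding lin_hull_def by auto
  have "r \<odot>\<^bsub>M\<^esub> x = (\<Oplus>\<^bsub>M\<^esub>b\<in>B. r \<odot>\<^bsub>M\<^esub> (a b \<odot>\<^bsub>M\<^esub> b))"
    unfolding a lincomb_def using a B r by (intro finsum_smult_ldistr) auto
  also have "\<dots> = lincomb (\<lambda>b. r \<otimes> a b) B"
    unfolding lincomb_def using a B r
    by (intro M.finsum_cong') (auto simp: smult_assoc1 Pi_def subset_iff)
  finally show ?thesis
    unfolding lin_hull_def using a r by (intro CollectI exI[of _ "\<lambda>b. r \<otimes> a b"]) auto
qed

lemma lin_hull_zero: "\<lbrakk>finite B; B \<subseteq> carrier M\<rbrakk> \<Longrightarrow> \<zero>\<^bsub>M\<^esub> \<in> lin_hull B"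
  unfolding lin_hull_def lincomb_def
  by (intro CollectI exI[of _ "\<lambda>_. \<zero>"]) (auto intro!: M.add.finprod_one_eqI[symmetric])

lemma lin_hull_finsum:
  assumes B: "finite B" "B \<subseteq> carrier M" and "finite I" "\<And>i. i \<in> I \<Longrightarrow> f i \<in> lin_hull B"
  shows "(\<Oplus>\<^bsub>M\<^esub>i\<in>I. f i) \<in> lin_hull B"
  using assms(3,4)
proof (induction I rule: finite_induct)
  case (insert i I)
  then have "f \<in> I \<rightarrow> carrier M" "f i \<in> carrier M" using lin_hull_closed[OF B(2)] by auto
  with insert show ?case by (simp add: lin_hull_add[OF B(2)])
qed (simp add: lin_hull_zero B)

lemma lin_hull_subspaceI:
  assumes B: "finite B" "B \<subseteq> carrier M" and x: "x \<in> lin_hull B"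
    and N: "B \<subseteq> N" "N \<subseteq> carrier M" "\<zero>\<^bsub>M\<^esub> \<in> N" "\<And>x y. \<lbrakk>x \<in> N; y \<in> N\<rbrakk> \<Longrightarrow> x \<oplus>\<^bsub>M\<^esub> y \<in> N"
      "\<And>r x. \<lbrakk>r \<in> carrier R; x \<in> N\<rbrakk> \<Longrightarrow> r \<odot>\<^bsub>M\<^esub> x \<in> N"
  shows "x \<in> N"
proof -
  obtain a where a: "a \<in> B \<rightarrow> carrier R" "x = lincomb a B"
    using x unfolding lin_hull_def by auto
  have "lincomb a B \<in> N" if "B \<subseteq> N" "a \<in> B \<rightarrow> carrier R"
    using B(1) that
  proof (induction B rule: finite_induct)
    case empty
    then show ?case using N by (simp add: lincomb_def)
  next
    case (insert b B)
    then have "insert b B \<subseteq> carrier M" using N by auto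
    with insert N show ?case by (auto simp: lincomb_insert)
  qed
  with a N show ?thesis by auto
qed

lemma lin_hull_insert:
  assumes B: "finite B" "b \<notin> B" "insert b B \<subseteq> carrier M"
  shows "x \<in> lin_hull (insert b B) \<longleftrightarrow> (\<exists>\<beta>\<in>carrier R. \<exists>w\<in>lin_hull B. x = \<beta> \<odot>\<^bsub>M\<^esub> b \<oplus>\<^bsub>M\<^esub> w)"
proof
  assume "x \<in> lin_hull (insert b B)"
  then obtain a where a: "a \<in> insert b B \<rightarrow> carrier R" "x = lincomb a (insert b B)"
    unfolding lin_hull_def by auto
  then have "x = a b \<odot>\<^bsub>M\<^esub> b \<oplus>\<^bsub>M\<^esub> lincomb a B" using lincomb_insert B by metis
  moreover have "lincomb a B \<in> lin_hull B" "a b \<in> carrier R" using a unfolding lin_hull_def by auto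
  ultimately show "\<exists>\<beta>\<in>carrier R. \<exists>w\<in>lin_hull B. x = \<beta> \<odot>\<^bsub>M\<^esub> b \<oplus>\<^bsub>M\<^esub> w" by blast
next
  assume "\<exists>\<beta>\<in>carrier R. \<exists>w\<in>lin_hull B. x = \<beta> \<odot>\<^bsub>M\<^esub> b \<oplus>\<^bsub>M\<^esub> w"
  then obtain \<beta> a where a: "\<beta> \<in> carrier R" "a \<in> B \<rightarrow> carrier R" "x = \<beta> \<odot>\<^bsub>M\<^esub> b \<oplus>\<^bsub>M\<^esub> lincomb a B"
    unfolding lin_hull_def by auto
  let ?a = "a(b := \<beta>)"
  have a': "?a \<in> insert b B \<rightarrow> carrier R" using a by auto
  have "lincomb ?a B = lincomb a B"
    unfolding lincomb_def using a B by (intro M.finsum_cong') auto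
  then have "x = lincomb ?a (insert b B)" using lincomb_insert[OF B a'] a by simp
  with a' show "x \<in> lin_hull (insert b B)" unfolding lin_hull_def by blast
qed

lemma lin_hull_incl:
  assumes "finite B" "B \<subseteq> carrier M" "b \<in> B"
  shows "b \<in> lin_hull B"
proof -
  have B: "B = insert b (B - {b})" using assms by auto
  have "b = \<one> \<odot>\<^bsub>M\<^esub> b \<oplus>\<^bsub>M\<^esub> \<zero>\<^bsub>M\<^esub>" using assms by (auto simp: subset_iff)
  moreover have "\<zero>\<^bsub>M\<^esub> \<in> lin_hull (B - {b})" by (rule lin_hull_zero) (use assms in auto)
  ultimately show ?thesis
    using assms by (subst B, subst lin_hull_insert) (auto intro!: bexI[of _ "\<one>"])
qed

lemma finsum_smult_rdistr:
  assumes "finite A" "f \<in> A \<rightarrow> carrier R" "x \<in> carrier M"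
  shows "(\<Oplus>i\<in>A. f i) \<odot>\<^bsub>M\<^esub> x = (\<Oplus>\<^bsub>M\<^esub>i\<in>A. f i \<odot>\<^bsub>M\<^esub> x)"
  using assms
proof (induction A rule: finite_induct)
  case (insert i A)
  then have "f i \<in> carrier R" "f \<in> A \<rightarrow> carrier R" "(\<lambda>i. f i \<odot>\<^bsub>M\<^esub> x) \<in> A \<rightarrow> carrier M" by auto
  with insert show ?case by (simp add: smult_l_distr)
qed simp

text \<open>The scalars in the locale \<open>module\<close> form a commutative ring only;
  \<open>field\<close> is assumed separately wherever a coefficient has to be inverted.\<close>

lemma inverse_exists:
  assumes "field R" "b \<in> carrier R" "b \<noteq> \<zero>"
  shows "\<exists>c\<in>carrier R. c \<otimes> b = \<one>"
proof -
  interpret field R by fact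
  have "b \<in> Units R" using assms field_Units by simp
  then show ?thesis using Units_inv_closed Units_l_inv by blast
qed

text \<open>Steinitz: Gaussian elimination against one spanning vector at a time.\<close>

lemma indep_family_card_le:
  assumes F: "field R" and B: "finite B" "B \<subseteq> carrier M"
    and J: "finite J" "indep_family J c" "c ` J \<subseteq> lin_hull B"
  shows "card J \<le> card B"
  using B J
proof (induction B arbitrary: J c rule: finite_induct)
  case empty
  interpret field R by fact
  have "J = {}"
  proof (rule ccontr)
    assume "J \<noteq> {}"
    then obtain j where j: "j \<in> J" by auto
    have c0: "c i = \<zero>\<^bsub>M\<^esub>" if "i \<in> J" for i
      using empty that by (auto simp: lin_hull_def lincomb_def)
    have "(\<Oplus>\<^bsub>M\<^esub>j\<in>J. \<one> \<odot>\<^bsub>M\<^esub> c j) = \<zero>\<^bsub>M\<^esub>"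
      by (rule M.add.finprod_one_eqI) (simp add: c0)
    then have "\<forall>j\<in>J. \<one> = \<zero>"
      using empty unfolding indep_family_def by (elim conjE ballE[of _ _ "\<lambda>_. \<one>"]) auto
    with j one_not_zero show False by blast
  qed
  then show ?case by simp
next
  case (insert b B)
  have Bc: "B \<subseteq> carrier M" and bc: "b \<in> carrier M" using insert by auto
  have cc: "c j \<in> carrier M" if "j \<in> J" for j using insert that unfolding indep_family_def by auto
  show ?case
  proof (cases "c ` J \<subseteq> lin_hull B")
    case True
    then have "card J \<le> card B" using insert by auto
    then show ?thesis using insert by simp
  next
    case False
    \<comment> \<open>The pivot: a vector outside the hull of \<open>B\<close> has a nonzero
      coefficient at \<open>b\<close>.\<close>
    then obtain j0 where j0: "j0 \<in> J" "c j0 \<notin> lin_hull B" by auto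
    have "\<exists>\<beta> w. \<beta> \<in> carrier R \<and> w \<in> lin_hull B \<and> c j = \<beta> \<odot>\<^bsub>M\<^esub> b \<oplus>\<^bsub>M\<^esub> w" if "j \<in> J" for j
      using insert(6) that lin_hull_insert[OF insert(1,2) insert(4)] insert(7) by blast
    then obtain \<beta> w where bw: "\<And>j. j \<in> J \<Longrightarrow> \<beta> j \<in> carrier R" "\<And>j. j \<in> J \<Longrightarrow> w j \<in> lin_hull B"
      "\<And>j. j \<in> J \<Longrightarrow> c j = \<beta> j \<odot>\<^bsub>M\<^esub> b \<oplus>\<^bsub>M\<^esub> w j"
      by metis
    have wc: "w j \<in> carrier M" if "j \<in> J" for j using bw that lin_hull_closed[OF Bc] by blast
    have "\<beta> j0 \<noteq> \<zero>" using bw j0 wc[OF j0(1)] bc by (metis M.l_zero smult_l_null)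
    then obtain i where i: "i \<in> carrier R" "i \<otimes> \<beta> j0 = \<one>"
      using inverse_exists[OF F] bw j0 by blast
    \<comment> \<open>Chosen so that adding \<open>l j\<close> times the pivot to \<open>c j\<close>
      cancels the coefficient of \<open>b\<close>.\<close>
    define l where "l = (\<lambda>j. \<ominus> (\<beta> j \<otimes> i))"
    have lc: "l j \<in> carrier R" if "j \<in> J" for j using bw i that unfolding l_def by simp
    have lb: "l j \<otimes> \<beta> j0 = \<ominus> \<beta> j" if "j \<in> J" for j
      unfolding l_def using bw i that j0 by (simp add: l_minus m_assoc)
    define c' where "c' = (\<lambda>j. c j \<oplus>\<^bsub>M\<^esub> l j \<odot>\<^bsub>M\<^esub> c j0)"
    have c'B: "c' j \<in> lin_hull B" if j: "j \<in> J" for j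
    proof -
      have "c' j = (\<beta> j \<odot>\<^bsub>M\<^esub> b \<oplus>\<^bsub>M\<^esub> w j) \<oplus>\<^bsub>M\<^esub> ((l j \<otimes> \<beta> j0) \<odot>\<^bsub>M\<^esub> b \<oplus>\<^bsub>M\<^esub> l j \<odot>\<^bsub>M\<^esub> w j0)"
        unfolding c'_def using bw[OF j] bw[OF j0(1)] lc[OF j] wc j0 j bc
        by (simp add: smult_r_distr smult_assoc1)
      also have "\<dots> = w j \<oplus>\<^bsub>M\<^esub> l j \<odot>\<^bsub>M\<^esub> w j0"
        using lb[OF j] bw[OF j] wc j j0 bc lc
        by (simp add: smult_l_minus M.a_ac M.r_neg1 M.a_assoc M.r_neg)
      finally show ?thesis
        using lin_hull_add[OF Bc bw(2)[OF j] lin_hull_smult[OF insert(1) Bc bw(2)[OF j0(1)] lc[OF j]]]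
        by simp
    qed
    let ?J = "J - {j0}"
    have fJ: "finite ?J" using insert by simp
    have ind: "indep_family ?J c'"
      unfolding indep_family_def
    proof (intro conjI ballI impI)
      show "c' \<in> ?J \<rightarrow> carrier M" unfolding c'_def using cc lc j0 by auto
      fix a j assume a: "a \<in> ?J \<rightarrow> carrier R" and s: "(\<Oplus>\<^bsub>M\<^esub>j\<in>?J. a j \<odot>\<^bsub>M\<^esub> c' j) = \<zero>\<^bsub>M\<^esub>" and j: "j \<in> ?J"
      have al: "(\<lambda>j. a j \<otimes> l j) \<in> ?J \<rightarrow> carrier R" using a lc by auto
      have cs: "(\<lambda>j. a j \<odot>\<^bsub>M\<^esub> c j) \<in> ?J \<rightarrow> carrier M"
        "(\<lambda>j. (a j \<otimes> l j) \<odot>\<^bsub>M\<^esub> c j0) \<in> ?J \<rightarrow> carrier M"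
        using a al lc cc j0 by (auto simp: Pi_def)
      \<comment> \<open>A relation between the reduced vectors is a relation between the original
        ones, in which \<open>t\<close> gathers everything that falls to the pivot
        \<open>c j0\<close>.\<close>
      define t where "t = (\<Oplus>j\<in>?J. a j \<otimes> l j)"
      have tc: "t \<in> carrier R" unfolding t_def using al by (intro R.finsum_closed)
      have "(\<Oplus>\<^bsub>M\<^esub>j\<in>?J. a j \<odot>\<^bsub>M\<^esub> c' j) =
        (\<Oplus>\<^bsub>M\<^esub>j\<in>?J. a j \<odot>\<^bsub>M\<^esub> c j \<oplus>\<^bsub>M\<^esub> (a j \<otimes> l j) \<odot>\<^bsub>M\<^esub> c j0)"
        unfolding c'_def using a lc cc j0
        by (intro M.finsum_cong') (auto simp: smult_r_distr smult_assoc1 Pi_def)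
      also have "\<dots> = (\<Oplus>\<^bsub>M\<^esub>j\<in>?J. a j \<odot>\<^bsub>M\<^esub> c j) \<oplus>\<^bsub>M\<^esub> (\<Oplus>\<^bsub>M\<^esub>j\<in>?J. (a j \<otimes> l j) \<odot>\<^bsub>M\<^esub> c j0)"
        using cs by (intro M.finsum_addf)
      also have "(\<Oplus>\<^bsub>M\<^esub>j\<in>?J. (a j \<otimes> l j) \<odot>\<^bsub>M\<^esub> c j0) = t \<odot>\<^bsub>M\<^esub> c j0"
        unfolding t_def using fJ al cc j0 by (intro finsum_smult_rdistr[symmetric]) auto
      finally have "t \<odot>\<^bsub>M\<^esub> c j0 \<oplus>\<^bsub>M\<^esub> (\<Oplus>\<^bsub>M\<^esub>j\<in>?J. a j \<odot>\<^bsub>M\<^esub> c j) = \<zero>\<^bsub>M\<^esub>"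
        using s tc cc j0 M.finsum_closed[OF cs(1)] by (simp add: M.a_comm)
      moreover have "(\<Oplus>\<^bsub>M\<^esub>j\<in>?J. a j \<odot>\<^bsub>M\<^esub> c j) = (\<Oplus>\<^bsub>M\<^esub>j\<in>?J. (a(j0 := t)) j \<odot>\<^bsub>M\<^esub> c j)"
        using a cc by (intro M.finsum_cong') (auto simp: Pi_def)
      moreover have "(\<lambda>j. (a(j0 := t)) j \<odot>\<^bsub>M\<^esub> c j) \<in> ?J \<rightarrow> carrier M" using a cc by (auto simp: Pi_def)
      ultimately have "(\<Oplus>\<^bsub>M\<^esub>j\<in>insert j0 ?J. (a(j0 := t)) j \<odot>\<^bsub>M\<^esub> c j) = \<zero>\<^bsub>M\<^esub>"
        using M.finsum_insert[OF fJ, of j0 "\<lambda>j. (a(j0 := t)) j \<odot>\<^bsub>M\<^esub> c j"] tc cc j0 by simp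
      moreover have "insert j0 ?J = J" using j0 by auto
      moreover have "a(j0 := t) \<in> J \<rightarrow> carrier R" using a tc by auto
      ultimately have "\<forall>j\<in>J. (a(j0 := t)) j = \<zero>"
        using insert(6) unfolding indep_family_def by metis
      with j show "a j = \<zero>" by (metis DiffD1 DiffD2 fun_upd_other singletonI)
    qed
    have "card ?J \<le> card B"
      by (rule insert.IH[OF Bc fJ ind]) (use c'B in auto)
    then show ?thesis using insert j0 by (simp add: card_Diff_singleton)
  qed
qed

section \<open>Independent sets: uniqueness of coefficients and extension to a basis\<close>

abbreviation indep :: "'c set \<Rightarrow> bool"
  where "indep B \<equiv> indep_family B (\<lambda>b. b)"

lemma indep_unique:
  assumes B: "finite B" "indep B" and a: "a \<in> B \<rightarrow> carrier R" and a': "a' \<in> B \<rightarrow> carrier R"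
    and eq: "lincomb a B = lincomb a' B" and b: "b \<in> B"
  shows "a b = a' b"
proof -
  have Bc: "B \<subseteq> carrier M" using B unfolding indep_family_def by auto
  have d: "(\<lambda>b. \<ominus> a' b) \<in> B \<rightarrow> carrier R" "(\<lambda>b. a b \<ominus> a' b) \<in> B \<rightarrow> carrier R" using a a' by auto
  have s: "(\<lambda>b. a b \<odot>\<^bsub>M\<^esub> b) \<in> B \<rightarrow> carrier M" "(\<lambda>b. (\<ominus> a' b) \<odot>\<^bsub>M\<^esub> b) \<in> B \<rightarrow> carrier M"
    "(\<lambda>b. a' b \<odot>\<^bsub>M\<^esub> b) \<in> B \<rightarrow> carrier M"
    using a a' Bc by (auto simp: Pi_def subset_iff)
  have "(\<Oplus>\<^bsub>M\<^esub>b\<in>B. (\<ominus> a' b) \<odot>\<^bsub>M\<^esub> b) \<oplus>\<^bsub>M\<^esub> lincomb a' B = (\<Oplus>\<^bsub>M\<^esub>b\<in>B. (\<ominus> a' b) \<odot>\<^bsub>M\<^esub> b \<oplus>\<^bsub>M\<^esub> a' b \<odot>\<^bsub>M\<^esub> b)"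
    unfolding lincomb_def using s by (intro M.finsum_addf[symmetric])
  also have "\<dots> = \<zero>\<^bsub>M\<^esub>"
    using a' Bc by (intro M.add.finprod_one_eqI) (auto simp: smult_l_minus Pi_def subset_iff M.l_neg)
  finally have z: "(\<Oplus>\<^bsub>M\<^esub>b\<in>B. (\<ominus> a' b) \<odot>\<^bsub>M\<^esub> b) \<oplus>\<^bsub>M\<^esub> lincomb a' B = \<zero>\<^bsub>M\<^esub>" .
  have "(\<Oplus>\<^bsub>M\<^esub>b\<in>B. (a b \<ominus> a' b) \<odot>\<^bsub>M\<^esub> b) = (\<Oplus>\<^bsub>M\<^esub>b\<in>B. a b \<odot>\<^bsub>M\<^esub> b \<oplus>\<^bsub>M\<^esub> (\<ominus> a' b) \<odot>\<^bsub>M\<^esub> b)"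
    using a a' Bc by (intro M.finsum_cong') (auto simp: a_minus_def smult_l_distr Pi_def subset_iff)
  also have "\<dots> = lincomb a B \<oplus>\<^bsub>M\<^esub> (\<Oplus>\<^bsub>M\<^esub>b\<in>B. (\<ominus> a' b) \<odot>\<^bsub>M\<^esub> b)"
    unfolding lincomb_def using s by (intro M.finsum_addf)
  also have "\<dots> = \<zero>\<^bsub>M\<^esub>"
    using z eq lincomb_closed[OF Bc a'] M.finsum_closed[OF s(2)] by (simp add: M.a_comm)
  finally have "a b \<ominus> a' b = \<zero>"
    using B(2) d(2) b unfolding indep_family_def by (elim conjE ballE[of _ _ "\<lambda>b. a b \<ominus> a' b"]) auto
  moreover have "a b \<in> carrier R" "a' b \<in> carrier R" using a a' b by auto
  ultimately show ?thesis using R.minus_eq_zero_iff by blast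
qed

lemma indep_insert:
  assumes F: "field R" and B: "finite B" "indep B" and t: "t \<in> carrier M" "t \<notin> lin_hull B"
  shows "indep (insert t B)"
  unfolding indep_family_def
proof (intro conjI ballI impI)
  have Bc: "B \<subseteq> carrier M" using B unfolding indep_family_def by auto
  then show "(\<lambda>b. b) \<in> insert t B \<rightarrow> carrier M" using t by auto
  fix a b assume a: "a \<in> insert t B \<rightarrow> carrier R"
    and s: "(\<Oplus>\<^bsub>M\<^esub>j\<in>insert t B. a j \<odot>\<^bsub>M\<^esub> j) = \<zero>\<^bsub>M\<^esub>" and b: "b \<in> insert t B"
  have tB: "t \<notin> B" using lin_hull_incl[OF B(1) Bc] t by auto
  have "a t \<odot>\<^bsub>M\<^esub> t \<oplus>\<^bsub>M\<^esub> lincomb a B = \<zero>\<^bsub>M\<^esub>"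
    using s lincomb_insert[OF B(1) tB _ a] Bc t unfolding lincomb_def by simp
  moreover have lc: "lincomb a B \<in> carrier M" and lh: "lincomb a B \<in> lin_hull B"
    using a Bc lincomb_closed unfolding lin_hull_def by auto
  ultimately have e: "lincomb a B = (\<ominus> a t) \<odot>\<^bsub>M\<^esub> t"
    using a t by (simp add: smult_l_minus M.minus_equality M.a_comm)
  \<comment> \<open>Dividing by a nonzero coefficient would express \<open>t\<close> through
    \<open>B\<close>.\<close>
  have at0: "a t = \<zero>"
  proof (rule ccontr)
    assume "a t \<noteq> \<zero>"
    then obtain c where c: "c \<in> carrier R" "c \<otimes> a t = \<one>" using inverse_exists[OF F] a by auto
    have "(\<ominus> c) \<odot>\<^bsub>M\<^esub> lincomb a B = ((\<ominus> c) \<otimes> (\<ominus> a t)) \<odot>\<^bsub>M\<^esub> t"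
      unfolding e using a c t by (simp add: smult_assoc1)
    also have "(\<ominus> c) \<otimes> (\<ominus> a t) = \<one>" using a c by (simp add: l_minus r_minus)
    finally have "t \<in> lin_hull B" using lin_hull_smult[OF B(1) Bc lh, of "\<ominus> c"] c t by simp
    then show False using t by blast
  qed
  with e t have "lincomb a B = \<zero>\<^bsub>M\<^esub>" by simp
  then show "a b = \<zero>"
    using B(2) a at0 b unfolding indep_family_def lincomb_def by (cases "b = t") auto
qed

text \<open>\<open>T\<close> is an arbitrary subset, since it will be the set of adapted vectors,
  which in general is no subspace. An independent set of greatest cardinality between
  \<open>A\<close> and \<open>T\<close> spans \<open>T\<close>; by Steinitz the cardinalities are
  bounded by that of \<open>G\<close>.\<close>

lemma indep_extends:
  assumes F: "field R" and G: "finite G" "G \<subseteq> carrier M" "T \<subseteq> lin_hull G"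
    and A: "finite A" "indep A" "A \<subseteq> T"
  shows "\<exists>B. finite B \<and> A \<subseteq> B \<and> B \<subseteq> T \<and> indep B \<and> T \<subseteq> lin_hull B"
proof -
  let ?Q = "\<lambda>B. finite B \<and> A \<subseteq> B \<and> B \<subseteq> T \<and> indep B"
  have le: "card B \<le> card G" if "?Q B" for B
    using indep_family_card_le[OF F G(1,2), of B "\<lambda>b. b"] that G(3) by auto
  have "\<exists>B. ?Q B \<and> (\<forall>C. ?Q C \<longrightarrow> card C \<le> card B)"
    by (rule ex_has_greatest_nat[of ?Q A card "card G + 1"]) (use A le in \<open>auto simp: less_Suc_eq_le\<close>)
  then obtain B where B: "?Q B" and max: "\<And>C. ?Q C \<Longrightarrow> card C \<le> card B" by blast
  have "t \<in> lin_hull B" if t: "t \<in> T" for t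
  proof (rule ccontr)
    assume n: "t \<notin> lin_hull B"
    have tc: "t \<in> carrier M" using t G lin_hull_closed by blast
    have "B \<subseteq> carrier M" using B unfolding indep_family_def by auto
    then have "t \<notin> B" using n lin_hull_incl B by blast
    moreover have "?Q (insert t B)" using B t indep_insert[OF F _ _ tc n] by auto
    ultimately show False using max[of "insert t B"] B by simp
  qed
  with B show ?thesis by blast
qed

end

section \<open>Homomorphisms of right modules\<close>

context right_module
begin

lemma act_zero [simp]: "r \<in> carrier R \<Longrightarrow> r \<odot>\<^bsub>M\<^esub> \<zero>\<^bsub>M\<^esub> = \<zero>\<^bsub>M\<^esub>"
  using act_add_module[OF _ M.zero_closed M.zero_closed] act_closed[OF _ M.zero_closed]
  by (metis M.add.l_cancel_one M.l_zero M.zero_closed)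

lemma zero_act [simp]: "x \<in> carrier M \<Longrightarrow> \<zero>\<^bsub>R\<^esub> \<odot>\<^bsub>M\<^esub> x = \<zero>\<^bsub>M\<^esub>"
  using act_add_ring[OF R.zero_closed R.zero_closed] act_closed[OF R.zero_closed]
  by (metis M.add.l_cancel_one R.l_zero R.zero_closed)

lemma act_neg: "\<lbrakk>r \<in> carrier R; x \<in> carrier M\<rbrakk> \<Longrightarrow> r \<odot>\<^bsub>M\<^esub> (\<ominus>\<^bsub>M\<^esub> x) = \<ominus>\<^bsub>M\<^esub> (r \<odot>\<^bsub>M\<^esub> x)"
  using act_add_module[of r "\<ominus>\<^bsub>M\<^esub> x" x] act_closed by (simp add: M.l_neg M.minus_equality)

lemma neg_act: "\<lbrakk>r \<in> carrier R; x \<in> carrier M\<rbrakk> \<Longrightarrow> (\<ominus>\<^bsub>R\<^esub> r) \<odot>\<^bsub>M\<^esub> x = \<ominus>\<^bsub>M\<^esub> (r \<odot>\<^bsub>M\<^esub> x)"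
  using act_add_ring[of "\<ominus>\<^bsub>R\<^esub> r" r x] act_closed by (simp add: R.l_neg M.minus_equality)

lemma act_finsum:
  assumes "finite I" "f \<in> I \<rightarrow> carrier M" "r \<in> carrier R"
  shows "r \<odot>\<^bsub>M\<^esub> (\<Oplus>\<^bsub>M\<^esub>i\<in>I. f i) = (\<Oplus>\<^bsub>M\<^esub>i\<in>I. r \<odot>\<^bsub>M\<^esub> f i)"
  using assms
proof (induction I rule: finite_induct)
  case (insert i I)
  then have "f i \<in> carrier M" "f \<in> I \<rightarrow> carrier M" "(\<lambda>i. r \<odot>\<^bsub>M\<^esub> f i) \<in> I \<rightarrow> carrier M"
    using act_closed by (auto simp: Pi_def)
  with insert show ?case by (simp add: act_add_module act_closed)
qed simp

lemma finsum_act: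
  assumes "finite I" "f \<in> I \<rightarrow> carrier R" "x \<in> carrier M"
  shows "(\<Oplus>\<^bsub>R\<^esub>i\<in>I. f i) \<odot>\<^bsub>M\<^esub> x = (\<Oplus>\<^bsub>M\<^esub>i\<in>I. f i \<odot>\<^bsub>M\<^esub> x)"
  using assms
proof (induction I rule: finite_induct)
  case (insert i I)
  then have "f i \<in> carrier R" "f \<in> I \<rightarrow> carrier R" "(\<lambda>i. f i \<odot>\<^bsub>M\<^esub> x) \<in> I \<rightarrow> carrier M"
    using act_closed by (auto simp: Pi_def)
  with insert show ?case by (simp add: act_add_ring act_closed)
qed simp

end

lemma rmod_homI:
  assumes "\<And>x. x \<in> carrier A \<Longrightarrow> f x \<in> carrier B"
    "\<And>x y. \<lbrakk>x \<in> carrier A; y \<in> carrier A\<rbrakk> \<Longrightarrow> f (x \<oplus>\<^bsub>A\<^esub> y) = f x \<oplus>\<^bsub>B\<^esub> f y"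
    "\<And>r x. \<lbrakk>r \<in> carrier R; x \<in> carrier A\<rbrakk> \<Longrightarrow> f (r \<odot>\<^bsub>A\<^esub> x) = r \<odot>\<^bsub>B\<^esub> f x"
  shows "f \<in> rmod_hom R A B"
  using assms unfolding rmod_hom_def by auto

lemma rmod_hom_closed: "\<lbrakk>f \<in> rmod_hom R A B; x \<in> carrier A\<rbrakk> \<Longrightarrow> f x \<in> carrier B"
  unfolding rmod_hom_def by auto

lemma rmod_hom_add:
  "\<lbrakk>f \<in> rmod_hom R A B; x \<in> carrier A; y \<in> carrier A\<rbrakk> \<Longrightarrow> f (x \<oplus>\<^bsub>A\<^esub> y) = f x \<oplus>\<^bsub>B\<^esub> f y"
  unfolding rmod_hom_def by auto

lemma rmod_hom_act:
  "\<lbrakk>f \<in> rmod_hom R A B; r \<in> carrier R; x \<in> carrier A\<rbrakk> \<Longrightarrow> f (r \<odot>\<^bsub>A\<^esub> x) = r \<odot>\<^bsub>B\<^esub> f x"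
  unfolding rmod_hom_def by auto

lemma rmod_hom_comp:
  "\<lbrakk>f \<in> rmod_hom R A B; g \<in> rmod_hom R B C\<rbrakk> \<Longrightarrow> (\<lambda>x. g (f x)) \<in> rmod_hom R A C"
  unfolding rmod_hom_def by (auto simp: Pi_def)

lemma rmod_hom_id: "(\<lambda>x. x) \<in> rmod_hom R A A"
  unfolding rmod_hom_def by auto

lemma rmod_hom_zero:
  assumes "right_module R A" "right_module R B" "f \<in> rmod_hom R A B"
  shows "f \<zero>\<^bsub>A\<^esub> = \<zero>\<^bsub>B\<^esub>"
proof -
  interpret A: right_module R A by fact
  interpret B: right_module R B by fact
  show ?thesis
    using rmod_hom_act[OF assms(3) A.R.zero_closed A.M.zero_closed]
      rmod_hom_closed[OF assms(3) A.M.zero_closed] by simp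
qed

lemma rmod_hom_neg:
  assumes "right_module R A" "right_module R B" "f \<in> rmod_hom R A B" "x \<in> carrier A"
  shows "f (\<ominus>\<^bsub>A\<^esub> x) = \<ominus>\<^bsub>B\<^esub> f x"
proof -
  interpret A: right_module R A by fact
  interpret B: right_module R B by fact
  have fc: "f x \<in> carrier B" "f (\<ominus>\<^bsub>A\<^esub> x) \<in> carrier B"
    using rmod_hom_closed[OF assms(3)] assms(4) by auto
  have "f (\<ominus>\<^bsub>A\<^esub> x) \<oplus>\<^bsub>B\<^esub> f x = \<zero>\<^bsub>B\<^esub>"
    using rmod_hom_add[OF assms(3), of "\<ominus>\<^bsub>A\<^esub> x" x] assms rmod_hom_zero[OF assms(1-3)]
    by (simp add: A.M.l_neg)
  then show ?thesis using fc by (simp add: B.M.minus_equality)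
qed

lemma rmod_hom_minus:
  assumes "right_module R A" "right_module R B" "f \<in> rmod_hom R A B" "x \<in> carrier A" "y \<in> carrier A"
  shows "f (x \<ominus>\<^bsub>A\<^esub> y) = f x \<ominus>\<^bsub>B\<^esub> f y"
proof -
  interpret A: right_module R A by fact
  show ?thesis unfolding a_minus_def
    using rmod_hom_add[OF assms(3)] rmod_hom_neg[OF assms(1-3)] assms by simp
qed

lemma rmod_hom_eq_iff_minus:
  assumes "right_module R A" "right_module R B" "f \<in> rmod_hom R A B" "x \<in> carrier A" "y \<in> carrier A"
  shows "f x = f y \<longleftrightarrow> f (x \<ominus>\<^bsub>A\<^esub> y) = \<zero>\<^bsub>B\<^esub>"
proof -
  interpret A: right_module R A by fact
  interpret B: right_module R B by fact
  show ?thesis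
    using rmod_hom_minus[OF assms] rmod_hom_closed[OF assms(3)] assms(4,5) by (simp add: B.M.minus_eq_zero_iff)
qed

lemma rmod_hom_inj_onI:
  assumes "right_module R A" "right_module R B" "f \<in> rmod_hom R A B"
    "\<And>x. \<lbrakk>x \<in> carrier A; f x = \<zero>\<^bsub>B\<^esub>\<rbrakk> \<Longrightarrow> x = \<zero>\<^bsub>A\<^esub>"
  shows "inj_on f (carrier A)"
proof (rule inj_onI)
  interpret A: right_module R A by fact
  fix x y assume x: "x \<in> carrier A" "y \<in> carrier A" "f x = f y"
  then have "x \<ominus>\<^bsub>A\<^esub> y = \<zero>\<^bsub>A\<^esub>" using rmod_hom_eq_iff_minus[OF assms(1-3)] assms(4) by simp
  then show "x = y" using x by (simp add: A.M.minus_eq_zero_iff)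
qed

lemma rmod_hom_finsum:
  assumes "right_module R A" "right_module R B" "f \<in> rmod_hom R A B"
    and "finite I" "g \<in> I \<rightarrow> carrier A"
  shows "f (\<Oplus>\<^bsub>A\<^esub>i\<in>I. g i) = (\<Oplus>\<^bsub>B\<^esub>i\<in>I. f (g i))"
proof -
  interpret A: right_module R A by fact
  interpret B: right_module R B by fact
  show ?thesis
    using assms(4,5)
  proof (induction I rule: finite_induct)
    case empty
    then show ?case using rmod_hom_zero[OF assms(1-3)] by simp
  next
    case (insert i I)
    then have "g i \<in> carrier A" "g \<in> I \<rightarrow> carrier A" "(\<lambda>i. f (g i)) \<in> I \<rightarrow> carrier B"
      using rmod_hom_closed[OF assms(3)] by (auto simp: Pi_def)
    with insert show ?case
      using rmod_hom_add[OF assms(3)] rmod_hom_closed[OF assms(3)] by simp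
  qed
qed

lemma rmod_hom_diff:
  assumes "right_module R A" "right_module R B" "f \<in> rmod_hom R A B" "g \<in> rmod_hom R A B"
  shows "(\<lambda>x. f x \<ominus>\<^bsub>B\<^esub> g x) \<in> rmod_hom R A B"
proof -
  interpret A: right_module R A by fact
  interpret B: right_module R B by fact
  note c = rmod_hom_closed[OF assms(3)] rmod_hom_closed[OF assms(4)]
  show ?thesis
    by (rule rmod_homI)
      (simp_all add: c rmod_hom_add[OF assms(3)] rmod_hom_add[OF assms(4)] rmod_hom_act[OF assms(3)]
        rmod_hom_act[OF assms(4)] a_minus_def B.M.minus_add B.M.a_ac B.act_add_module B.act_neg)
qed

text \<open>The value of \<open>f\<close> is read off at a chosen preimage under \<open>g\<close>;
  two preimages differ by an element of the kernel of \<open>g\<close>, which \<open>h\<close>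
  kills.\<close>

lemma rmod_hom_factor:
  assumes "right_module R A" "right_module R B" "right_module R C"
    and g: "g \<in> rmod_hom R A B" "g ` carrier A = carrier B" and h: "h \<in> rmod_hom R A C"
    and ker: "\<And>x. \<lbrakk>x \<in> carrier A; g x = \<zero>\<^bsub>B\<^esub>\<rbrakk> \<Longrightarrow> h x = \<zero>\<^bsub>C\<^esub>"
  shows "\<exists>f\<in>rmod_hom R B C. \<forall>x\<in>carrier A. f (g x) = h x"
proof -
  interpret A: right_module R A by fact
  interpret B: right_module R B by fact
  define f where "f = (\<lambda>y. h (inv_into (carrier A) g y))"
  have eq: "f (g x) = h x" if x: "x \<in> carrier A" for x
  proof -
    let ?y = "inv_into (carrier A) g (g x)"
    have y: "?y \<in> carrier A" "g ?y = g x" using x by (auto intro: inv_into_into f_inv_into_f)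
    then have "g (?y \<ominus>\<^bsub>A\<^esub> x) = \<zero>\<^bsub>B\<^esub>" using x rmod_hom_eq_iff_minus[OF assms(1,2) g(1)] by blast
    then have "h ?y = h x"
      using ker x y rmod_hom_eq_iff_minus[OF assms(1,3) h] by simp
    then show ?thesis unfolding f_def .
  qed
  have "f \<in> rmod_hom R B C"
  proof (rule rmod_homI)
    fix y assume "y \<in> carrier B"
    then obtain x where x: "x \<in> carrier A" "y = g x" using g(2) by blast
    then show "f y \<in> carrier C" using eq rmod_hom_closed[OF h] by simp
    fix r assume r: "r \<in> carrier R"
    show "f (r \<odot>\<^bsub>B\<^esub> y) = r \<odot>\<^bsub>C\<^esub> f y"
      using x r eq rmod_hom_act[OF h] rmod_hom_act[OF g(1), symmetric] A.act_closed by simp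
  next
    fix y z assume "y \<in> carrier B" "z \<in> carrier B"
    then obtain x x' where x: "x \<in> carrier A" "y = g x" "x' \<in> carrier A" "z = g x'" using g(2) by blast
    then show "f (y \<oplus>\<^bsub>B\<^esub> z) = f y \<oplus>\<^bsub>C\<^esub> f z"
      using eq rmod_hom_add[OF h] rmod_hom_add[OF g(1), symmetric] by simp
  qed
  with eq show ?thesis by blast
qed

text \<open>Being a right module depends on the carrier, zero, addition and action alone. This
  carries it between records that differ elsewhere, such as a syzygy and an update of
  \<open>P n\<close>.\<close>

lemma right_module_cong:
  assumes "right_module R A" and eq: "carrier B = carrier A" "\<zero>\<^bsub>B\<^esub> = \<zero>\<^bsub>A\<^esub>"
    "\<And>x y. x \<oplus>\<^bsub>B\<^esub> y = x \<oplus>\<^bsub>A\<^esub> y" "\<And>r x. r \<odot>\<^bsub>B\<^esub> x = r \<odot>\<^bsub>A\<^esub> x"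
  shows "right_module R B"
proof -
  interpret A: right_module R A by fact
  have "abelian_group B"
  proof (rule abelian_groupI)
    fix x assume "x \<in> carrier B"
    then show "\<exists>y\<in>carrier B. y \<oplus>\<^bsub>B\<^esub> x = \<zero>\<^bsub>B\<^esub>"
      by (intro bexI[of _ "\<ominus>\<^bsub>A\<^esub> x"]) (simp_all add: eq A.M.l_neg)
  qed (auto simp: eq A.M.a_assoc intro: A.M.a_comm)
  then show ?thesis
    unfolding right_module_def right_module_axioms_def
    using A.R.ring_axioms
    by (auto simp: eq A.act_closed A.act_add_ring A.act_add_module A.act_mult A.act_one)
qed

lemma submodule_right_module:
  assumes "right_module R A" and N: "additive_subgroup N A"
    and act: "\<And>r x. \<lbrakk>r \<in> carrier R; x \<in> N\<rbrakk> \<Longrightarrow> r \<odot>\<^bsub>A\<^esub> x \<in> N"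
  shows "right_module R (A\<lparr>carrier := N\<rparr>)"
proof -
  interpret A: right_module R A by fact
  interpret N: additive_subgroup N A by fact
  have sub: "x \<in> carrier A" if "x \<in> N" for x using that N.a_subset by auto
  have "abelian_group (A\<lparr>carrier := N\<rparr>)"
  proof (rule abelian_groupI)
    fix x assume "x \<in> carrier (A\<lparr>carrier := N\<rparr>)"
    then show "\<exists>y\<in>carrier (A\<lparr>carrier := N\<rparr>). y \<oplus>\<^bsub>A\<lparr>carrier := N\<rparr>\<^esub> x = \<zero>\<^bsub>A\<lparr>carrier := N\<rparr>\<^esub>"
      using sub A.M.l_neg N.a_inv_closed[of x] by (intro bexI[of _ "\<ominus>\<^bsub>A\<^esub> x"]) simp_all
  qed (use sub in \<open>auto simp: A.M.a_assoc intro: A.M.a_comm\<close>)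
  then show ?thesis
    unfolding right_module_def right_module_axioms_def
    using A.R.ring_axioms act sub
    by (auto simp: A.act_add_ring A.act_add_module A.act_mult A.act_one)
qed

lemma rmod_hom_image_subgroup:
  assumes "right_module R A" "right_module R B" and f: "f \<in> rmod_hom R A B"
  shows "additive_subgroup (f ` carrier A) B" "\<lbrakk>r \<in> carrier R; y \<in> f ` carrier A\<rbrakk> \<Longrightarrow> r \<odot>\<^bsub>B\<^esub> y \<in> f ` carrier A"
proof -
  interpret A: right_module R A by fact
  interpret B: right_module R B by fact
  show "additive_subgroup (f ` carrier A) B"
  proof (rule B.M.additive_subgroupI')
    show "f ` carrier A \<subseteq> carrier B" using rmod_hom_closed[OF f] by auto
    show "\<zero>\<^bsub>B\<^esub> \<in> f ` carrier A" using rmod_hom_zero[OF assms] by force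
    fix x assume "x \<in> f ` carrier A"
    then obtain a where a: "a \<in> carrier A" "x = f a" by auto
    then show "\<ominus>\<^bsub>B\<^esub> x \<in> f ` carrier A" using rmod_hom_neg[OF assms, of a] by (metis A.M.a_inv_closed image_eqI)
    fix y assume "y \<in> f ` carrier A"
    then obtain b where b: "b \<in> carrier A" "y = f b" by auto
    show "x \<oplus>\<^bsub>B\<^esub> y \<in> f ` carrier A" using rmod_hom_add[OF f a(1) b(1)] a b by (metis A.M.a_closed image_eqI)
  qed
  show "r \<odot>\<^bsub>B\<^esub> y \<in> f ` carrier A" if "r \<in> carrier R" "y \<in> f ` carrier A"
    using that rmod_hom_act[OF f, symmetric] A.act_closed by auto
qed

lemma rmod_hom_restrict: "f \<in> rmod_hom R A B \<Longrightarrow> f \<in> rmod_hom R A (B\<lparr>carrier := f ` carrier A\<rparr>)"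
  unfolding rmod_hom_def by auto

text \<open>Writing \<open>y\<close> as the sum of \<open>q y\<close> and \<open>y - q y\<close>
  decomposes \<open>M\<close> into the image and the kernel of \<open>q\<close>, one of which has to
  be zero.\<close>

lemma indecomposable_idempotent:
  assumes rM: "right_module R M" and ind: "indecomposable R M" and q: "q \<in> rmod_hom R M M"
    and idem: "\<And>y. y \<in> carrier M \<Longrightarrow> q (q y) = q y"
  shows "(\<forall>y\<in>carrier M. q y = \<zero>\<^bsub>M\<^esub>) \<or> (\<forall>y\<in>carrier M. q y = y)"
proof -
  interpret M: right_module R M by (rule rM)
  let ?A = "q ` carrier M" and ?B = "{y \<in> carrier M. q y = \<zero>\<^bsub>M\<^esub>}"
  note qc = rmod_hom_closed[OF q] and q0 = rmod_hom_zero[OF rM rM q]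
  have A: "submodule ?A R M"
    unfolding submodule_iff using rmod_hom_image_subgroup[OF rM rM q] by blast
  have B: "submodule ?B R M"
    unfolding submodule_iff
    by (intro conjI ballI M.M.additive_subgroupI')
      (auto simp: q0 rmod_hom_add[OF q] rmod_hom_neg[OF rM rM q] rmod_hom_act[OF q] M.act_closed)
  have int: "?A \<inter> ?B = {\<zero>\<^bsub>M\<^esub>}"
  proof
    show "?A \<inter> ?B \<subseteq> {\<zero>\<^bsub>M\<^esub>}" using idem by auto
    have "\<zero>\<^bsub>M\<^esub> \<in> ?A" using q0 by (metis M.M.zero_closed image_eqI)
    then show "{\<zero>\<^bsub>M\<^esub>} \<subseteq> ?A \<inter> ?B" using q0 by auto
  qed
  have inB: "y \<ominus>\<^bsub>M\<^esub> q y \<in> ?B" if "y \<in> carrier M" for y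
    using that qc idem rmod_hom_minus[OF rM rM q that qc[OF that]] M.M.minus_eq_zero_iff by simp
  have "?A <+>\<^bsub>M\<^esub> ?B = carrier M"
  proof
    show "?A <+>\<^bsub>M\<^esub> ?B \<subseteq> carrier M" using qc unfolding set_add_def set_mult_def by auto
    show "carrier M \<subseteq> ?A <+>\<^bsub>M\<^esub> ?B"
    proof
      fix y assume y: "y \<in> carrier M"
      have "y = q y \<oplus>\<^bsub>M\<^esub> (y \<ominus>\<^bsub>M\<^esub> q y)"
        using y qc[OF y] by (simp add: a_minus_def M.M.a_lcomm M.M.r_neg)
      then show "y \<in> ?A <+>\<^bsub>M\<^esub> ?B" using y inB[OF y] unfolding set_add_def set_mult_def by auto
    qed
  qed
  then consider "?A = {\<zero>\<^bsub>M\<^esub>}" | "?B = {\<zero>\<^bsub>M\<^esub>}"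
    using ind A B int unfolding indecomposable_def by blast
  then show ?thesis
  proof cases
    case 1
    then show ?thesis by blast
  next
    case 2
    have "q y = y" if y: "y \<in> carrier M" for y
    proof -
      have "y \<ominus>\<^bsub>M\<^esub> q y = \<zero>\<^bsub>M\<^esub>" using inB[OF y] 2 by blast
      then show ?thesis using M.M.minus_eq_zero_iff[OF y qc[OF y]] by simp
    qed
    then show ?thesis by blast
  qed
qed

section \<open>Homogeneous components and parts of homomorphisms\<close>

lemma component_in_homog:
  "\<lbrakk>direct_sum_decomposition M (homog M); x \<in> carrier M\<rbrakk> \<Longrightarrow> component M i x \<in> homog M i"
  using decomposes_component[of M x] by (simp add: decomposes_def)

lemma component_closed:
  "\<lbrakk>direct_sum_decomposition M (homog M); x \<in> carrier M\<rbrakk> \<Longrightarrow> component M i x \<in> carrier M"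
  using component_in_homog[of M x i] homog_subset[of M i] by auto

lemma component_sum:
  assumes "direct_sum_decomposition M (homog M)" "x \<in> carrier M"
  shows "finite {i. component M i x \<noteq> \<zero>\<^bsub>M\<^esub>}"
    "x = (\<Oplus>\<^bsub>M\<^esub>i\<in>{i. component M i x \<noteq> \<zero>\<^bsub>M\<^esub>}. component M i x)"
  using decomposes_component[OF assms] unfolding decomposes_def by auto

text \<open>Every element is the finite sum of its components, so an additive property has to be
  checked on homogeneous elements only.\<close>

lemma graded_induct [consumes 3, case_names zero add homog]:
  assumes ab: "abelian_group M" and D: "direct_sum_decomposition M (homog M)" and x: "x \<in> carrier M"
    and zero: "Q \<zero>\<^bsub>M\<^esub>"
    and add: "\<And>x y. \<lbrakk>x \<in> carrier M; y \<in> carrier M; Q x; Q y\<rbrakk> \<Longrightarrow> Q (x \<oplus>\<^bsub>M\<^esub> y)"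
    and hom: "\<And>i x. \<lbrakk>x \<in> homog M i; x \<in> carrier M\<rbrakk> \<Longrightarrow> Q x"
  shows "Q x"
proof -
  interpret M: abelian_group M by fact
  note c = component_in_homog[OF D x] component_closed[OF D x]
  have "Q (\<Oplus>\<^bsub>M\<^esub>i\<in>I. component M i x)" if "finite I" for I
    using that
  proof (induction I rule: finite_induct)
    case (insert i I)
    have "Q (component M i x)" using c hom by blast
    moreover have "(\<Oplus>\<^bsub>M\<^esub>i\<in>I. component M i x) \<in> carrier M" using c by (intro M.finsum_closed) auto
    ultimately show ?case using c add insert by simp
  qed (simp add: zero)
  then show ?thesis using component_sum[OF D x] by metis
qed

lemma component_eq_imp_eq:
  assumes D: "direct_sum_decomposition M (homog M)" "x \<in> carrier M" "y \<in> carrier M"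
    and "\<And>i. component M i x = component M i y"
  shows "x = y"
  using component_sum(2)[OF D(1,2)] component_sum(2)[OF D(1,3)] assms(4) by simp

lemma component_finsum:
  assumes ab: "abelian_group M" and D: "direct_sum_decomposition M (homog M)"
    and "finite I" "f \<in> I \<rightarrow> carrier M"
  shows "component M k (\<Oplus>\<^bsub>M\<^esub>i\<in>I. f i) = (\<Oplus>\<^bsub>M\<^esub>i\<in>I. component M k (f i))"
proof -
  interpret M: abelian_group M by fact
  show ?thesis
    using assms(3,4)
  proof (induction I rule: finite_induct)
    case (insert i I)
    then have "f i \<in> carrier M" "f \<in> I \<rightarrow> carrier M" "(\<lambda>i. component M k (f i)) \<in> I \<rightarrow> carrier M"
      using component_closed[OF D] by (auto simp: Pi_def)
    with insert show ?case
      using component_add[OF ab D] component_closed[OF D] by simp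
  qed (simp add: component_zero[OF ab D])
qed

section \<open>Graded modules over a graded algebra, in particular those generated in one
  degree\<close>

locale graded_alg =
  fixes K :: "('k, 'e) ring_scheme" and R :: "('k, 'r, 'c) graded_scheme"
  assumes graded_algebra: "graded_algebra K R"
begin

sublocale R: ring R
  using graded_algebra unfolding graded_algebra_def by blast

lemma abelian_R: "abelian_group R"
  by (rule R.abelian_group_axioms)

lemma decomposition_R: "direct_sum_decomposition R (homog R)"
  using graded_algebra unfolding graded_algebra_def by blast

lemma homog_R_closed: "r \<in> homog R i \<Longrightarrow> r \<in> carrier R"
  using homog_subset[OF decomposition_R] by blast

lemma homog_R_neg: "\<lbrakk>r \<in> homog R i; i < 0\<rbrakk> \<Longrightarrow> r = \<zero>\<^bsub>R\<^esub>"
  using graded_algebra unfolding graded_algebra_def by blast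

lemma homog_R_mult: "\<lbrakk>r \<in> homog R i; s \<in> homog R j\<rbrakk> \<Longrightarrow> r \<otimes>\<^bsub>R\<^esub> s \<in> homog R (i + j)"
  using graded_algebra unfolding graded_algebra_def by blast

lemma one_homog: "\<one>\<^bsub>R\<^esub> \<in> homog R 0"
  using graded_algebra unfolding graded_algebra_def by blast

context
  fixes A :: "('r, 'a, 'd) graded_scheme"
  assumes gA: "graded_module R A"
begin

lemma graded_right_module: "right_module R A"
  using gA unfolding graded_module_def by blast

lemma graded_abelian: "abelian_group A"
  using graded_right_module right_module.axioms(2) by blast

lemma decomposition: "direct_sum_decomposition A (homog A)"
  using gA unfolding graded_module_def by blast

lemma homog_closed: "x \<in> homog A i \<Longrightarrow> x \<in> carrier A"
  using homog_subset[OF decomposition] by blast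

lemma homog_subgroup: "additive_subgroup (homog A i) A"
  using decomposition unfolding direct_sum_decomposition_def by blast

lemma homog_act: "\<lbrakk>r \<in> homog R j; x \<in> homog A i\<rbrakk> \<Longrightarrow> r \<odot>\<^bsub>A\<^esub> x \<in> homog A (i + j)"
  using gA unfolding graded_module_def by blast

lemma homog_act0: "\<lbrakk>r \<in> homog R 0; x \<in> homog A i\<rbrakk> \<Longrightarrow> r \<odot>\<^bsub>A\<^esub> x \<in> homog A i"
  using homog_act[of r 0 x i] by simp

lemmas comp_in = component_in_homog[OF decomposition]
lemmas comp_closed = component_closed[OF decomposition]
lemmas comp_homog = component_homog[OF graded_abelian decomposition]
lemmas comp_add = component_add[OF graded_abelian decomposition]
lemmas comp_zero = component_zero[OF graded_abelian decomposition]
lemmas comp_eqI = component_eq_imp_eq[OF decomposition]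

lemma comp_act:
  assumes r: "r \<in> homog R j" and x: "x \<in> carrier A"
  shows "component A k (r \<odot>\<^bsub>A\<^esub> x) = r \<odot>\<^bsub>A\<^esub> component A (k - j) x"
proof -
  interpret A: right_module R A by (rule graded_right_module)
  have rc: "r \<in> carrier R" by (rule homog_R_closed[OF r])
  show ?thesis
    using graded_abelian decomposition x
  proof (induction x rule: graded_induct)
    case zero
    then show ?case using rc comp_zero by simp
  next
    case (add x y)
    then show ?case
      using rc comp_add A.act_closed comp_closed A.act_add_module by simp
  next
    case (homog i x)
    then show ?case
      using comp_homog[OF homog_act[OF r homog(1)], of k] comp_homog[OF homog(1), of "k - j"] rc by auto
  qed
qed

context
  fixes n
  assumes gen: "generated_in_degree R A n"
begin

text \<open>\<open>Q\<close> is not assumed to be stable under the action. The span is therefore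
  compared with the submodule \<open>N\<close> of those elements all of whose multiples satisfy
  \<open>Q\<close>. Zero and negatives need no cases of their own, as they arise from the scalars
  zero and \<open>- r\<close>.\<close>

lemma gen_induct [consumes 1, case_names add act]:
  assumes x: "x \<in> carrier A"
    and add: "\<And>x y. \<lbrakk>x \<in> carrier A; y \<in> carrier A; Q x; Q y\<rbrakk> \<Longrightarrow> Q (x \<oplus>\<^bsub>A\<^esub> y)"
    and act: "\<And>i r x. \<lbrakk>i \<ge> 0; r \<in> homog R i; r \<in> carrier R; x \<in> homog A n; x \<in> carrier A\<rbrakk> \<Longrightarrow> Q (r \<odot>\<^bsub>A\<^esub> x)"
  shows "Q x"
proof -
  interpret A: right_module R A by (rule graded_right_module)
  have R0: "\<zero>\<^bsub>R\<^esub> \<in> homog R 0" "\<zero>\<^bsub>A\<^esub> \<in> homog A n"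
    using decomposition_R decomposition unfolding direct_sum_decomposition_def
    by (meson additive_subgroup.zero_closed)+
  have Q0: "Q \<zero>\<^bsub>A\<^esub>" using act[of 0 "\<zero>\<^bsub>R\<^esub>" "\<zero>\<^bsub>A\<^esub>"] R0 by simp
  have Qact: "Q (r \<odot>\<^bsub>A\<^esub> x)" if r: "r \<in> carrier R" and x: "x \<in> homog A n" for r x
    using abelian_R decomposition_R r
  proof (induction r rule: graded_induct)
    case zero
    then show ?case using homog_closed[OF x] Q0 by simp
  next
    case (add r s)
    then show ?case using homog_closed[OF x] A.act_add_ring A.act_closed assms(2) by simp
  next
    case (homog i r)
    then show ?case using homog_closed[OF x] act[of i r x] x homog_R_neg[of r i] Q0 by (cases "i \<ge> 0") auto
  qed
  define N where "N = {x \<in> carrier A. \<forall>r\<in>carrier R. Q (r \<odot>\<^bsub>A\<^esub> x)}"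
  have sub: "homog A n \<subseteq> carrier A" using homog_closed by blast
  have "submodule N R A"
    unfolding submodule_iff
  proof (intro conjI ballI A.M.additive_subgroupI')
    fix x assume x: "x \<in> N"
    then have "Q (r \<odot>\<^bsub>A\<^esub> \<ominus>\<^bsub>A\<^esub> x)" if "r \<in> carrier R" for r
      using that A.act_neg[of r x] A.neg_act[of r x] unfolding N_def
      by (metis (no_types, lifting) R.a_inv_closed mem_Collect_eq)
    then show "\<ominus>\<^bsub>A\<^esub> x \<in> N" using x unfolding N_def by simp
    fix r assume "r \<in> carrier R"
    with x show "r \<odot>\<^bsub>A\<^esub> x \<in> N"
      unfolding N_def using A.act_closed by (auto simp: A.act_mult[symmetric])
  qed (auto simp: N_def Q0 A.act_add_module A.act_closed add)
  moreover have "homog A n \<subseteq> N" unfolding N_def using Qact sub by auto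
  ultimately have "carrier A \<subseteq> N"
    using submodule_rmod_span(3)[OF graded_right_module sub] gen
    unfolding generated_in_degree_def by blast
  with x have "Q (\<one>\<^bsub>R\<^esub> \<odot>\<^bsub>A\<^esub> x)" unfolding N_def by auto
  then show ?thesis using x A.act_one by simp
qed

text \<open>As the algebra has no negative degrees, the generators have the lowest degree. Later on,
  maps are shown to vanish because their values on generators would lie below this degree.\<close>

lemma comp_below: "\<lbrakk>x \<in> carrier A; k < n\<rbrakk> \<Longrightarrow> component A k x = \<zero>\<^bsub>A\<^esub>"
proof (induction x rule: gen_induct)
  interpret A: right_module R A by (rule graded_right_module)
  case (add x y)
  then show ?case using comp_add by simp
next
  interpret A: right_module R A by (rule graded_right_module)
  case (act i r x)
  then show ?case using comp_act[of r i x k] comp_homog[of x n "k - i"] by simp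
qed

lemma homog_below: "\<lbrakk>x \<in> homog A k; k < n\<rbrakk> \<Longrightarrow> x = \<zero>\<^bsub>A\<^esub>"
  using comp_below[of x k] homog_closed comp_homog[of x k k] by auto

text \<open>A scalar of degree \<open>i > 0\<close> contributes to degree \<open>n\<close> only from
  degree \<open>n - i\<close>, where \<open>A\<close> vanishes. So the algebra acts on lowest
  components through its degree 0.\<close>

lemma comp_act_lowest:
  assumes r: "r \<in> carrier R" and x: "x \<in> carrier A"
  shows "component A n (r \<odot>\<^bsub>A\<^esub> x) = component R 0 r \<odot>\<^bsub>A\<^esub> component A n x"
proof -
  interpret A: right_module R A by (rule graded_right_module)
  note cR = component_closed[OF decomposition_R]
  show ?thesis
    using abelian_R decomposition_R r
  proof (induction r rule: graded_induct)
    case zero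
    then show ?case using x comp_closed comp_zero component_zero[OF abelian_R decomposition_R] by simp
  next
    case (add r s)
    then show ?case
      using x component_add[OF abelian_R decomposition_R] A.act_closed comp_closed cR
      by (simp add: A.act_add_ring comp_add)
  next
    case (homog i r)
    consider "i = 0" | "i > 0" | "i < 0" by linarith
    then show ?case
    proof cases
      case 3
      then have "r = \<zero>\<^bsub>R\<^esub>" using homog homog_R_neg by blast
      then show ?thesis
        using x comp_closed comp_zero component_zero[OF abelian_R decomposition_R] by simp
    qed (use homog x comp_act[OF homog(1) x, of n] component_homog[OF abelian_R decomposition_R homog(1), of 0]
        comp_below[OF x, of "n - i"] comp_closed in auto)
  qed
qed

lemma rmod_hom_eqI:
  assumes B: "right_module R B" and f: "f \<in> rmod_hom R A B" and g: "g \<in> rmod_hom R A B"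
    and eq: "\<And>x. x \<in> homog A n \<Longrightarrow> f x = g x" and x: "x \<in> carrier A"
  shows "f x = g x"
  using x
proof (induction x rule: gen_induct)
  case (add x y)
  then show ?case using rmod_hom_add[OF f] rmod_hom_add[OF g] by simp
next
  case (act i r x)
  then show ?case using rmod_hom_act[OF f] rmod_hom_act[OF g] eq by simp
qed

lemma rmod_hom_ontoI:
  assumes B: "right_module R B" and f: "f \<in> rmod_hom R B A" and on: "homog A n \<subseteq> f ` carrier B"
  shows "f ` carrier B = carrier A"
proof
  show "f ` carrier B \<subseteq> carrier A" using rmod_hom_closed[OF f] by auto
  have "x \<in> f ` carrier B" if "x \<in> carrier A" for x
    using that
  proof (induction x rule: gen_induct)
    case (add x y)
    then show ?case
      using additive_subgroup.a_closed[OF rmod_hom_image_subgroup(1)[OF B graded_right_module f]] by blast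
  next
    case (act i r x)
    then show ?case using rmod_hom_image_subgroup(2)[OF B graded_right_module f] on by blast
  qed
  then show "carrier A \<subseteq> f ` carrier B" by blast
qed

end

end

section \<open>Homogeneous maps and homogeneous parts of arbitrary homomorphisms\<close>

lemma graded_hom_rmod: "f \<in> graded_hom R j A B \<Longrightarrow> f \<in> rmod_hom R A B"
  unfolding graded_hom_def by blast

lemma graded_hom_homog: "\<lbrakk>f \<in> graded_hom R j A B; x \<in> homog A k\<rbrakk> \<Longrightarrow> f x \<in> homog B (j + k)"
  unfolding graded_hom_def by blast

lemma graded_hom_comp:
  assumes "f \<in> graded_hom R i A B" "g \<in> graded_hom R j B C"
  shows "(\<lambda>x. g (f x)) \<in> graded_hom R (j + i) A C"
  using assms rmod_hom_comp[of f R A B g C] unfolding graded_hom_def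
  by (auto simp: image_subset_iff add.assoc)

text \<open>The degree is a variable subject to an equation, so that the rule applies when the
  degree in a goal is not literally a sum.\<close>

lemma graded_hom_comp':
  assumes "f \<in> graded_hom R i A B" "g \<in> graded_hom R j B C" "k = j + i"
  shows "(\<lambda>x. g (f x)) \<in> graded_hom R k A C"
  using graded_hom_comp assms by blast

lemma graded_hom_component:
  assumes A: "graded_module R A" and B: "graded_module R B"
    and f: "f \<in> graded_hom R j A B" and x: "x \<in> carrier A"
  shows "component B (j + k) (f x) = f (component A k x)"
  using graded_abelian[OF A] decomposition[OF A] x
proof (induction x rule: graded_induct)
  case zero
  then show ?case
    using rmod_hom_zero[OF graded_right_module[OF A] graded_right_module[OF B] graded_hom_rmod[OF f]]
      comp_zero[OF A] comp_zero[OF B] by simp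
next
  case (add x y)
  then show ?case
    using comp_add[OF A] comp_add[OF B] rmod_hom_add[OF graded_hom_rmod[OF f]]
      rmod_hom_closed[OF graded_hom_rmod[OF f]] comp_closed[OF A] by simp
next
  case (homog i x)
  then show ?case
    using comp_homog[OF A homog(1), of k] comp_homog[OF B graded_hom_homog[OF f homog(1)], of "j + k"]
      rmod_hom_zero[OF graded_right_module[OF A] graded_right_module[OF B] graded_hom_rmod[OF f]] by auto
qed

lemma graded_hom_diff:
  assumes A: "graded_module R A" and B: "graded_module R B" and f: "f \<in> graded_hom R j A B"
    and g: "g \<in> graded_hom R j A B"
  shows "(\<lambda>x. f x \<ominus>\<^bsub>B\<^esub> g x) \<in> graded_hom R j A B"
proof -
  have "f x \<ominus>\<^bsub>B\<^esub> g x \<in> homog B (j + k)" if "x \<in> homog A k" for x k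
    using graded_hom_homog[OF f that] graded_hom_homog[OF g that] homog_subgroup[OF B]
    unfolding a_minus_def by (blast intro: additive_subgroup.a_closed additive_subgroup.a_inv_closed)
  then show ?thesis
    using rmod_hom_diff[OF graded_right_module[OF A] graded_right_module[OF B] graded_hom_rmod[OF f] graded_hom_rmod[OF g]]
    unfolding graded_hom_def by auto
qed

text \<open>The part of degree \<open>j\<close> of a homomorphism: on an element of degree
  \<open>k\<close> it is the component of degree \<open>j + k\<close> of the value of
  \<open>f\<close>, and this is extended additively over the finitely many components of
  \<open>x\<close>.\<close>

definition part :: "int \<Rightarrow> ('r, 'a, 'd) graded_scheme \<Rightarrow> ('r, 'b, 'f) graded_scheme \<Rightarrow> ('a \<Rightarrow> 'b) \<Rightarrow> 'a \<Rightarrow> 'b"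
  where "part j A B f x =
    (\<Oplus>\<^bsub>B\<^esub>k\<in>{k. component A k x \<noteq> \<zero>\<^bsub>A\<^esub>}. component B (j + k) (f (component A k x)))"

context
  fixes A :: "('r, 'a, 'd) graded_scheme" and B :: "('r, 'b, 'f) graded_scheme" and f
  assumes A: "graded_module R A" and B: "graded_module R B" and f: "f \<in> rmod_hom R A B"
begin

lemma part_closed: "x \<in> carrier A \<Longrightarrow> part j A B f x \<in> carrier B"
  unfolding part_def using comp_closed[OF A] comp_closed[OF B] rmod_hom_closed[OF f]
  by (intro abelian_monoid.finsum_closed) (auto intro: abelian_group.axioms graded_abelian[OF B])

lemma comp_part:
  assumes x: "x \<in> carrier A"
  shows "component B (j + k) (part j A B f x) = component B (j + k) (f (component A k x))"
proof -
  interpret B: right_module R B by (rule graded_right_module[OF B])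
  let ?S = "{k. component A k x \<noteq> \<zero>\<^bsub>A\<^esub>}"
  let ?g = "\<lambda>i. component B (j + i) (f (component A i x))"
  have gh: "?g i \<in> homog B (j + i)" "?g i \<in> carrier B" for i
    using comp_in[OF B] comp_closed[OF B] rmod_hom_closed[OF f] comp_closed[OF A x] by blast+
  have fin: "finite ?S" by (rule component_sum[OF decomposition[OF A] x])
  have "component B (j + k) (part j A B f x) = (\<Oplus>\<^bsub>B\<^esub>i\<in>?S. component B (j + k) (?g i))"
    unfolding part_def using gh by (intro component_finsum[OF graded_abelian[OF B] decomposition[OF B] fin]) auto
  also have "\<dots> = (\<Oplus>\<^bsub>B\<^esub>i\<in>?S. if k = i then ?g i else \<zero>\<^bsub>B\<^esub>)"
    using comp_homog[OF B gh(1), of "j + k"] gh(2) by (intro B.M.finsum_cong') auto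
  also have "\<dots> = ?g k"
  proof (cases "k \<in> ?S")
    case True
    then show ?thesis using B.M.finsum_singleton[OF True fin, of ?g] gh(2) by auto
  next
    case False
    then have "component A k x = \<zero>\<^bsub>A\<^esub>" by simp
    then have "?g k = \<zero>\<^bsub>B\<^esub>"
      using rmod_hom_zero[OF graded_right_module[OF A] graded_right_module[OF B] f] comp_zero[OF B] by simp
    moreover have "(\<Oplus>\<^bsub>B\<^esub>i\<in>?S. if k = i then ?g i else \<zero>\<^bsub>B\<^esub>) = \<zero>\<^bsub>B\<^esub>"
      using False by (intro B.M.add.finprod_one_eqI) auto
    ultimately show ?thesis by simp
  qed
  finally show ?thesis .
qed

text \<open>By \<open>comp_part\<close> the part is determined by its components, so the properties
  below can be verified degree by degree.\<close>

lemma part_eqI: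
  assumes x: "x \<in> carrier A" and y: "y \<in> carrier B"
    and eq: "\<And>k. component B (j + k) y = component B (j + k) (f (component A k x))"
  shows "part j A B f x = y"
proof (rule comp_eqI[OF B part_closed[OF x] y])
  fix i
  show "component B i (part j A B f x) = component B i y"
    using comp_part[OF x, of j "i - j"] eq[of "i - j"] by simp
qed

lemma part_homog:
  assumes x: "x \<in> homog A k"
  shows "part j A B f x = component B (j + k) (f x)"
proof (rule part_eqI)
  show xc: "x \<in> carrier A" by (rule homog_closed[OF A x])
  have fx: "f x \<in> carrier B" using rmod_hom_closed[OF f xc] .
  show "component B (j + k) (f x) \<in> carrier B" by (rule comp_closed[OF B fx])
  fix i
  show "component B (j + i) (component B (j + k) (f x)) = component B (j + i) (f (component A i x))"
    using comp_homog[OF B comp_in[OF B fx, of "j + k"], of "j + i"] comp_homog[OF A x, of i]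
      rmod_hom_zero[OF graded_right_module[OF A] graded_right_module[OF B] f] comp_zero[OF B] by auto
qed

lemma part_graded_hom: "part j A B f \<in> graded_hom R j A B"
proof -
  interpret A: right_module R A by (rule graded_right_module[OF A])
  interpret B: right_module R B by (rule graded_right_module[OF B])
  note fc = rmod_hom_closed[OF f] and cA = comp_closed[OF A] and cB = comp_closed[OF B]
  have add: "part j A B f (x \<oplus>\<^bsub>A\<^esub> y) = part j A B f x \<oplus>\<^bsub>B\<^esub> part j A B f y"
    if "x \<in> carrier A" "y \<in> carrier A" for x y
    using that part_closed comp_add[OF A] comp_add[OF B] comp_part fc cA rmod_hom_add[OF f]
    by (intro part_eqI) simp_all
  have "part j A B f \<in> rmod_hom R A B"
  proof (rule rmod_homI[OF part_closed add])
    fix r x assume r: "r \<in> carrier R" and x: "x \<in> carrier A"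
    have px: "part j A B f x \<in> carrier B" by (rule part_closed[OF x])
    show "part j A B f (r \<odot>\<^bsub>A\<^esub> x) = r \<odot>\<^bsub>B\<^esub> part j A B f x"
      using abelian_R decomposition_R r
    proof (induction r rule: graded_induct)
      case zero
      then show ?case
        using add[of "\<zero>\<^bsub>A\<^esub>" "\<zero>\<^bsub>A\<^esub>"] x px part_closed[of "\<zero>\<^bsub>A\<^esub>"] by simp
    next
      case (add r s)
      then show ?case
        using x px A.act_closed \<open>\<And>x y. \<lbrakk>x \<in> carrier A; y \<in> carrier A\<rbrakk> \<Longrightarrow>
          part j A B f (x \<oplus>\<^bsub>A\<^esub> y) = part j A B f x \<oplus>\<^bsub>B\<^esub> part j A B f y\<close>
        by (simp add: A.act_add_ring B.act_add_ring)
    next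
      \<comment> \<open>A scalar of degree \<open>i\<close> shifts degrees by \<open>i\<close>: in
        degree \<open>j + k\<close> both sides see only the component of \<open>x\<close> of degree
        \<open>k - i\<close>.\<close>
      case (homog i r)
      show ?case
      proof (rule part_eqI)
        fix k
        have "component B (j + k) (r \<odot>\<^bsub>B\<^esub> part j A B f x) = r \<odot>\<^bsub>B\<^esub> component B (j + (k - i)) (part j A B f x)"
          using comp_act[OF B homog(1) px, of "j + k"] by (simp add: add_diff_eq)
        also have "\<dots> = r \<odot>\<^bsub>B\<^esub> component B (j + (k - i)) (f (component A (k - i) x))"
          by (simp only: comp_part[OF x])
        also have "\<dots> = component B (j + k) (r \<odot>\<^bsub>B\<^esub> f (component A (k - i) x))"
          using comp_act[OF B homog(1) fc[OF cA[OF x]], of "j + k" "k - i"] by (simp add: add_diff_eq)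
        also have "\<dots> = component B (j + k) (f (component A k (r \<odot>\<^bsub>A\<^esub> x)))"
          using comp_act[OF A homog(1) x, of k] rmod_hom_act[OF f homog(2) cA[OF x], of "k - i"] by simp
        finally show "component B (j + k) (r \<odot>\<^bsub>B\<^esub> part j A B f x) = component B (j + k) (f (component A k (r \<odot>\<^bsub>A\<^esub> x)))" .
      qed (use homog x px A.act_closed B.act_closed in auto)
    qed
  qed
  moreover have "part j A B f x \<in> homog B (j + k)" if "x \<in> homog A k" for x k
    using part_homog[OF that] comp_in[OF B fc[OF homog_closed[OF A that]]] by simp
  ultimately show ?thesis unfolding graded_hom_def by auto
qed

end

text \<open>Lifting problems with homogeneous data survive the passage to parts: if \<open>g\<close>
  after \<open>f\<close> is homogeneous, then a part of \<open>f\<close> of the right degree is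
  again a lift.\<close>

lemma part_lift:
  assumes A: "graded_module R A" and B: "graded_module R B" and C: "graded_module R C"
    and f: "f \<in> rmod_hom R A B" and g: "g \<in> graded_hom R i B C" and x: "x \<in> carrier A"
  shows "part (i + j) A C (\<lambda>x. g (f x)) x = g (part j A B f x)"
proof (rule part_eqI[OF A C rmod_hom_comp[OF f graded_hom_rmod[OF g]] x])
  have px: "part j A B f x \<in> carrier B" by (rule part_closed[OF A B f x])
  show "g (part j A B f x) \<in> carrier C" by (rule rmod_hom_closed[OF graded_hom_rmod[OF g] px])
  fix k
  have fx: "f (component A k x) \<in> carrier B" by (rule rmod_hom_closed[OF f comp_closed[OF A x]])
  show "component C (i + j + k) (g (part j A B f x)) = component C (i + j + k) (g (f (component A k x)))"
    using graded_hom_component[OF B C g px, of "j + k"] graded_hom_component[OF B C g fx, of "j + k"]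
      comp_part[OF A B f x, of j k] by (simp add: add.assoc)
qed

text \<open>The counterpart of \<open>part_lift\<close> for extension problems, where the
  homogeneous map comes first.\<close>

lemma part_precomp:
  assumes A: "graded_module R A" and B: "graded_module R B" and C: "graded_module R C"
    and f: "f \<in> graded_hom R i A B" and g: "g \<in> rmod_hom R B C" and x: "x \<in> carrier A"
  shows "part (j + i) A C (\<lambda>x. g (f x)) x = part j B C g (f x)"
proof (rule part_eqI[OF A C rmod_hom_comp[OF graded_hom_rmod[OF f] g] x])
  have fx: "f x \<in> carrier B" by (rule rmod_hom_closed[OF graded_hom_rmod[OF f] x])
  show "part j B C g (f x) \<in> carrier C" by (rule part_closed[OF B C g fx])
  fix k
  show "component C (j + i + k) (part j B C g (f x)) = component C (j + i + k) (g (f (component A k x)))"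
    using graded_hom_component[OF A B f x, of k] comp_part[OF B C g fx, of j "i + k"]
    by (simp add: add.assoc)
qed

lemma part_graded:
  assumes A: "graded_module R A" and B: "graded_module R B"
    and f: "f \<in> graded_hom R j A B" and x: "x \<in> carrier A"
  shows "part j A B f x = f x"
  using graded_hom_component[OF A B f x] graded_hom_component[OF A B f comp_closed[OF A x]]
    comp_homog[OF A comp_in[OF A x]] rmod_hom_closed[OF graded_hom_rmod[OF f] x]
  by (intro part_eqI[OF A B graded_hom_rmod[OF f] x]) simp_all

lemma part_cong:
  assumes A: "graded_module R A" and x: "x \<in> carrier A" and eq: "\<And>x. x \<in> carrier A \<Longrightarrow> f x = g x"
  shows "part j A B f x = part j A B g x"
  unfolding part_def using eq comp_closed[OF A x] by simp

end

section \<open>Generating spaces and dual bases\<close>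

text \<open>The degree 0 of the algebra enters through the unit vectors of
  \<open>K \<times> \<dots> \<times> K\<close>: orthogonal idempotents with sum one, each spanning
  over \<open>K\<close> the ideal that it generates in degree 0.\<close>

locale split_alg = graded_alg K R
  for K :: "('k, 'e) ring_scheme" and R :: "('k, 'r, 'c) graded_scheme" +
  fixes m :: nat and e :: "nat \<Rightarrow> 'r"
  assumes idem_homog: "i < m \<Longrightarrow> e i \<in> homog R 0"
    and idem_mult: "\<lbrakk>i < m; j < m\<rbrakk> \<Longrightarrow> e i \<otimes>\<^bsub>R\<^esub> e j = (if i = j then e i else \<zero>\<^bsub>R\<^esub>)"
    and idem_sum: "(\<Oplus>\<^bsub>R\<^esub>i\<in>{..<m}. e i) = \<one>\<^bsub>R\<^esub>"
    and idem_scalar: "\<lbrakk>i < m; r \<in> homog R 0\<rbrakk> \<Longrightarrow> \<exists>a\<in>carrier K. e i \<otimes>\<^bsub>R\<^esub> r = a \<odot>\<^bsub>R\<^esub> e i"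
begin

lemma field_K: "field K"
  using graded_algebra unfolding graded_algebra_def by blast

lemma module_K_R: "module K R"
  using graded_algebra unfolding graded_algebra_def by blast

text \<open>A right module carries an action of \<open>R\<close> only, so the field acts on it
  through its image in \<open>R\<close>.\<close>

definition scal :: "'k \<Rightarrow> 'r"
  where "scal a = a \<odot>\<^bsub>R\<^esub> \<one>\<^bsub>R\<^esub>"

lemma scal_homog: "a \<in> carrier K \<Longrightarrow> scal a \<in> homog R 0"
  using graded_algebra one_homog unfolding graded_algebra_def scal_def by blast

lemma scal_closed: "a \<in> carrier K \<Longrightarrow> scal a \<in> carrier R"
  using scal_homog homog_R_closed by blast

lemma idem_closed: "i < m \<Longrightarrow> e i \<in> carrier R"
  using idem_homog homog_R_closed by blast

lemma scal_mult: "\<lbrakk>a \<in> carrier K; r \<in> carrier R\<rbrakk> \<Longrightarrow> scal a \<otimes>\<^bsub>R\<^esub> r = a \<odot>\<^bsub>R\<^esub> r"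
  "\<lbrakk>a \<in> carrier K; r \<in> carrier R\<rbrakk> \<Longrightarrow> r \<otimes>\<^bsub>R\<^esub> scal a = a \<odot>\<^bsub>R\<^esub> r"
  using graded_algebra unfolding graded_algebra_def scal_def by (metis R.l_one R.one_closed, metis R.r_one R.one_closed)

lemma scal_add: "\<lbrakk>a \<in> carrier K; b \<in> carrier K\<rbrakk> \<Longrightarrow> scal (a \<oplus>\<^bsub>K\<^esub> b) = scal a \<oplus>\<^bsub>R\<^esub> scal b"
  unfolding scal_def by (rule module.smult_l_distr[OF module_K_R]) auto

text \<open>The order of the factors is the one in which the right action law
  \<open>act_mult\<close> becomes associativity for a vector space over \<open>K\<close>.\<close>

lemma scal_prod: "\<lbrakk>a \<in> carrier K; b \<in> carrier K\<rbrakk> \<Longrightarrow> scal (a \<otimes>\<^bsub>K\<^esub> b) = scal b \<otimes>\<^bsub>R\<^esub> scal a"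
  using module.smult_assoc1[OF module_K_R, of a b "\<one>\<^bsub>R\<^esub>"] scal_mult(2)[of a "scal b"] scal_closed
  unfolding scal_def by simp

lemma scal_one: "scal \<one>\<^bsub>K\<^esub> = \<one>\<^bsub>R\<^esub>"
  unfolding scal_def by (rule module.smult_one[OF module_K_R]) auto

lemma scal_zero: "scal \<zero>\<^bsub>K\<^esub> = \<zero>\<^bsub>R\<^esub>"
  unfolding scal_def by (rule module.smult_l_null[OF module_K_R]) auto

text \<open>A record for the library locale \<open>module\<close>, so that the linear algebra above
  applies to a single degree of a graded module.\<close>

definition hspace :: "('r, 'a, 'd) graded_scheme \<Rightarrow> int \<Rightarrow> ('k, 'a) module"
  where "hspace A n = \<lparr>carrier = homog A n, monoid.mult = undefined, monoid.one = undefined,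
    ring.zero = \<zero>\<^bsub>A\<^esub>, ring.add = ring.add A, smult = (\<lambda>a x. scal a \<odot>\<^bsub>A\<^esub> x)\<rparr>"

lemma hspace_simps [simp]:
  "carrier (hspace A n) = homog A n" "\<zero>\<^bsub>hspace A n\<^esub> = \<zero>\<^bsub>A\<^esub>"
  "x \<oplus>\<^bsub>hspace A n\<^esub> y = x \<oplus>\<^bsub>A\<^esub> y" "a \<odot>\<^bsub>hspace A n\<^esub> x = scal a \<odot>\<^bsub>A\<^esub> x"
  unfolding hspace_def by simp_all

text \<open>Vectors supported at a single idempotent. They are the possible images of the generator
  \<open>e i\<close> under homomorphisms from \<open>e i R\<close>, so a basis must consist of them
  if it is to decompose \<open>A\<close> into such modules.\<close>

definition adapted :: "('r, 'a, 'd) graded_scheme \<Rightarrow> int \<Rightarrow> 'a set"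
  where "adapted A n = {x \<in> homog A n. \<exists>i<m. e i \<odot>\<^bsub>A\<^esub> x = x}"

definition adapted_indep :: "('r, 'a, 'd) graded_scheme \<Rightarrow> int \<Rightarrow> 'a set \<Rightarrow> bool"
  where "adapted_indep A n B \<longleftrightarrow>
    finite B \<and> B \<subseteq> adapted A n \<and> module.indep_family K (hspace A n) B (\<lambda>b. b)"

definition adapted_basis :: "('r, 'a, 'd) graded_scheme \<Rightarrow> int \<Rightarrow> 'a set \<Rightarrow> bool"
  where "adapted_basis A n B \<longleftrightarrow>
    adapted_indep A n B \<and> homog A n \<subseteq> module.lin_hull K (hspace A n) B"

context
  fixes A :: "('r, 'a, 'd) graded_scheme"
  assumes gA: "graded_module R A"
begin

lemma hspace_module: "module K (hspace A n)"
proof -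
  interpret A: right_module R A by (rule graded_right_module[OF gA])
  interpret H: additive_subgroup "homog A n" A by (rule homog_subgroup[OF gA])
  interpret K: field K by (rule field_K)
  note c = homog_closed[OF gA]
  show ?thesis
  proof (rule moduleI)
    show "cring K" by (rule K.is_cring)
    show "abelian_group (hspace A n)"
    proof (rule abelian_groupI)
      fix x assume x: "x \<in> carrier (hspace A n)"
      then show "\<exists>y\<in>carrier (hspace A n). y \<oplus>\<^bsub>hspace A n\<^esub> x = \<zero>\<^bsub>hspace A n\<^esub>"
        using c A.M.l_neg H.a_inv_closed[of x] by (intro bexI[of _ "\<ominus>\<^bsub>A\<^esub> x"]) simp_all
    qed (use c in \<open>auto simp: A.M.a_assoc intro: A.M.a_comm\<close>)
  qed (use c scal_closed scal_homog homog_act0[OF gA] in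
      \<open>auto simp: scal_add scal_prod scal_one A.act_add_ring A.act_add_module A.act_mult A.act_one\<close>)
qed

lemma hspace_finsum:
  assumes "finite I" "f \<in> I \<rightarrow> homog A n"
  shows "finsum (hspace A n) f I = finsum A f I"
proof -
  interpret A: right_module R A by (rule graded_right_module[OF gA])
  interpret V: module K "hspace A n" by (rule hspace_module)
  note c = homog_closed[OF gA]
  show ?thesis using assms
  proof (induction I rule: finite_induct)
    case empty
    then show ?case using V.M.finsum_empty A.M.finsum_empty by simp
  next
    case (insert i I)
    then have "f \<in> I \<rightarrow> homog A n" "f i \<in> homog A n" "f i \<in> carrier A" "f \<in> I \<rightarrow> carrier A"
      using c by (auto simp: Pi_def)
    with insert show ?case using V.M.finsum_insert[of I i f] by simp
  qed
qed

lemma lincomb_hspace: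
  assumes "finite B" "B \<subseteq> homog A n" "a \<in> B \<rightarrow> carrier K"
  shows "module.lincomb (hspace A n) a B = (\<Oplus>\<^bsub>A\<^esub>b\<in>B. scal (a b) \<odot>\<^bsub>A\<^esub> b)"
  unfolding module.lincomb_def[OF hspace_module]
  using assms homog_act0[OF gA] scal_homog by (subst hspace_finsum) (auto simp: Pi_def subset_iff)

text \<open>One is the sum of the idempotents; hence adapted vectors span.\<close>

lemma adapted_decomp:
  assumes x: "x \<in> homog A n"
  shows "\<And>i. i < m \<Longrightarrow> e i \<odot>\<^bsub>A\<^esub> x \<in> adapted A n" "x = (\<Oplus>\<^bsub>A\<^esub>i\<in>{..<m}. e i \<odot>\<^bsub>A\<^esub> x)"
proof -
  interpret A: right_module R A by (rule graded_right_module[OF gA])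
  note xc = homog_closed[OF gA x]
  show "e i \<odot>\<^bsub>A\<^esub> x \<in> adapted A n" if i: "i < m" for i
    using x xc i idem_closed[OF i] homog_act0[OF gA idem_homog[OF i] x]
      A.act_mult[of "e i" "e i" x] idem_mult[OF i i]
    unfolding adapted_def by auto
  show "x = (\<Oplus>\<^bsub>A\<^esub>i\<in>{..<m}. e i \<odot>\<^bsub>A\<^esub> x)"
    using A.finsum_act[of "{..<m}" e x] idem_closed idem_sum xc A.act_one by simp
qed

text \<open>The lowest components of finitely many module generators, cut down by the idempotents,
  already span over \<open>K\<close>: on lowest components only degree 0 of the algebra acts, and on
  vectors supported at one idempotent it acts by scalars.\<close>

lemma fin_dim:
  assumes fg: "finitely_generated R A" and gen: "generated_in_degree R A n"
  shows "\<exists>G. finite G \<and> G \<subseteq> homog A n \<and> homog A n \<subseteq> module.lin_hull K (hspace A n) G"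
proof -
  interpret A: right_module R A by (rule graded_right_module[OF gA])
  interpret V: module K "hspace A n" by (rule hspace_module)
  obtain S where S: "finite S" "S \<subseteq> carrier A" "rmod_span R A S = carrier A"
    using fg unfolding finitely_generated_def by blast
  define G where "G = (\<lambda>(s, i). e i \<odot>\<^bsub>A\<^esub> component A n s) ` (S \<times> {..<m})"
  have G: "finite G" "G \<subseteq> homog A n"
    using S homog_act0[OF gA idem_homog comp_in[OF gA]] unfolding G_def by auto
  let ?L = "V.lin_hull G"
  have Lh: "w \<in> homog A n" if "w \<in> ?L" for w using V.lin_hull_closed[OF _ that] G by simp
  \<comment> \<open>On a vector supported at \<open>e i\<close> the element \<open>r\<close> acts as
    \<open>e i \<otimes> r\<close>, which is a scalar multiple of \<open>e i\<close>. So the hull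
    over \<open>K\<close> is stable under all of degree 0.\<close>
  have L0: "r \<odot>\<^bsub>A\<^esub> w \<in> ?L" if r: "r \<in> homog R 0" and w: "w \<in> ?L" for r w
  proof -
    have "w \<in> {w \<in> homog A n. r \<odot>\<^bsub>A\<^esub> w \<in> ?L}"
    proof (rule V.lin_hull_subspaceI[OF G(1) _ w])
      show "G \<subseteq> {w \<in> homog A n. r \<odot>\<^bsub>A\<^esub> w \<in> ?L}"
      proof
        fix g assume g: "g \<in> G"
        then obtain s i where si: "s \<in> S" "i < m" "g = e i \<odot>\<^bsub>A\<^esub> component A n s" unfolding G_def by auto
        have sc: "component A n s \<in> carrier A" using si S comp_closed[OF gA] by auto
        obtain a where a: "a \<in> carrier K" "e i \<otimes>\<^bsub>R\<^esub> r = a \<odot>\<^bsub>R\<^esub> e i" using idem_scalar[OF si(2) r] by blast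
        have "r \<odot>\<^bsub>A\<^esub> g = (e i \<otimes>\<^bsub>R\<^esub> r) \<odot>\<^bsub>A\<^esub> component A n s"
          using si r sc homog_R_closed idem_closed by (simp add: A.act_mult)
        also have "\<dots> = (e i \<otimes>\<^bsub>R\<^esub> scal a) \<odot>\<^bsub>A\<^esub> component A n s"
          using a scal_mult(2) si idem_closed by simp
        also have "\<dots> = a \<odot>\<^bsub>hspace A n\<^esub> g"
          using si a sc scal_closed idem_closed by (simp add: A.act_mult)
        finally have "r \<odot>\<^bsub>A\<^esub> g \<in> ?L"
          using V.lin_hull_smult[OF G(1) _ V.lin_hull_incl[OF G(1) _ g] a(1)] G by simp
        then show "g \<in> {w \<in> homog A n. r \<odot>\<^bsub>A\<^esub> w \<in> ?L}" using g G by auto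
      qed
      have rc: "r \<in> carrier R" using r homog_R_closed by blast
      show "\<zero>\<^bsub>hspace A n\<^esub> \<in> {w \<in> homog A n. r \<odot>\<^bsub>A\<^esub> w \<in> ?L}"
        using rc V.lin_hull_zero[OF G(1)] G Lh by simp
      show "x \<oplus>\<^bsub>hspace A n\<^esub> y \<in> {w \<in> homog A n. r \<odot>\<^bsub>A\<^esub> w \<in> ?L}"
        if "x \<in> {w \<in> homog A n. r \<odot>\<^bsub>A\<^esub> w \<in> ?L}" "y \<in> {w \<in> homog A n. r \<odot>\<^bsub>A\<^esub> w \<in> ?L}" for x y
        using that V.lin_hull_add[of G "r \<odot>\<^bsub>A\<^esub> x" "r \<odot>\<^bsub>A\<^esub> y"] G rc homog_closed[OF gA, of _ n]
          additive_subgroup.a_closed[OF homog_subgroup[OF gA]] by (simp add: A.act_add_module)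
      show "a \<odot>\<^bsub>hspace A n\<^esub> x \<in> {w \<in> homog A n. r \<odot>\<^bsub>A\<^esub> w \<in> ?L}"
        if a: "a \<in> carrier K" and "x \<in> {w \<in> homog A n. r \<odot>\<^bsub>A\<^esub> w \<in> ?L}" for a x
      proof -
        have x: "x \<in> homog A n" "r \<odot>\<^bsub>A\<^esub> x \<in> ?L" using that by auto
        have "r \<odot>\<^bsub>A\<^esub> (scal a \<odot>\<^bsub>A\<^esub> x) = scal a \<odot>\<^bsub>A\<^esub> (r \<odot>\<^bsub>A\<^esub> x)"
          using A.act_mult[of r "scal a" x] A.act_mult[of "scal a" r x] scal_mult[OF a rc] rc scal_closed[OF a]
            homog_closed[OF gA x(1)] by simp
        then show ?thesis
          using x homog_act0[OF gA scal_homog[OF a]] V.lin_hull_smult[OF G(1) _ x(2) a] G by simp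
      qed
    qed (use G in auto)
    then show ?thesis by blast
  qed
  \<comment> \<open>The elements with lowest component in the hull form a submodule by
    \<open>comp_act_lowest\<close>; it contains the generators \<open>S\<close>, hence
    everything.\<close>
  define N where "N = {x \<in> carrier A. component A n x \<in> ?L}"
  have Nact: "r \<odot>\<^bsub>A\<^esub> x \<in> N" if "r \<in> carrier R" "x \<in> N" for r x
    using that comp_act_lowest[OF gA gen] L0 component_in_homog[OF decomposition_R] A.act_closed
    unfolding N_def by simp
  have "submodule N R A"
    unfolding submodule_iff
  proof (intro conjI ballI A.M.additive_subgroupI')
    show "\<zero>\<^bsub>A\<^esub> \<in> N" using comp_zero[OF gA] V.lin_hull_zero[OF G(1)] G unfolding N_def by simp
    fix x assume x: "x \<in> N"
    then have "(\<ominus>\<^bsub>R\<^esub> \<one>\<^bsub>R\<^esub>) \<odot>\<^bsub>A\<^esub> x = \<ominus>\<^bsub>A\<^esub> x" unfolding N_def by (simp add: A.neg_act A.act_one)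
    then show "\<ominus>\<^bsub>A\<^esub> x \<in> N" using Nact[OF _ x, of "\<ominus>\<^bsub>R\<^esub> \<one>\<^bsub>R\<^esub>"] by simp
    fix y assume "y \<in> N"
    then show "x \<oplus>\<^bsub>A\<^esub> y \<in> N"
      using x V.lin_hull_add[of G "component A n x" "component A n y"] G comp_add[OF gA] unfolding N_def by simp
  qed (auto simp: N_def[symmetric] Nact, simp add: N_def)
  moreover have "S \<subseteq> N"
  proof
    fix s assume s: "s \<in> S"
    have sn: "component A n s \<in> homog A n" using s S comp_in[OF gA] by auto
    have "(\<Oplus>\<^bsub>hspace A n\<^esub>i\<in>{..<m}. e i \<odot>\<^bsub>A\<^esub> component A n s) \<in> ?L"
      by (rule V.lin_hull_finsum[OF G(1)]) (use G s in \<open>auto intro!: V.lin_hull_incl simp: G_def\<close>)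
    moreover have "(\<Oplus>\<^bsub>hspace A n\<^esub>i\<in>{..<m}. e i \<odot>\<^bsub>A\<^esub> component A n s) = component A n s"
      using adapted_decomp(2)[OF sn] homog_act0[OF gA idem_homog sn] by (subst hspace_finsum) auto
    ultimately show "s \<in> N" unfolding N_def using s S by auto
  qed
  ultimately have "carrier A \<subseteq> N"
    using submodule_rmod_span(3)[OF A.right_module_axioms S(2)] S(3) by blast
  then have "homog A n \<subseteq> ?L"
    using homog_closed[OF gA, of _ n] comp_homog[OF gA, of _ n n] unfolding N_def by force
  with G show ?thesis by blast
qed

text \<open>Adapted vectors span, so a basis can be chosen among them. The prescribed set
  \<open>C\<close> will be the image of a basis under an injective map, or a single vector that is
  to generate a direct summand.\<close>

lemma adapted_basis_extends:
  assumes fg: "finitely_generated R A" and gen: "generated_in_degree R A n" and C: "adapted_indep A n C"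
  shows "\<exists>B. C \<subseteq> B \<and> adapted_basis A n B"
proof -
  interpret V: module K "hspace A n" by (rule hspace_module)
  obtain G where G: "finite G" "G \<subseteq> homog A n" "homog A n \<subseteq> V.lin_hull G" using fin_dim[OF fg gen] by blast
  have ad: "adapted A n \<subseteq> homog A n" unfolding adapted_def by blast
  obtain B where B: "finite B" "C \<subseteq> B" "B \<subseteq> adapted A n" "V.indep B" "adapted A n \<subseteq> V.lin_hull B"
    using V.indep_extends[OF field_K G(1), of "adapted A n" C] G ad C unfolding adapted_indep_def by auto
  have "x \<in> V.lin_hull B" if x: "x \<in> homog A n" for x
  proof -
    have "(\<Oplus>\<^bsub>hspace A n\<^esub>i\<in>{..<m}. e i \<odot>\<^bsub>A\<^esub> x) \<in> V.lin_hull B"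
      by (rule V.lin_hull_finsum[OF B(1)]) (use B ad adapted_decomp(1)[OF x] in auto)
    moreover have "(\<Oplus>\<^bsub>hspace A n\<^esub>i\<in>{..<m}. e i \<odot>\<^bsub>A\<^esub> x) = x"
      using adapted_decomp[OF x] ad by (subst hspace_finsum) auto
    ultimately show ?thesis by simp
  qed
  with B show ?thesis unfolding adapted_basis_def adapted_indep_def by blast
qed

lemma adapted_indep_card_le:
  assumes "adapted_indep A n C" "adapted_basis A n B"
  shows "card C \<le> card B"
proof -
  interpret V: module K "hspace A n" by (rule hspace_module)
  have ad: "adapted A n \<subseteq> homog A n" unfolding adapted_def by blast
  show ?thesis
    by (rule V.indep_family_card_le[OF field_K, of B C "\<lambda>b. b"])
      (use assms ad in \<open>auto simp: adapted_basis_def adapted_indep_def\<close>)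
qed

lemma adapted_basis_expand:
  assumes "adapted_basis A n B" "x \<in> homog A n"
  shows "\<exists>a\<in>B \<rightarrow> carrier K. x = (\<Oplus>\<^bsub>A\<^esub>b\<in>B. scal (a b) \<odot>\<^bsub>A\<^esub> b)"
proof -
  interpret V: module K "hspace A n" by (rule hspace_module)
  have B: "finite B" "B \<subseteq> homog A n" using assms unfolding adapted_basis_def adapted_indep_def adapted_def by auto
  have "x \<in> V.lin_hull B" using assms unfolding adapted_basis_def by blast
  then show ?thesis unfolding V.lin_hull_def using lincomb_hspace[OF B] by auto
qed

lemma adapted_indep_unique:
  assumes "adapted_indep A n B" and a: "a \<in> B \<rightarrow> carrier K" "a' \<in> B \<rightarrow> carrier K"
    and eq: "(\<Oplus>\<^bsub>A\<^esub>b\<in>B. scal (a b) \<odot>\<^bsub>A\<^esub> b) = (\<Oplus>\<^bsub>A\<^esub>b\<in>B. scal (a' b) \<odot>\<^bsub>A\<^esub> b)" and b: "b \<in> B"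
  shows "a b = a' b"
proof -
  interpret V: module K "hspace A n" by (rule hspace_module)
  have B: "finite B" "B \<subseteq> homog A n" "V.indep B" using assms unfolding adapted_indep_def adapted_def by auto
  show ?thesis
    by (rule V.indep_unique[OF B(1,3) a _ b]) (use eq lincomb_hspace[OF B(1,2)] a in auto)
qed

lemma adapted_indepI:
  assumes B: "finite B" "B \<subseteq> adapted A n"
    and ind: "\<And>a b. \<lbrakk>a \<in> B \<rightarrow> carrier K; (\<Oplus>\<^bsub>A\<^esub>b\<in>B. scal (a b) \<odot>\<^bsub>A\<^esub> b) = \<zero>\<^bsub>A\<^esub>; b \<in> B\<rbrakk> \<Longrightarrow> a b = \<zero>\<^bsub>K\<^esub>"
  shows "adapted_indep A n B"
proof -
  interpret V: module K "hspace A n" by (rule hspace_module)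
  have Bh: "B \<subseteq> homog A n" using B unfolding adapted_def by auto
  have "V.indep B"
    unfolding V.indep_family_def
    using ind lincomb_hspace[OF B(1) Bh, unfolded V.lincomb_def] Bh by (auto simp: Pi_def)
  with B show ?thesis unfolding adapted_indep_def by blast
qed

end

end

section \<open>The regular module and free modules\<close>

definition graded_regular :: "('k, 'r, 'c) graded_scheme \<Rightarrow> ('r, 'r) graded"
  where "graded_regular R =
    \<lparr>carrier = carrier R, monoid.mult = undefined, monoid.one = undefined, ring.zero = \<zero>\<^bsub>R\<^esub>,
     ring.add = ring.add R, smult = (\<lambda>r x. x \<otimes>\<^bsub>R\<^esub> r), homog = homog R\<rparr>"

text \<open>For finite \<open>B\<close>, the case in use, this is the free module on
  \<open>B\<close>. Functions on the whole type are taken because \<open>projective_module\<close>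
  tests on modules of this type.\<close>

definition free_module :: "('r, 'c) ring_scheme \<Rightarrow> 'b set \<Rightarrow> ('r, 'b \<Rightarrow> 'r) module"
  where "free_module R B =
    \<lparr>carrier = {f. (\<forall>b\<in>B. f b \<in> carrier R) \<and> (\<forall>b. b \<notin> B \<longrightarrow> f b = \<zero>\<^bsub>R\<^esub>)},
     monoid.mult = undefined, monoid.one = undefined, ring.zero = (\<lambda>_. \<zero>\<^bsub>R\<^esub>),
     ring.add = (\<lambda>f g b. f b \<oplus>\<^bsub>R\<^esub> g b), smult = (\<lambda>r f b. f b \<otimes>\<^bsub>R\<^esub> r)\<rparr>"

lemma free_module_closed: "\<lbrakk>ring R; f \<in> carrier (free_module R B)\<rbrakk> \<Longrightarrow> f b \<in> carrier R"
  unfolding free_module_def using ring.ring_simprules(2) by (cases "b \<in> B") auto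

lemma right_module_free:
  assumes "ring R"
  shows "right_module R (free_module R B)"
proof -
  interpret R: ring R by fact
  note c = free_module_closed[OF assms]
  have "abelian_group (free_module R B)"
  proof (rule abelian_groupI)
    fix f assume f: "f \<in> carrier (free_module R B)"
    then show "\<exists>g\<in>carrier (free_module R B). g \<oplus>\<^bsub>free_module R B\<^esub> f = \<zero>\<^bsub>free_module R B\<^esub>"
      using c[OF f] by (intro bexI[of _ "\<lambda>b. \<ominus>\<^bsub>R\<^esub> f b"]) (auto simp: free_module_def R.l_neg)
  next
    fix f g h assume fgh: "f \<in> carrier (free_module R B)" "g \<in> carrier (free_module R B)" "h \<in> carrier (free_module R B)"
    show "f \<oplus>\<^bsub>free_module R B\<^esub> g \<oplus>\<^bsub>free_module R B\<^esub> h = f \<oplus>\<^bsub>free_module R B\<^esub> (g \<oplus>\<^bsub>free_module R B\<^esub> h)"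
      using fgh[THEN c] by (simp add: free_module_def R.a_assoc)
  next
    fix f g assume fg: "f \<in> carrier (free_module R B)" "g \<in> carrier (free_module R B)"
    show "f \<oplus>\<^bsub>free_module R B\<^esub> g = g \<oplus>\<^bsub>free_module R B\<^esub> f"
      using fg[THEN c] by (simp add: free_module_def R.a_comm)
  next
    fix f assume f: "f \<in> carrier (free_module R B)"
    show "\<zero>\<^bsub>free_module R B\<^esub> \<oplus>\<^bsub>free_module R B\<^esub> f = f"
      using f[THEN c] by (simp add: free_module_def)
  qed (auto simp: free_module_def)
  moreover have "right_module_axioms R (free_module R B)"
  proof
    fix r s f assume "r \<in> carrier R" "s \<in> carrier R" and f: "f \<in> carrier (free_module R B)"
    then show "(r \<oplus>\<^bsub>R\<^esub> s) \<odot>\<^bsub>free_module R B\<^esub> f = r \<odot>\<^bsub>free_module R B\<^esub> f \<oplus>\<^bsub>free_module R B\<^esub> s \<odot>\<^bsub>free_module R B\<^esub> f"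
      "(r \<otimes>\<^bsub>R\<^esub> s) \<odot>\<^bsub>free_module R B\<^esub> f = s \<odot>\<^bsub>free_module R B\<^esub> (r \<odot>\<^bsub>free_module R B\<^esub> f)"
      using f[THEN c] by (simp_all add: free_module_def R.r_distr R.m_assoc)
  next
    fix r f g assume "r \<in> carrier R" and fg: "f \<in> carrier (free_module R B)" "g \<in> carrier (free_module R B)"
    then show "r \<odot>\<^bsub>free_module R B\<^esub> (f \<oplus>\<^bsub>free_module R B\<^esub> g) = r \<odot>\<^bsub>free_module R B\<^esub> f \<oplus>\<^bsub>free_module R B\<^esub> r \<odot>\<^bsub>free_module R B\<^esub> g"
      using fg[THEN c] by (simp add: free_module_def R.l_distr)
  next
    fix f assume f: "f \<in> carrier (free_module R B)"
    then show "\<one>\<^bsub>R\<^esub> \<odot>\<^bsub>free_module R B\<^esub> f = f" using f[THEN c] by (simp add: free_module_def)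
  qed (auto simp: free_module_def)
  ultimately show ?thesis unfolding right_module_def using assms by blast
qed

text \<open>Forgets the grading: the test modules in \<open>projective_module\<close> are plain
  \<open>module\<close> records.\<close>

definition underlying :: "('r, 'a, 'd) module_scheme \<Rightarrow> ('r, 'a) module"
  where "underlying A = \<lparr>carrier = carrier A, monoid.mult = undefined, monoid.one = undefined,
    ring.zero = \<zero>\<^bsub>A\<^esub>, ring.add = ring.add A, smult = smult A\<rparr>"

lemma right_module_underlying: "right_module R A \<Longrightarrow> right_module R (underlying A)"
  by (erule right_module_cong) (simp_all add: underlying_def)

context graded_alg
begin

lemma graded_regular_simps [simp]:
  "carrier (graded_regular R) = carrier R" "homog (graded_regular R) = homog R"
  "\<zero>\<^bsub>graded_regular R\<^esub> = \<zero>\<^bsub>R\<^esub>" "x \<oplus>\<^bsub>graded_regular R\<^esub> y = x \<oplus>\<^bsub>R\<^esub> y"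
  "r \<odot>\<^bsub>graded_regular R\<^esub> x = x \<otimes>\<^bsub>R\<^esub> r"
  by (simp_all add: graded_regular_def)

lemma abelian_regular: "abelian_group (graded_regular R)"
proof (rule abelian_groupI)
  fix x assume "x \<in> carrier (graded_regular R)"
  then show "\<exists>y\<in>carrier (graded_regular R). y \<oplus>\<^bsub>graded_regular R\<^esub> x = \<zero>\<^bsub>graded_regular R\<^esub>"
    by (intro bexI[of _ "\<ominus>\<^bsub>R\<^esub> x"]) (simp_all add: R.l_neg)
qed (auto simp: R.a_assoc intro: R.a_comm)

lemma finsum_regular:
  assumes "finite I" "f \<in> I \<rightarrow> carrier R"
  shows "finsum (graded_regular R) f I = finsum R f I"
proof -
  interpret G: abelian_group "graded_regular R" by (rule abelian_regular)
  show ?thesis using assms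
  proof (induction I rule: finite_induct)
    case empty
    then show ?case using G.finsum_empty R.finsum_empty by simp
  next
    case (insert i I)
    then have "f \<in> I \<rightarrow> carrier R" "f i \<in> carrier R" by auto
    with insert show ?case using G.finsum_insert[of I i f] R.finsum_insert[of I i f] by simp
  qed
qed

text \<open>An equation between predicates, so that it can rewrite under the description operator in
  \<open>component\<close>.\<close>

lemma decomposes_regular: "decomposes (graded_regular R) (homog R) x = decomposes R (homog R) x"
proof
  fix f
  show "decomposes (graded_regular R) (homog R) x f = decomposes R (homog R) x f"
  proof (cases "(\<forall>i. f i \<in> homog R i) \<and> finite {i. f i \<noteq> \<zero>\<^bsub>R\<^esub>}")
    case True
    then have "finsum (graded_regular R) f {i. f i \<noteq> \<zero>\<^bsub>R\<^esub>} = finsum R f {i. f i \<noteq> \<zero>\<^bsub>R\<^esub>}"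
      using homog_R_closed by (intro finsum_regular) blast+
    then show ?thesis unfolding decomposes_def by simp
  qed (auto simp: decomposes_def)
qed

lemma component_regular [simp]: "component (graded_regular R) i x = component R i x"
  unfolding component_def by (simp add: decomposes_regular)

lemma graded_module_regular: "graded_module R (graded_regular R)"
proof -
  note ab = abelian_regular
  interpret G: abelian_group "graded_regular R" by (rule ab)
  have "right_module R (graded_regular R)"
    unfolding right_module_def right_module_axioms_def
    using ab R.ring_axioms by (auto simp: R.r_distr R.l_distr R.m_assoc)
  moreover have "direct_sum_decomposition (graded_regular R) (homog R)"
    unfolding direct_sum_decomposition_def
  proof (intro conjI allI ballI)
    fix i
    have H: "additive_subgroup (homog R i) R"
      using decomposition_R unfolding direct_sum_decomposition_def by blast
    show "additive_subgroup (homog R i) (graded_regular R)"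
    proof (rule G.additive_subgroupI')
      fix x assume x: "x \<in> homog R i"
      have "\<ominus>\<^bsub>graded_regular R\<^esub> x = \<ominus>\<^bsub>R\<^esub> x"
        using x homog_R_closed R.l_neg by (intro G.minus_equality) auto
      then show "\<ominus>\<^bsub>graded_regular R\<^esub> x \<in> homog R i" using additive_subgroup.a_inv_closed[OF H x] by simp
    qed (use H homog_R_closed in \<open>auto intro: additive_subgroup.zero_closed additive_subgroup.a_closed\<close>)
  next
    fix x assume "x \<in> carrier (graded_regular R)"
    then show "\<exists>!f. decomposes (graded_regular R) (homog R) x f"
      using decomposition_R unfolding direct_sum_decomposition_def decomposes_regular by simp
  qed
  ultimately show ?thesis unfolding graded_module_def using homog_R_mult by auto
qed

lemma comp_act_homog:
  assumes A: "graded_module R A" and b: "b \<in> homog A n" and r: "r \<in> carrier R"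
  shows "component A k (r \<odot>\<^bsub>A\<^esub> b) = component R (k - n) r \<odot>\<^bsub>A\<^esub> b"
proof -
  interpret A: right_module R A by (rule graded_right_module[OF A])
  have bc: "b \<in> carrier A" by (rule homog_closed[OF A b])
  show ?thesis
    using abelian_R decomposition_R r
  proof (induction r rule: graded_induct)
    case zero
    then show ?case using bc comp_zero[OF A] component_zero[OF abelian_R decomposition_R] by simp
  next
    case (add r s)
    then show ?case
      using bc component_add[OF abelian_R decomposition_R] comp_add[OF A] A.act_closed
        component_closed[OF decomposition_R] by (simp add: A.act_add_ring)
  next
    case (homog i r)
    then show ?case
      using comp_act[OF A homog(1) bc, of k] comp_homog[OF A b, of "k - i"] bc
        component_homog[OF abelian_R decomposition_R homog(1), of "k - n"] by auto
  qed
qed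

end

section \<open>Dual bases and lifting for projective modules generated in one degree\<close>

context split_alg
begin

text \<open>Coordinates that exhibit \<open>A\<close> as the direct sum of the modules
  \<open>e (\<iota> b) R\<close>. The functional \<open>c b\<close> takes the value
  \<open>e (\<iota> b)\<close> at \<open>b\<close>, and not one, because \<open>b\<close> is fixed
  by this idempotent. Since \<open>b\<close> has degree \<open>n\<close> and this value degree 0,
  the degree of \<open>c b\<close> is \<open>- n\<close>. Working with functionals avoids forming
  direct sums.\<close>

definition dual_basis :: "('r, 'a, 'd) graded_scheme \<Rightarrow> int \<Rightarrow> 'a set \<Rightarrow> ('a \<Rightarrow> nat) \<Rightarrow> ('a \<Rightarrow> 'a \<Rightarrow> 'r) \<Rightarrow> bool"
  where "dual_basis A n B \<iota> c \<longleftrightarrow> finite B \<and> B \<subseteq> homog A n \<and>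
    (\<forall>b\<in>B. \<iota> b < m \<and> e (\<iota> b) \<odot>\<^bsub>A\<^esub> b = b \<and> c b \<in> graded_hom R (- n) A (graded_regular R) \<and>
       (\<forall>b'\<in>B. c b b' = (if b = b' then e (\<iota> b) else \<zero>\<^bsub>R\<^esub>))) \<and>
    (\<forall>x\<in>carrier A. x = (\<Oplus>\<^bsub>A\<^esub>b\<in>B. c b x \<odot>\<^bsub>A\<^esub> b))"

text \<open>
  The projectivity of \<open>A\<close> provides a section of \<open>R\<^sup>B \<rightarrow> A\<close>. Its homogeneous part of degree \<open>0\<close>,
  cut down to \<open>\<Oplus> e\<^sub>\<iota>\<^sub>(\<^sub>b\<^sub>) R\<close>, is an isomorphism, because it is one in the generating degree \<open>n\<close>.
\<close>

lemma dual_basis_exists: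
  assumes gA: "graded_module R A" and proj: "projective_module R A" and gen: "generated_in_degree R A n"
    and B: "adapted_basis A n B"
  shows "\<exists>\<iota> c. dual_basis A n B \<iota> c"
proof -
  interpret A: right_module R A by (rule graded_right_module[OF gA])
  let ?F = "free_module R B" and ?C = "underlying A" and ?G = "graded_regular R"
  have fB: "finite B" and Bh: "B \<subseteq> homog A n" and Bad: "B \<subseteq> adapted A n"
    using B unfolding adapted_basis_def adapted_indep_def adapted_def by auto
  have Bc: "b \<in> carrier A" if "b \<in> B" for b using Bh homog_closed[OF gA] that by blast
  have "\<forall>b\<in>B. \<exists>i<m. e i \<odot>\<^bsub>A\<^esub> b = b" using Bad unfolding adapted_def by auto
  then obtain \<iota> where \<iota>: "\<And>b. b \<in> B \<Longrightarrow> \<iota> b < m" "\<And>b. b \<in> B \<Longrightarrow> e (\<iota> b) \<odot>\<^bsub>A\<^esub> b = b" by metis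
  define g where "g = (\<lambda>f. \<Oplus>\<^bsub>A\<^esub>b\<in>B. f b \<odot>\<^bsub>A\<^esub> b)"
  note Fc = free_module_closed[OF R.ring_axioms]
  have gc: "(\<lambda>b. f b \<odot>\<^bsub>A\<^esub> b) \<in> B \<rightarrow> carrier A" if "f \<in> carrier ?F" for f
    using Fc[OF that] Bc A.act_closed by auto
  have gF: "g \<in> rmod_hom R ?F A"
  proof (rule rmod_homI)
    fix f assume f: "f \<in> carrier ?F"
    show "g f \<in> carrier A" unfolding g_def using gc[OF f] by (intro A.M.finsum_closed)
    fix r assume r: "r \<in> carrier R"
    have "g (r \<odot>\<^bsub>?F\<^esub> f) = (\<Oplus>\<^bsub>A\<^esub>b\<in>B. r \<odot>\<^bsub>A\<^esub> (f b \<odot>\<^bsub>A\<^esub> b))"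
      unfolding g_def using Fc[OF f] Bc r
      by (intro A.M.finsum_cong') (auto simp: free_module_def A.act_mult A.act_closed)
    then show "g (r \<odot>\<^bsub>?F\<^esub> f) = r \<odot>\<^bsub>A\<^esub> g f"
      unfolding g_def using A.act_finsum[OF fB gc[OF f] r] by simp
  next
    fix f f' assume f: "f \<in> carrier ?F" "f' \<in> carrier ?F"
    have "g (f \<oplus>\<^bsub>?F\<^esub> f') = (\<Oplus>\<^bsub>A\<^esub>b\<in>B. f b \<odot>\<^bsub>A\<^esub> b \<oplus>\<^bsub>A\<^esub> f' b \<odot>\<^bsub>A\<^esub> b)"
      unfolding g_def using f[THEN Fc] Bc
      by (intro A.M.finsum_cong') (auto simp: free_module_def A.act_add_ring A.act_closed)
    then show "g (f \<oplus>\<^bsub>?F\<^esub> f') = g f \<oplus>\<^bsub>A\<^esub> g f'"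
      unfolding g_def using A.M.finsum_addf[OF gc[OF f(1)] gc[OF f(2)]] by simp
  qed
  have gon: "g ` carrier ?F = carrier A"
  proof (rule rmod_hom_ontoI[OF gA gen right_module_free[OF R.ring_axioms] gF], rule subsetI)
    fix x assume "x \<in> homog A n"
    then obtain a where a: "a \<in> B \<rightarrow> carrier K" "x = (\<Oplus>\<^bsub>A\<^esub>b\<in>B. scal (a b) \<odot>\<^bsub>A\<^esub> b)"
      using adapted_basis_expand[OF gA B] by blast
    let ?f = "\<lambda>b. if b \<in> B then scal (a b) else \<zero>\<^bsub>R\<^esub>"
    have f: "?f \<in> carrier ?F" using a scal_closed unfolding free_module_def by auto
    have "g ?f = x" unfolding g_def a(2) using gc[OF f] a(1) Bc scal_closed A.act_closed
      by (intro A.M.finsum_cong') (auto simp: Pi_iff)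
    with f show "x \<in> g ` carrier ?F" by blast
  qed
  \<comment> \<open>The identity of \<open>A\<close> is lifted along the epimorphism
    \<open>g\<close> from the free module on \<open>B\<close>; both test modules have the types and
    the plain record format that \<open>projective_module\<close> prescribes.\<close>
  have "\<exists>h\<in>rmod_hom R A ?F. \<forall>x\<in>carrier A. g (h x) = x"
  proof -
    have P: "\<And>(B' :: ('r, 'a \<Rightarrow> 'r) module) (C :: ('r, 'a) module) g f.
       right_module R B' \<and> right_module R C \<and>
       g \<in> rmod_hom R B' C \<and> g ` carrier B' = carrier C \<and> f \<in> rmod_hom R A C \<Longrightarrow>
       (\<exists>h\<in>rmod_hom R A B'. \<forall>x\<in>carrier A. g (h x) = f x)"
      using proj unfolding projective_module_def by blast
    show ?thesis
      by (rule P[of ?F ?C g "\<lambda>x. x"])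
        (use right_module_free[OF R.ring_axioms] right_module_underlying[OF A.right_module_axioms] gF gon
          in \<open>simp_all add: rmod_hom_def underlying_def\<close>)
  qed
  then obtain h where h: "h \<in> rmod_hom R A ?F" and gh: "\<And>x. x \<in> carrier A \<Longrightarrow> g (h x) = x" by blast
  note hc = Fc[OF rmod_hom_closed[OF h]]
  have h0: "(\<lambda>x. h x b) \<in> rmod_hom R A ?G" for b
    by (rule rmod_homI) (use hc rmod_hom_add[OF h] rmod_hom_act[OF h] in \<open>simp_all add: free_module_def\<close>)
  \<comment> \<open>The coordinates of an arbitrary section are not homogeneous; only their parts of
    degree \<open>- n\<close> are kept.\<close>
  define p where "p = (\<lambda>b. part (- n) A ?G (\<lambda>x. h x b))"
  have p: "p b \<in> graded_hom R (- n) A ?G" for b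
    unfolding p_def by (rule part_graded_hom[OF gA graded_module_regular h0])
  have pc: "p b x \<in> carrier R" if "x \<in> carrier A" for b x
    using rmod_hom_closed[OF graded_hom_rmod[OF p] that] by simp
  \<comment> \<open>Multiplication by the idempotent brings the coordinate into
    \<open>e (\<iota> b) R\<close>. The term at \<open>b\<close> does not change, as
    \<open>b\<close> is fixed by this idempotent.\<close>
  define c where "c = (\<lambda>b x. e (\<iota> b) \<otimes>\<^bsub>R\<^esub> p b x)"
  have cc: "c b x \<in> carrier R" if "b \<in> B" "x \<in> carrier A" for b x
    unfolding c_def using pc idem_closed[OF \<iota>(1)] that by simp
  have c: "c b \<in> graded_hom R (- n) A ?G" if b: "b \<in> B" for b
  proof -
    have "(\<lambda>y. e (\<iota> b) \<otimes>\<^bsub>R\<^esub> y) \<in> graded_hom R 0 ?G ?G"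
      unfolding graded_hom_def rmod_hom_def
      using idem_closed[OF \<iota>(1)[OF b]] homog_R_mult[OF idem_homog[OF \<iota>(1)[OF b]]]
      by (auto simp: R.r_distr R.m_assoc)
    from graded_hom_comp'[OF p this] show ?thesis unfolding c_def by simp
  qed
  have cb: "c b x \<odot>\<^bsub>A\<^esub> b = p b x \<odot>\<^bsub>A\<^esub> b" if "b \<in> B" "x \<in> carrier A" for b x
    unfolding c_def using A.act_mult[OF idem_closed[OF \<iota>(1)] pc Bc] \<iota>(2) that by simp
  \<comment> \<open>In degree \<open>k\<close> the sum involves only the components of degree
    \<open>k - n\<close> of the coordinates of \<open>x\<close>, and there \<open>p\<close> agrees
    with the section \<open>h\<close> applied to the component of \<open>x\<close> of degree
    \<open>k\<close>.\<close>
  have expand: "x = (\<Oplus>\<^bsub>A\<^esub>b\<in>B. c b x \<odot>\<^bsub>A\<^esub> b)" if x: "x \<in> carrier A" for x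
  proof (rule comp_eqI[OF gA x])
    show "(\<Oplus>\<^bsub>A\<^esub>b\<in>B. c b x \<odot>\<^bsub>A\<^esub> b) \<in> carrier A"
      using cc x Bc A.act_closed by (intro A.M.finsum_closed) auto
    fix k
    have xk: "component A k x \<in> carrier A" by (rule comp_closed[OF gA x])
    have "component A k (\<Oplus>\<^bsub>A\<^esub>b\<in>B. c b x \<odot>\<^bsub>A\<^esub> b) = (\<Oplus>\<^bsub>A\<^esub>b\<in>B. component A k (p b x \<odot>\<^bsub>A\<^esub> b))"
      using cb x cc Bc A.act_closed pc comp_closed[OF gA]
      by (subst component_finsum[OF graded_abelian[OF gA] decomposition[OF gA] fB])
        (auto intro!: A.M.finsum_cong')
    also have "\<dots> = (\<Oplus>\<^bsub>A\<^esub>b\<in>B. component A k (h (component A k x) b \<odot>\<^bsub>A\<^esub> b))"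
    proof (intro A.M.finsum_cong')
      fix b assume b: "b \<in> B"
      have "component R (k - n) (p b x) = component R (k - n) (h (component A k x) b)"
        using comp_part[OF gA graded_module_regular h0 x, of "- n" k b] unfolding p_def by simp
      then show "component A k (p b x \<odot>\<^bsub>A\<^esub> b) = component A k (h (component A k x) b \<odot>\<^bsub>A\<^esub> b)"
        using comp_act_homog[OF gA subsetD[OF Bh b]] pc[OF x] hc[OF xk] by simp
    qed (use hc[OF xk] Bc A.act_closed comp_closed[OF gA] in auto)
    also have "\<dots> = component A k (g (h (component A k x)))"
      unfolding g_def
      by (rule component_finsum[OF graded_abelian[OF gA] decomposition[OF gA] fB, symmetric])
        (use hc[OF xk] Bc A.act_closed in auto)
    also have "\<dots> = component A k x" using gh[OF xk] comp_homog[OF gA comp_in[OF gA x], of k k] by simp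
    finally show "component A k x = component A k (\<Oplus>\<^bsub>A\<^esub>b\<in>B. c b x \<odot>\<^bsub>A\<^esub> b)" by simp
  qed
  \<comment> \<open>In degree 0 the coordinate is a scalar multiple of \<open>e (\<iota> b)\<close>;
    the scalars are found by comparing the expansion of \<open>b'\<close> with the trivial one,
    \<open>B\<close> being independent over \<open>K\<close>.\<close>
  have delta: "c b b' = (if b = b' then e (\<iota> b) else \<zero>\<^bsub>R\<^esub>)" if b: "b \<in> B" and b': "b' \<in> B" for b b'
  proof -
    interpret K: field K by (rule field_K)
    have "\<exists>a\<in>carrier K. c b b' = e (\<iota> b) \<otimes>\<^bsub>R\<^esub> scal a" if b: "b \<in> B" for b
    proof -
      have "p b b' \<in> homog R 0" using graded_hom_homog[OF p subsetD[OF Bh b'], of b] by simp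
      then obtain a where "a \<in> carrier K" "c b b' = a \<odot>\<^bsub>R\<^esub> e (\<iota> b)"
        unfolding c_def using idem_scalar[OF \<iota>(1)[OF b]] by blast
      then show ?thesis using scal_mult(2) idem_closed[OF \<iota>(1)[OF b]] by auto
    qed
    then obtain a where a: "\<And>b. b \<in> B \<Longrightarrow> a b \<in> carrier K" "\<And>b. b \<in> B \<Longrightarrow> c b b' = e (\<iota> b) \<otimes>\<^bsub>R\<^esub> scal (a b)"
      by metis
    have "b' = (\<Oplus>\<^bsub>A\<^esub>b\<in>B. c b b' \<odot>\<^bsub>A\<^esub> b)" by (rule expand[OF Bc[OF b']])
    also have "\<dots> = (\<Oplus>\<^bsub>A\<^esub>b\<in>B. scal (a b) \<odot>\<^bsub>A\<^esub> b)"
      using a Bc \<iota> idem_closed scal_closed A.act_closed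
      by (intro A.M.finsum_cong') (auto simp: A.act_mult)
    finally have 1: "b' = (\<Oplus>\<^bsub>A\<^esub>b\<in>B. scal (a b) \<odot>\<^bsub>A\<^esub> b)" .
    let ?d = "\<lambda>b. if b' = b then \<one>\<^bsub>K\<^esub> else \<zero>\<^bsub>K\<^esub>"
    have "(\<Oplus>\<^bsub>A\<^esub>b\<in>B. scal (?d b) \<odot>\<^bsub>A\<^esub> b) = (\<Oplus>\<^bsub>A\<^esub>b\<in>B. if b' = b then b else \<zero>\<^bsub>A\<^esub>)"
      using Bc A.act_one by (intro A.M.finsum_cong') (auto simp: scal_one scal_zero)
    also have "\<dots> = b'" using A.M.finsum_singleton[OF b' fB, of "\<lambda>b. b"] Bc by auto
    finally have 2: "b' = (\<Oplus>\<^bsub>A\<^esub>b\<in>B. scal (?d b) \<odot>\<^bsub>A\<^esub> b)" by simp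
    have "a b = ?d b"
      by (rule adapted_indep_unique[OF gA, of n B])
        (use B a(1) b 1 2 in \<open>auto simp: adapted_basis_def\<close>)
    then show ?thesis using a(2)[OF b] idem_closed[OF \<iota>(1)[OF b]] by (auto simp: scal_one scal_zero)
  qed
  have "dual_basis A n B \<iota> c"
    unfolding dual_basis_def using fB Bh \<iota> c delta expand by blast
  then show ?thesis by blast
qed

text \<open>What the term \<open>P n\<close> of a linear resolution satisfies. Isolating it allows
  resolutions on different types to be compared.\<close>

definition linear_term :: "('r, 'a, 'd) graded_scheme \<Rightarrow> int \<Rightarrow> bool"
  where "linear_term A n \<longleftrightarrow> graded_module R A \<and> projective_module R A \<and> finitely_generated R A \<and>
    generated_in_degree R A n"

lemma linear_termD:
  assumes "linear_term A n"
  shows "graded_module R A" "right_module R A" "projective_module R A" "finitely_generated R A"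
    "generated_in_degree R A n"
  using assms graded_right_module unfolding linear_term_def by blast+

lemma adapted_indep_empty:
  assumes "graded_module R A"
  shows "adapted_indep A n {}"
  by (rule adapted_indepI[OF assms]) auto

lemma adapted_indep_singleton:
  assumes gA: "graded_module R A" and w: "w \<in> adapted A n" "w \<noteq> \<zero>\<^bsub>A\<^esub>"
  shows "adapted_indep A n {w}"
proof (rule adapted_indepI[OF gA])
  interpret A: right_module R A by (rule graded_right_module[OF gA])
  interpret V: module K "hspace A n" by (rule hspace_module[OF gA])
  have wc: "w \<in> carrier A" using w homog_closed[OF gA] unfolding adapted_def by blast
  fix a b assume a: "a \<in> {w} \<rightarrow> carrier K" and s: "(\<Oplus>\<^bsub>A\<^esub>b\<in>{w}. scal (a b) \<odot>\<^bsub>A\<^esub> b) = \<zero>\<^bsub>A\<^esub>" and b: "b \<in> {w}"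
  have aw: "a w \<in> carrier K" using a by auto
  have s: "scal (a w) \<odot>\<^bsub>A\<^esub> w = \<zero>\<^bsub>A\<^esub>"
    using s A.M.finsum_insert[of "{}" w "\<lambda>b. scal (a b) \<odot>\<^bsub>A\<^esub> b"] A.act_closed scal_closed[OF aw] wc by simp
  show "a b = \<zero>\<^bsub>K\<^esub>"
  proof (rule ccontr)
    assume "a b \<noteq> \<zero>\<^bsub>K\<^esub>"
    then obtain c where c: "c \<in> carrier K" "c \<otimes>\<^bsub>K\<^esub> a w = \<one>\<^bsub>K\<^esub>"
      using V.inverse_exists[OF field_K aw] b by auto
    have "w = scal (c \<otimes>\<^bsub>K\<^esub> a w) \<odot>\<^bsub>A\<^esub> w" using c wc by (simp add: scal_one A.act_one)
    also have "\<dots> = scal c \<odot>\<^bsub>A\<^esub> (scal (a w) \<odot>\<^bsub>A\<^esub> w)"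
      using scal_prod[OF c(1) aw] A.act_mult[OF scal_closed[OF aw] scal_closed[OF c(1)] wc] by simp
    also have "\<dots> = \<zero>\<^bsub>A\<^esub>" using s scal_closed[OF c(1)] by simp
    finally show False using w by simp
  qed
qed (use w in auto)

lemma linear_term_dual_basis_extends:
  assumes A: "linear_term A n" and C: "adapted_indep A n C"
  shows "\<exists>B \<iota> c. C \<subseteq> B \<and> adapted_basis A n B \<and> dual_basis A n B \<iota> c"
proof -
  obtain B where B: "C \<subseteq> B" "adapted_basis A n B"
    using adapted_basis_extends[OF linear_termD(1,4,5)[OF A] C] by blast
  then show ?thesis using dual_basis_exists[OF linear_termD(1,3,5)[OF A] B(2)] by blast
qed

text \<open>The universal property of a direct sum of modules \<open>e (\<iota> b) R\<close>: the
  image of \<open>b\<close> may be any element fixed by the idempotent of \<open>b\<close>.\<close>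

lemma dual_basis_homs:
  assumes gA: "graded_module R A" and N: "right_module R N" and D: "dual_basis A n B \<iota> c"
    and \<phi>: "\<And>b. b \<in> B \<Longrightarrow> \<phi> b \<in> carrier N" "\<And>b. b \<in> B \<Longrightarrow> e (\<iota> b) \<odot>\<^bsub>N\<^esub> \<phi> b = \<phi> b"
  shows "(\<lambda>x. \<Oplus>\<^bsub>N\<^esub>b\<in>B. c b x \<odot>\<^bsub>N\<^esub> \<phi> b) \<in> rmod_hom R A N"
    "b' \<in> B \<Longrightarrow> (\<Oplus>\<^bsub>N\<^esub>b\<in>B. c b b' \<odot>\<^bsub>N\<^esub> \<phi> b) = \<phi> b'"
proof -
  interpret N: right_module R N by (rule N)
  have fB: "finite B" and c: "\<And>b. b \<in> B \<Longrightarrow> c b \<in> rmod_hom R A (graded_regular R)"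
    and delta: "\<And>b b'. \<lbrakk>b \<in> B; b' \<in> B\<rbrakk> \<Longrightarrow> c b b' = (if b = b' then e (\<iota> b) else \<zero>\<^bsub>R\<^esub>)"
    and \<iota>: "\<And>b. b \<in> B \<Longrightarrow> \<iota> b < m"
    using D graded_hom_rmod unfolding dual_basis_def by blast+
  have cc: "c b x \<in> carrier R" if "b \<in> B" "x \<in> carrier A" for b x
    using rmod_hom_closed[OF c[OF that(1)] that(2)] by simp
  have t: "(\<lambda>b. c b x \<odot>\<^bsub>N\<^esub> \<phi> b) \<in> B \<rightarrow> carrier N" if "x \<in> carrier A" for x
    using cc that \<phi> N.act_closed by auto
  show "(\<lambda>x. \<Oplus>\<^bsub>N\<^esub>b\<in>B. c b x \<odot>\<^bsub>N\<^esub> \<phi> b) \<in> rmod_hom R A N"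
  proof (rule rmod_homI)
    fix x assume x: "x \<in> carrier A"
    show "(\<Oplus>\<^bsub>N\<^esub>b\<in>B. c b x \<odot>\<^bsub>N\<^esub> \<phi> b) \<in> carrier N" using t[OF x] by (rule N.M.finsum_closed)
    fix r assume r: "r \<in> carrier R"
    have "(\<Oplus>\<^bsub>N\<^esub>b\<in>B. c b (r \<odot>\<^bsub>A\<^esub> x) \<odot>\<^bsub>N\<^esub> \<phi> b) = (\<Oplus>\<^bsub>N\<^esub>b\<in>B. r \<odot>\<^bsub>N\<^esub> (c b x \<odot>\<^bsub>N\<^esub> \<phi> b))"
      using cc x r \<phi> N.act_closed rmod_hom_act[OF c] by (intro N.M.finsum_cong') (auto simp: N.act_mult)
    then show "(\<Oplus>\<^bsub>N\<^esub>b\<in>B. c b (r \<odot>\<^bsub>A\<^esub> x) \<odot>\<^bsub>N\<^esub> \<phi> b) = r \<odot>\<^bsub>N\<^esub> (\<Oplus>\<^bsub>N\<^esub>b\<in>B. c b x \<odot>\<^bsub>N\<^esub> \<phi> b)"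
      using N.act_finsum[OF fB t[OF x] r] by simp
  next
    fix x y assume x: "x \<in> carrier A" and y: "y \<in> carrier A"
    have "(\<Oplus>\<^bsub>N\<^esub>b\<in>B. c b (x \<oplus>\<^bsub>A\<^esub> y) \<odot>\<^bsub>N\<^esub> \<phi> b) = (\<Oplus>\<^bsub>N\<^esub>b\<in>B. c b x \<odot>\<^bsub>N\<^esub> \<phi> b \<oplus>\<^bsub>N\<^esub> c b y \<odot>\<^bsub>N\<^esub> \<phi> b)"
      using cc x y \<phi> N.act_closed rmod_hom_add[OF c] by (intro N.M.finsum_cong') (auto simp: N.act_add_ring)
    then show "(\<Oplus>\<^bsub>N\<^esub>b\<in>B. c b (x \<oplus>\<^bsub>A\<^esub> y) \<odot>\<^bsub>N\<^esub> \<phi> b) =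
        (\<Oplus>\<^bsub>N\<^esub>b\<in>B. c b x \<odot>\<^bsub>N\<^esub> \<phi> b) \<oplus>\<^bsub>N\<^esub> (\<Oplus>\<^bsub>N\<^esub>b\<in>B. c b y \<odot>\<^bsub>N\<^esub> \<phi> b)"
      using N.M.finsum_addf[OF t[OF x] t[OF y]] by simp
  qed
  assume b': "b' \<in> B"
  have "(\<Oplus>\<^bsub>N\<^esub>b\<in>B. c b b' \<odot>\<^bsub>N\<^esub> \<phi> b) = (\<Oplus>\<^bsub>N\<^esub>b\<in>B. if b' = b then \<phi> b else \<zero>\<^bsub>N\<^esub>)"
    using delta[OF _ b'] \<phi> by (intro N.M.finsum_cong') auto
  also have "\<dots> = \<phi> b'" using N.M.finsum_singleton[OF b' fB, of \<phi>] \<phi> by auto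
  finally show "(\<Oplus>\<^bsub>N\<^esub>b\<in>B. c b b' \<odot>\<^bsub>N\<^esub> \<phi> b) = \<phi> b'" .
qed

lemma dual_basis_eqI:
  assumes gA: "graded_module R A" and N: "right_module R N" and D: "dual_basis A n B \<iota> c"
    and f: "f \<in> rmod_hom R A N" and g: "g \<in> rmod_hom R A N" and eq: "\<And>b. b \<in> B \<Longrightarrow> f b = g b"
    and x: "x \<in> carrier A"
  shows "f x = g x"
proof -
  interpret A: right_module R A by (rule graded_right_module[OF gA])
  interpret N: right_module R N by (rule N)
  have fB: "finite B" and c: "\<And>b. b \<in> B \<Longrightarrow> c b \<in> rmod_hom R A (graded_regular R)"
    and B: "\<And>b. b \<in> B \<Longrightarrow> b \<in> carrier A" and ex: "x = (\<Oplus>\<^bsub>A\<^esub>b\<in>B. c b x \<odot>\<^bsub>A\<^esub> b)"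
    using D graded_hom_rmod homog_closed[OF gA] x unfolding dual_basis_def by blast+
  have cc: "c b x \<in> carrier R" if "b \<in> B" for b using rmod_hom_closed[OF c[OF that] x] by simp
  have *: "h x = (\<Oplus>\<^bsub>N\<^esub>b\<in>B. c b x \<odot>\<^bsub>N\<^esub> h b)" if h: "h \<in> rmod_hom R A N" for h
  proof -
    have "h x = h (\<Oplus>\<^bsub>A\<^esub>b\<in>B. c b x \<odot>\<^bsub>A\<^esub> b)" using ex by simp
    also have "\<dots> = (\<Oplus>\<^bsub>N\<^esub>b\<in>B. h (c b x \<odot>\<^bsub>A\<^esub> b))"
      using cc B A.act_closed by (intro rmod_hom_finsum[OF A.right_module_axioms N h fB]) auto
    also have "\<dots> = (\<Oplus>\<^bsub>N\<^esub>b\<in>B. c b x \<odot>\<^bsub>N\<^esub> h b)"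
      using cc B N.act_closed rmod_hom_closed[OF h] rmod_hom_act[OF h] by (intro N.M.finsum_cong') auto
    finally show ?thesis .
  qed
  show ?thesis
    unfolding *[OF f] *[OF g] using eq cc B rmod_hom_closed[OF g] N.act_closed
    by (intro N.M.finsum_cong') auto
qed

text \<open>Unlike the definition of projectivity, this serves test modules of every type. A basis
  vector is sent to a preimage of its value, cut down by its idempotent; this is still a preimage
  because the value of \<open>f\<close> is fixed by the same idempotent.\<close>

lemma linear_term_lift:
  assumes A: "linear_term A n" and B: "right_module R B" and C: "right_module R C"
    and g: "g \<in> rmod_hom R B C" and f: "f \<in> rmod_hom R A C" and im: "f ` carrier A \<subseteq> g ` carrier B"
  shows "\<exists>h\<in>rmod_hom R A B. \<forall>x\<in>carrier A. g (h x) = f x"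
proof -
  interpret A: right_module R A by (rule linear_termD(2)[OF A])
  interpret B: right_module R B by (rule B)
  note gA = linear_termD(1)[OF A]
  obtain S \<iota> c where D: "dual_basis A n S \<iota> c"
    using linear_term_dual_basis_extends[OF A adapted_indep_empty[OF gA]] by blast
  have S: "\<And>b. b \<in> S \<Longrightarrow> b \<in> carrier A" and \<iota>: "\<And>b. b \<in> S \<Longrightarrow> \<iota> b < m"
    and eb: "\<And>b. b \<in> S \<Longrightarrow> e (\<iota> b) \<odot>\<^bsub>A\<^esub> b = b"
    using D homog_closed[OF gA] unfolding dual_basis_def by blast+
  have "\<exists>y\<in>carrier B. g y = f b" if "b \<in> S" for b
  proof -
    have "f b \<in> g ` carrier B" using im S[OF that] by blast
    then show ?thesis by auto
  qed
  then obtain y where y: "\<And>b. b \<in> S \<Longrightarrow> y b \<in> carrier B" "\<And>b. b \<in> S \<Longrightarrow> g (y b) = f b" by metis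
  define \<phi> where "\<phi> = (\<lambda>b. e (\<iota> b) \<odot>\<^bsub>B\<^esub> y b)"
  have \<phi>: "\<phi> b \<in> carrier B" "e (\<iota> b) \<odot>\<^bsub>B\<^esub> \<phi> b = \<phi> b" "g (\<phi> b) = f b" if b: "b \<in> S" for b
    using y[OF b] \<iota>[OF b] idem_closed[OF \<iota>[OF b]] B.act_mult[of "e (\<iota> b)" "e (\<iota> b)" "y b", symmetric]
      idem_mult[OF \<iota>[OF b] \<iota>[OF b]] B.act_closed rmod_hom_act[OF g] rmod_hom_act[OF f _ S[OF b], symmetric] eb[OF b]
    unfolding \<phi>_def by simp_all
  let ?h = "\<lambda>x. \<Oplus>\<^bsub>B\<^esub>b\<in>S. c b x \<odot>\<^bsub>B\<^esub> \<phi> b"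
  have h: "?h \<in> rmod_hom R A B" and hb: "\<And>b. b \<in> S \<Longrightarrow> ?h b = \<phi> b"
    using dual_basis_homs[OF gA B D, of \<phi>] \<phi> by blast+
  have "g (?h x) = f x" if "x \<in> carrier A" for x
    by (rule dual_basis_eqI[OF gA C D rmod_hom_comp[OF h g] f _ that]) (simp add: hb \<phi>)
  with h show ?thesis by (intro bexI[of _ ?h]) auto
qed

text \<open>The part of degree \<open>j\<close> of an ungraded lift is a lift as well, by
  \<open>part_lift\<close>.\<close>

lemma linear_term_graded_lift:
  assumes A: "linear_term A n" and B: "graded_module R B" and C: "graded_module R C"
    and g: "g \<in> graded_hom R 0 B C" and f: "f \<in> graded_hom R j A C" and im: "f ` carrier A \<subseteq> g ` carrier B"
  shows "\<exists>h\<in>graded_hom R j A B. \<forall>x\<in>carrier A. g (h x) = f x"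
proof -
  note gA = linear_termD(1)[OF A]
  obtain h where h: "h \<in> rmod_hom R A B" "\<And>x. x \<in> carrier A \<Longrightarrow> g (h x) = f x"
    using linear_term_lift[OF A graded_right_module[OF B] graded_right_module[OF C] graded_hom_rmod[OF g]
        graded_hom_rmod[OF f] im] by blast
  have "g (part j A B h x) = f x" if x: "x \<in> carrier A" for x
  proof -
    have "part j A C (\<lambda>x. g (h x)) x = part j A C f x" by (rule part_cong[OF gA x h(2)])
    then show ?thesis using part_lift[OF gA B C h(1) g x, of j] part_graded[OF gA C f x] by simp
  qed
  then show ?thesis using part_graded_hom[OF gA B h(1)] by blast
qed

end

section \<open>Dimensions of generating spaces; maps determined by the generating degree\<close>

context split_alg
begin

text \<open>The dimension over \<open>K\<close> of the component of degree \<open>n\<close>, counted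
  on a chosen adapted basis; \<open>hdim_eq\<close> makes it independent of the choice.\<close>

definition hdim :: "('r, 'a, 'd) graded_scheme \<Rightarrow> int \<Rightarrow> nat"
  where "hdim A n = card (SOME B. adapted_basis A n B)"

lemma hdim_eq:
  assumes "graded_module R A" "adapted_basis A n B"
  shows "hdim A n = card B"
proof -
  have S: "adapted_basis A n (SOME B. adapted_basis A n B)" using assms(2) by (rule someI)
  show ?thesis unfolding hdim_def
    using adapted_indep_card_le[OF assms(1), of n _ B] adapted_indep_card_le[OF assms(1), of n B]
      S assms(2) unfolding adapted_basis_def by (meson le_antisym)
qed

lemma adapted_indep_image:
  assumes A: "graded_module R A" and A': "graded_module R A'" and l: "l \<in> graded_hom R j A A'"
    and inj: "inj_on l (homog A p)" and B: "adapted_indep A p B"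
  shows "adapted_indep A' (j + p) (l ` B)"
proof (rule adapted_indepI[OF A'])
  interpret A: right_module R A by (rule graded_right_module[OF A])
  interpret A': right_module R A' by (rule graded_right_module[OF A'])
  note lh = graded_hom_rmod[OF l]
  have fB: "finite B" and Bh: "B \<subseteq> homog A p" and Bad: "B \<subseteq> adapted A p"
    using B unfolding adapted_indep_def adapted_def by auto
  have Bc: "b \<in> carrier A" if "b \<in> B" for b using that Bh homog_closed[OF A] by blast
  show "finite (l ` B)" using fB by simp
  show "l ` B \<subseteq> adapted A' (j + p)"
  proof
    fix y assume "y \<in> l ` B"
    then obtain b where b: "b \<in> B" "y = l b" by blast
    then obtain i where i: "i < m" "e i \<odot>\<^bsub>A\<^esub> b = b" using Bad unfolding adapted_def by blast
    have "e i \<odot>\<^bsub>A'\<^esub> l b = l b" using rmod_hom_act[OF lh idem_closed[OF i(1)] Bc[OF b(1)]] i by simp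
    then show "y \<in> adapted A' (j + p)"
      using i b graded_hom_homog[OF l, of b p] Bh unfolding adapted_def by auto
  qed
  fix a y assume a: "a \<in> l ` B \<rightarrow> carrier K" and s: "(\<Oplus>\<^bsub>A'\<^esub>b\<in>l ` B. scal (a b) \<odot>\<^bsub>A'\<^esub> b) = \<zero>\<^bsub>A'\<^esub>"
    and y: "y \<in> l ` B"
  have aK: "a (l b) \<in> carrier K" if "b \<in> B" for b using a that by auto
  have t: "(\<lambda>b. scal (a (l b)) \<odot>\<^bsub>A\<^esub> b) \<in> B \<rightarrow> homog A p"
    using aK Bh homog_act0[OF A scal_homog] by auto
  have tc: "(\<lambda>b. scal (a (l b)) \<odot>\<^bsub>A\<^esub> b) \<in> B \<rightarrow> carrier A" using t homog_closed[OF A] by blast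
  let ?s = "\<Oplus>\<^bsub>A\<^esub>b\<in>B. scal (a (l b)) \<odot>\<^bsub>A\<^esub> b"
  have "l ?s = (\<Oplus>\<^bsub>A'\<^esub>b\<in>B. l (scal (a (l b)) \<odot>\<^bsub>A\<^esub> b))"
    by (rule rmod_hom_finsum[OF A.right_module_axioms A'.right_module_axioms lh fB tc])
  also have "\<dots> = (\<Oplus>\<^bsub>A'\<^esub>b\<in>B. scal (a (l b)) \<odot>\<^bsub>A'\<^esub> l b)"
    using rmod_hom_act[OF lh scal_closed[OF aK] Bc] rmod_hom_closed[OF lh Bc] scal_closed[OF aK] A'.act_closed
    by (intro A'.M.finsum_cong') auto
  also have "\<dots> = (\<Oplus>\<^bsub>A'\<^esub>b\<in>l ` B. scal (a b) \<odot>\<^bsub>A'\<^esub> b)"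
    using rmod_hom_closed[OF lh Bc] scal_closed[OF aK] A'.act_closed inj_on_subset[OF inj Bh]
    by (intro A'.M.finsum_reindex[symmetric]) auto
  also have "\<dots> = l \<zero>\<^bsub>A\<^esub>"
    using s rmod_hom_zero[OF A.right_module_axioms A'.right_module_axioms lh] by simp
  finally have ls: "l ?s = l \<zero>\<^bsub>A\<^esub>" .
  have "?s \<in> homog A p" by (rule finsum_in_subgroup[OF graded_abelian[OF A] homog_subgroup[OF A] fB]) (use t in auto)
  with ls have "?s = \<zero>\<^bsub>A\<^esub>"
    using inj_onD[OF inj] additive_subgroup.zero_closed[OF homog_subgroup[OF A]] by blast
  moreover have "(\<Oplus>\<^bsub>A\<^esub>b\<in>B. scal \<zero>\<^bsub>K\<^esub> \<odot>\<^bsub>A\<^esub> b) = \<zero>\<^bsub>A\<^esub>"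
    using Bc by (intro A.M.add.finprod_one_eqI) (simp add: scal_zero)
  moreover obtain b where b: "b \<in> B" "y = l b" using y by blast
  moreover have "\<zero>\<^bsub>K\<^esub> \<in> carrier K" using field_K by (simp add: field.is_ring ring.ring_simprules(2))
  ultimately have "(\<lambda>b. a (l b)) b = (\<lambda>_. \<zero>\<^bsub>K\<^esub>) b"
    using aK by (intro adapted_indep_unique[OF A B]) auto
  then show "a y = \<zero>\<^bsub>K\<^esub>" using b by simp
qed

text \<open>The images under \<open>l\<close> of an adapted basis of \<open>A\<close> are adapted
  and independent, so they extend to an adapted basis of \<open>A'\<close>. The dual coordinates of
  the latter recover those of \<open>A\<close>, which gives injectivity everywhere; counting
  compares the dimensions, and in case of equality the images are already a basis.\<close>

lemma linear_term_inj:
  assumes A: "linear_term A p" and A': "linear_term A' q" and l: "l \<in> graded_hom R j A A'"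
    and q: "q = j + p" and inj: "inj_on l (homog A p)"
  shows "inj_on l (carrier A)" "hdim A p \<le> hdim A' q"
    "hdim A p = hdim A' q \<Longrightarrow> l ` carrier A = carrier A'"
  unfolding q
proof -
  note A' = A'[unfolded q]
  interpret A: right_module R A by (rule linear_termD(2)[OF A])
  interpret A': right_module R A' by (rule linear_termD(2)[OF A'])
  note gA = linear_termD(1)[OF A] and gA' = linear_termD(1)[OF A'] and lh = graded_hom_rmod[OF l]
  obtain B \<iota> c where B: "adapted_basis A p B" and D: "dual_basis A p B \<iota> c"
    using linear_term_dual_basis_extends[OF A adapted_indep_empty[OF gA]] by blast
  have Bi: "adapted_indep A p B" using B unfolding adapted_basis_def by blast
  obtain B' \<iota>' c' where B': "l ` B \<subseteq> B'" "adapted_basis A' (j + p) B'" and D': "dual_basis A' (j + p) B' \<iota>' c'"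
    using linear_term_dual_basis_extends[OF A' adapted_indep_image[OF gA gA' l inj Bi]] by blast
  have fB: "finite B" and Bh: "B \<subseteq> homog A p" and c: "\<And>b. b \<in> B \<Longrightarrow> c b \<in> rmod_hom R A (graded_regular R)"
    and ex: "\<And>x. x \<in> carrier A \<Longrightarrow> x = (\<Oplus>\<^bsub>A\<^esub>b\<in>B. c b x \<odot>\<^bsub>A\<^esub> b)"
    using D graded_hom_rmod unfolding dual_basis_def by blast+
  have fB': "finite B'" and c': "\<And>b. b \<in> B' \<Longrightarrow> c' b \<in> rmod_hom R A' (graded_regular R)"
    and \<iota>': "\<And>b. b \<in> B' \<Longrightarrow> \<iota>' b < m" "\<And>b. b \<in> B' \<Longrightarrow> e (\<iota>' b) \<odot>\<^bsub>A'\<^esub> b = b"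
    and delta: "\<And>b b'. \<lbrakk>b \<in> B'; b' \<in> B'\<rbrakk> \<Longrightarrow> c' b b' = (if b = b' then e (\<iota>' b) else \<zero>\<^bsub>R\<^esub>)"
    using D' graded_hom_rmod unfolding dual_basis_def by blast+
  have Bc: "b \<in> carrier A" if "b \<in> B" for b using that Bh homog_closed[OF gA] by blast
  have lB: "l b \<in> B'" "l b \<in> carrier A'" if "b \<in> B" for b
    using B'(1) that rmod_hom_closed[OF lh Bc] by auto
  have injB: "inj_on l B" using inj_on_subset[OF inj Bh] .
  show "inj_on l (carrier A)"
  proof (rule rmod_hom_inj_onI[OF A.right_module_axioms A'.right_module_axioms lh])
    fix x assume x: "x \<in> carrier A" and lx: "l x = \<zero>\<^bsub>A'\<^esub>"
    have cc: "c b x \<in> carrier R" if "b \<in> B" for b using rmod_hom_closed[OF c[OF that] x] by simp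
    have "c b x \<odot>\<^bsub>A\<^esub> b = \<zero>\<^bsub>A\<^esub>" if b: "b \<in> B" for b
    proof -
      \<comment> \<open>The coordinate at \<open>l b\<close>, pulled back along \<open>l\<close>,
        sees only the coordinate of \<open>x\<close> at \<open>b\<close>, multiplied by an
        idempotent.\<close>
      let ?f = "\<lambda>x. c' (l b) (l x)"
      let ?i = "\<iota>' (l b)"
      have f: "?f \<in> rmod_hom R A (graded_regular R)" by (rule rmod_hom_comp[OF lh c'[OF lB(1)[OF b]]])
      interpret G: right_module R "graded_regular R" by (rule graded_right_module[OF graded_module_regular])
      note RG = G.right_module_axioms
      have ei: "e ?i \<in> carrier R" by (rule idem_closed[OF \<iota>'(1)[OF lB(1)[OF b]]])
      have "\<zero>\<^bsub>R\<^esub> = ?f x"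
        using rmod_hom_zero[OF A'.right_module_axioms RG c'[OF lB(1)[OF b]]] lx by simp
      also have "\<dots> = ?f (\<Oplus>\<^bsub>A\<^esub>b\<in>B. c b x \<odot>\<^bsub>A\<^esub> b)" using ex[OF x] by simp
      also have "\<dots> = (\<Oplus>\<^bsub>graded_regular R\<^esub>b'\<in>B. ?f (c b' x \<odot>\<^bsub>A\<^esub> b'))"
        using cc Bc A.act_closed by (intro rmod_hom_finsum[OF A.right_module_axioms RG f fB]) auto
      also have "\<dots> = (\<Oplus>\<^bsub>graded_regular R\<^esub>b'\<in>B. if b = b' then e ?i \<otimes>\<^bsub>R\<^esub> c b' x else \<zero>\<^bsub>graded_regular R\<^esub>)"
      proof (rule G.M.finsum_cong')
        fix b' assume b': "b' \<in> B"
        have "(l b = l b') = (b = b')" using inj_on_eq_iff[OF injB b b'] .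
        then show "?f (c b' x \<odot>\<^bsub>A\<^esub> b') = (if b = b' then e ?i \<otimes>\<^bsub>R\<^esub> c b' x else \<zero>\<^bsub>graded_regular R\<^esub>)"
          using rmod_hom_act[OF f cc[OF b'] Bc[OF b']] delta[OF lB(1)[OF b] lB(1)[OF b']] cc[OF b'] by auto
      qed (use ei cc in auto)
      also have "\<dots> = e ?i \<otimes>\<^bsub>R\<^esub> c b x"
        by (rule G.M.finsum_singleton[OF b fB]) (use ei cc in auto)
      finally have z: "e ?i \<otimes>\<^bsub>R\<^esub> c b x = \<zero>\<^bsub>R\<^esub>" by simp
      \<comment> \<open>The idempotent belonging to \<open>l b\<close> fixes \<open>b\<close> too,
        because \<open>l\<close> is injective in the generating degree. Hence the vanishing product
        makes the term of \<open>x\<close> at \<open>b\<close> vanish.\<close>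
      have "l (e ?i \<odot>\<^bsub>A\<^esub> b) = l b"
        using rmod_hom_act[OF lh ei Bc[OF b]] \<iota>'(2)[OF lB(1)[OF b]] by simp
      then have "e ?i \<odot>\<^bsub>A\<^esub> b = b"
        using inj_onD[OF inj] Bh b homog_act0[OF gA idem_homog[OF \<iota>'(1)[OF lB(1)[OF b]]]] by blast
      then show ?thesis using A.act_mult[OF ei cc[OF b] Bc[OF b]] z Bc[OF b] by simp
    qed
    then have "(\<Oplus>\<^bsub>A\<^esub>b\<in>B. c b x \<odot>\<^bsub>A\<^esub> b) = \<zero>\<^bsub>A\<^esub>" by (intro A.M.add.finprod_one_eqI) simp
    then show "x = \<zero>\<^bsub>A\<^esub>" using ex[OF x] by simp
  qed
  have cl: "card (l ` B) = hdim A p" using hdim_eq[OF gA B] card_image[OF injB] by simp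
  show "hdim A p \<le> hdim A' (j + p)"
    using cl hdim_eq[OF gA' B'(2)] card_mono[OF fB' B'(1)] by simp
  show "l ` carrier A = carrier A'" if "hdim A p = hdim A' (j + p)"
  proof (rule rmod_hom_ontoI[OF gA' linear_termD(5)[OF A'] A.right_module_axioms lh], rule subsetI)
    have lBB: "l ` B = B'"
      using card_subset_eq[OF fB' B'(1)] cl that hdim_eq[OF gA' B'(2)] by simp
    fix y assume "y \<in> homog A' (j + p)"
    then obtain a where a: "a \<in> B' \<rightarrow> carrier K" "y = (\<Oplus>\<^bsub>A'\<^esub>b\<in>B'. scal (a b) \<odot>\<^bsub>A'\<^esub> b)"
      using adapted_basis_expand[OF gA' B'(2)] by blast
    note im = rmod_hom_image_subgroup[OF A.right_module_axioms A'.right_module_axioms lh]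
    show "y \<in> l ` carrier A"
      unfolding a(2)
    proof (rule finsum_in_subgroup[OF graded_abelian[OF gA'] im(1) fB'])
      fix b assume "b \<in> B'"
      then show "scal (a b) \<odot>\<^bsub>A'\<^esub> b \<in> l ` carrier A"
        using im(2) scal_closed a(1) lBB Bc by blast
    qed
  qed
qed

text \<open>A scalar of positive degree moves everything out of the lowest degree, before and after
  \<open>f\<close>. So every homomorphism, homogeneous or not, induces a map on lowest
  components.\<close>

lemma comp_hom_lowest:
  assumes A: "graded_module R A" and B: "graded_module R B" and gA: "generated_in_degree R A p"
    and gB: "generated_in_degree R B q" and f: "f \<in> rmod_hom R A B" and x: "x \<in> carrier A"
  shows "component B q (f (component A p x)) = component B q (f x)"
  using x
proof (induction x rule: gen_induct[OF A gA, consumes 1, case_names add act])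
  case (add x y)
  then show ?case
    using comp_add[OF A] comp_add[OF B] comp_closed[OF A] rmod_hom_add[OF f] rmod_hom_closed[OF f] by simp
next
  case (act i r x)
  show ?case
  proof (cases "i = 0")
    case True
    then show ?thesis using comp_homog[OF A homog_act0[OF A, of r x p], of p] act by simp
  next
    case False
    interpret B: right_module R B by (rule graded_right_module[OF B])
    have fx: "f x \<in> carrier B" using rmod_hom_closed[OF f act(5)] .
    have "component A p (r \<odot>\<^bsub>A\<^esub> x) = \<zero>\<^bsub>A\<^esub>"
      using comp_homog[OF A homog_act[OF A act(2,4)], of p] False by simp
    moreover have "component B q (f (r \<odot>\<^bsub>A\<^esub> x)) = \<zero>\<^bsub>B\<^esub>"
      using comp_act[OF B act(2) fx, of q] comp_below[OF B gB fx, of "q - i"] rmod_hom_act[OF f act(3,5)]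
        False act by simp
    ultimately show ?thesis
      using rmod_hom_zero[OF graded_right_module[OF A] graded_right_module[OF B] f] comp_zero[OF B] by simp
  qed
qed

text \<open>
  An isomorphism of the quotients lifts to maps in both directions. Because neither quotient map has a kernel in
  the generating degree, the lowest homogeneous parts of the lifts are mutually inverse.
\<close>

lemma graded_iso_of_iso:
  assumes A: "linear_term A p" and B: "linear_term B q"
    and U: "right_module R U" and W: "right_module R W"
    and g: "g \<in> rmod_hom R A U" "g ` carrier A = carrier U"
    and h: "h \<in> rmod_hom R B W" "h ` carrier B = carrier W"
    and kg: "\<And>x k. \<lbrakk>x \<in> carrier A; g x = \<zero>\<^bsub>U\<^esub>\<rbrakk> \<Longrightarrow> g (component A k x) = \<zero>\<^bsub>U\<^esub>"
    and kh: "\<And>x k. \<lbrakk>x \<in> carrier B; h x = \<zero>\<^bsub>W\<^esub>\<rbrakk> \<Longrightarrow> h (component B k x) = \<zero>\<^bsub>W\<^esub>"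
    and ig: "\<And>x. \<lbrakk>x \<in> homog A p; g x = \<zero>\<^bsub>U\<^esub>\<rbrakk> \<Longrightarrow> x = \<zero>\<^bsub>A\<^esub>"
    and ih: "\<And>x. \<lbrakk>x \<in> homog B q; h x = \<zero>\<^bsub>W\<^esub>\<rbrakk> \<Longrightarrow> x = \<zero>\<^bsub>B\<^esub>"
    and iso: "rmod_isomorphic R U W"
  shows "\<exists>\<phi>\<in>graded_hom R (q - p) A B. \<exists>\<psi>\<in>graded_hom R (p - q) B A.
    (\<forall>x\<in>carrier A. \<psi> (\<phi> x) = x) \<and> (\<forall>y\<in>carrier B. \<phi> (\<psi> y) = y) \<and>
    (\<forall>x\<in>carrier A. g x = \<zero>\<^bsub>U\<^esub> \<longrightarrow> h (\<phi> x) = \<zero>\<^bsub>W\<^esub>) \<and>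
    (\<forall>y\<in>carrier B. h y = \<zero>\<^bsub>W\<^esub> \<longrightarrow> g (\<psi> y) = \<zero>\<^bsub>U\<^esub>)"
proof -
  \<comment> \<open>One direction, with the types of both modules left open, so that it yields
    \<open>F\<close> and, after exchanging the roles, \<open>G\<close>.\<close>
  have half: "\<exists>F\<in>rmod_hom R A B. (\<forall>x\<in>carrier A. h (F x) = f (g x)) \<and>
      (\<forall>x\<in>carrier A. g x = \<zero>\<^bsub>U\<^esub> \<longrightarrow> h (part (q - p) A B F x) = \<zero>\<^bsub>W\<^esub>)"
    if A: "linear_term A p" and B: "linear_term B q"
      and U: "right_module R U" and W: "right_module R W"
      and g: "g \<in> rmod_hom R A U" and h: "h \<in> rmod_hom R B W" "h ` carrier B = carrier W"
      and kg: "\<And>x k. \<lbrakk>x \<in> carrier A; g x = \<zero>\<^bsub>U\<^esub>\<rbrakk> \<Longrightarrow> g (component A k x) = \<zero>\<^bsub>U\<^esub>"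
      and kh: "\<And>x k. \<lbrakk>x \<in> carrier B; h x = \<zero>\<^bsub>W\<^esub>\<rbrakk> \<Longrightarrow> h (component B k x) = \<zero>\<^bsub>W\<^esub>"
      and f: "f \<in> rmod_hom R U W"
    for A :: "('r, 'a1, 'd1) graded_scheme" and p U g and B :: "('r, 'a2, 'd2) graded_scheme" and q W h f
  proof -
    note gA = linear_termD(1)[OF A] and gB = linear_termD(1)[OF B]
    note rA = linear_termD(2)[OF A] and rB = linear_termD(2)[OF B]
    interpret B: right_module R B by (rule rB)
    interpret W: right_module R W by (rule W)
    have gf: "(\<lambda>x. f (g x)) \<in> rmod_hom R A W" by (rule rmod_hom_comp[OF g f])
    obtain F where F: "F \<in> rmod_hom R A B" "\<And>x. x \<in> carrier A \<Longrightarrow> h (F x) = f (g x)"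
      using linear_term_lift[OF A rB W h(1) gf] rmod_hom_closed[OF gf] h(2) by blast
    have "h (part (q - p) A B F x) = \<zero>\<^bsub>W\<^esub>" if x: "x \<in> carrier A" and gx: "g x = \<zero>\<^bsub>U\<^esub>" for x
    proof -
      let ?y = "part (q - p) A B F x"
      have y: "?y \<in> carrier B" by (rule part_closed[OF gA gB F(1) x])
      \<comment> \<open>Each component of the part is a component of \<open>F\<close> at a component
        of \<open>x\<close>. Since both kernels contain the components of their elements, it is
        killed by \<open>h\<close>.\<close>
      have hk: "h (component B k ?y) = \<zero>\<^bsub>W\<^esub>" for k
      proof -
        let ?k = "k - (q - p)"
        have xk: "component A ?k x \<in> carrier A" by (rule comp_closed[OF gA x])
        have "component B k ?y = component B k (F (component A ?k x))"
          using comp_part[OF gA gB F(1) x, of "q - p" ?k] by simp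
        moreover have "h (F (component A ?k x)) = \<zero>\<^bsub>W\<^esub>"
          using F(2)[OF xk] kg[OF x gx] rmod_hom_zero[OF U W f] by simp
        ultimately show ?thesis using kh rmod_hom_closed[OF F(1) xk] by simp
      qed
      have "h ?y = h (\<Oplus>\<^bsub>B\<^esub>i\<in>{i. component B i ?y \<noteq> \<zero>\<^bsub>B\<^esub>}. component B i ?y)"
        using component_sum(2)[OF decomposition[OF gB] y] by simp
      also have "\<dots> = (\<Oplus>\<^bsub>W\<^esub>i\<in>{i. component B i ?y \<noteq> \<zero>\<^bsub>B\<^esub>}. h (component B i ?y))"
        using comp_closed[OF gB y] component_sum(1)[OF decomposition[OF gB] y]
        by (intro rmod_hom_finsum[OF rB W h(1)]) auto
      also have "\<dots> = \<zero>\<^bsub>W\<^esub>" by (intro W.M.add.finprod_one_eqI) (simp add: hk)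
      finally show ?thesis .
    qed
    with F show ?thesis by blast
  qed
  note gA = linear_termD(1)[OF A] and gB = linear_termD(1)[OF B]
  note rA = linear_termD(2)[OF A] and rB = linear_termD(2)[OF B]
  note genA = linear_termD(5)[OF A] and genB = linear_termD(5)[OF B]
  obtain f where f: "f \<in> rmod_hom R U W" "bij_betw f (carrier U) (carrier W)"
    using iso unfolding rmod_isomorphic_def by blast
  define f' where "f' = inv_into (carrier U) f"
  have f'f: "f' (f x) = x" if "x \<in> carrier U" for x
    using that f(2) unfolding f'_def by (simp add: bij_betw_inv_into_left)
  have ff': "f (f' y) = y" "f' y \<in> carrier U" if "y \<in> carrier W" for y
    using that f(2) bij_betwE[OF bij_betw_inv_into[OF f(2)]] unfolding f'_def
    by (simp_all add: bij_betw_inv_into_right)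
  have f': "f' \<in> rmod_hom R W U"
  proof (rule rmod_homI)
    interpret U: right_module R U by (rule U)
    fix y assume y: "y \<in> carrier W"
    then show "f' y \<in> carrier U" by (rule ff')
    show "f' (r \<odot>\<^bsub>W\<^esub> y) = r \<odot>\<^bsub>U\<^esub> f' y" if r: "r \<in> carrier R" for r
      using f'f[of "r \<odot>\<^bsub>U\<^esub> f' y"] rmod_hom_act[OF f(1) r ff'(2)[OF y]] ff'[OF y] U.act_closed[OF r] by simp
    show "f' (y \<oplus>\<^bsub>W\<^esub> z) = f' y \<oplus>\<^bsub>U\<^esub> f' z" if z: "z \<in> carrier W" for z
      using f'f[of "f' y \<oplus>\<^bsub>U\<^esub> f' z"] rmod_hom_add[OF f(1) ff'(2)[OF y] ff'(2)[OF z]] ff'[OF y] ff'[OF z] by simp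
  qed
  obtain F where F: "F \<in> rmod_hom R A B" "\<And>x. x \<in> carrier A \<Longrightarrow> h (F x) = f (g x)"
    "\<And>x. \<lbrakk>x \<in> carrier A; g x = \<zero>\<^bsub>U\<^esub>\<rbrakk> \<Longrightarrow> h (part (q - p) A B F x) = \<zero>\<^bsub>W\<^esub>"
    using half[OF A B U W g(1) h kg kh f(1)] by blast
  obtain G where G: "G \<in> rmod_hom R B A" "\<And>x. x \<in> carrier B \<Longrightarrow> g (G x) = f' (h x)"
    "\<And>x. \<lbrakk>x \<in> carrier B; h x = \<zero>\<^bsub>W\<^esub>\<rbrakk> \<Longrightarrow> g (part (p - q) B A G x) = \<zero>\<^bsub>U\<^esub>"
    using half[OF B A W U h(1) g kh kg f'] by blast
  have inv: "part (p - q) B A G (part (q - p) A B F x) = x"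
    if A: "graded_module R A" and B: "graded_module R B"
      and genA: "generated_in_degree R A p" and genB: "generated_in_degree R B q"
      and F: "F \<in> rmod_hom R A B" and G: "G \<in> rmod_hom R B A" and U: "right_module R U"
      and g: "g \<in> rmod_hom R A U" and kg: "\<And>x k. \<lbrakk>x \<in> carrier A; g x = \<zero>\<^bsub>U\<^esub>\<rbrakk> \<Longrightarrow> g (component A k x) = \<zero>\<^bsub>U\<^esub>"
      and ig: "\<And>x. \<lbrakk>x \<in> homog A p; g x = \<zero>\<^bsub>U\<^esub>\<rbrakk> \<Longrightarrow> x = \<zero>\<^bsub>A\<^esub>"
      and GF: "\<And>x. x \<in> carrier A \<Longrightarrow> g (G (F x)) = g x" and x: "x \<in> carrier A"
    for A :: "('r, 'a1, 'd1) graded_scheme" and p U g and B :: "('r, 'a2, 'd2) graded_scheme" and q F G x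
  proof (rule rmod_hom_eqI[OF A genA graded_right_module[OF A] _ rmod_hom_id _ x])
    note rA = graded_right_module[OF A]
    interpret A: right_module R A by (rule rA)
    show "(\<lambda>x. part (p - q) B A G (part (q - p) A B F x)) \<in> rmod_hom R A A"
      by (rule rmod_hom_comp[OF graded_hom_rmod[OF part_graded_hom[OF A B F]]
            graded_hom_rmod[OF part_graded_hom[OF B A G]]])
    fix v assume v: "v \<in> homog A p"
    have vc: "v \<in> carrier A" by (rule homog_closed[OF A v])
    have Fv: "F v \<in> carrier B" by (rule rmod_hom_closed[OF F vc])
    have GFv: "G (F v) \<in> carrier A" by (rule rmod_hom_closed[OF G Fv])
    have "part (q - p) A B F v = component B q (F v)" using part_homog[OF A B F v, of "q - p"] by simp
    moreover have "part (p - q) B A G (component B q (F v)) = component A p (G (component B q (F v)))"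
      using part_homog[OF B A G comp_in[OF B Fv, of q], of "p - q"] by simp
    moreover have "\<dots> = component A p (G (F v))" by (rule comp_hom_lowest[OF B A genB genA G Fv])
    moreover have "component A p (G (F v)) = v"
    proof -
      \<comment> \<open>The difference lies in the kernel of \<open>g\<close>, hence so does its
        lowest component, which is zero by \<open>ig\<close>.\<close>
      let ?d = "G (F v) \<ominus>\<^bsub>A\<^esub> v"
      have d: "?d \<in> carrier A" using GFv vc by simp
      have "g ?d = \<zero>\<^bsub>U\<^esub>" using rmod_hom_eq_iff_minus[OF rA U g GFv vc] GF[OF vc] by simp
      then have "component A p ?d = \<zero>\<^bsub>A\<^esub>" using kg[OF d] ig[OF comp_in[OF A d]] by blast
      moreover have "component A p ?d = component A p (G (F v)) \<ominus>\<^bsub>A\<^esub> component A p v"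
        unfolding a_minus_def using comp_add[OF A] GFv vc
          component_minus[OF graded_abelian[OF A] decomposition[OF A] vc] by simp
      ultimately show ?thesis
        using A.M.minus_eq_zero_iff comp_closed[OF A] GFv vc comp_homog[OF A v, of p] by simp
    qed
    ultimately show "part (p - q) B A G (part (q - p) A B F v) = v" by simp
  qed
  have "part (p - q) B A G (part (q - p) A B F x) = x" if "x \<in> carrier A" for x
    by (rule inv[OF gA gB genA genB F(1) G(1) U g(1) kg ig _ that])
      (use F G f'f rmod_hom_closed[OF F(1)] rmod_hom_closed[OF g(1)] in auto)
  moreover have "part (q - p) A B F (part (p - q) B A G y) = y" if "y \<in> carrier B" for y
    by (rule inv[OF gB gA genB genA G(1) F(1) W h(1) kh ih _ that])
      (use F G ff' rmod_hom_closed[OF G(1)] rmod_hom_closed[OF h(1)] in auto)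
  ultimately show ?thesis
    using part_graded_hom[OF gA gB F(1), of "q - p"] part_graded_hom[OF gB gA G(1), of "p - q"] F(3) G(3) by blast
qed

end

section \<open>Extension of homomorphisms over selfinjective algebras\<close>

text \<open>A homomorphism to the regular module on a submodule \<open>N\<close> of
  \<open>A\<close>; keeping \<open>N\<close> as a set lets the domain grow inside the fixed module
  \<open>A\<close>.\<close>

definition partial_functional ::
  "('r, 'c) ring_scheme \<Rightarrow> ('r, 'a, 'd) module_scheme \<Rightarrow> 'a set \<Rightarrow> ('a \<Rightarrow> 'r) \<Rightarrow> bool"
  where "partial_functional R A N v \<longleftrightarrow>
    additive_subgroup N A \<and> (\<forall>r\<in>carrier R. \<forall>x\<in>N. r \<odot>\<^bsub>A\<^esub> x \<in> N) \<and>
    (\<forall>x\<in>N. v x \<in> carrier R) \<and> (\<forall>x\<in>N. \<forall>y\<in>N. v (x \<oplus>\<^bsub>A\<^esub> y) = v x \<oplus>\<^bsub>R\<^esub> v y) \<and>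
    (\<forall>r\<in>carrier R. \<forall>x\<in>N. v (r \<odot>\<^bsub>A\<^esub> x) = v x \<otimes>\<^bsub>R\<^esub> r)"

lemma right_regular_simps [simp]:
  "carrier (right_regular R) = carrier R" "\<zero>\<^bsub>right_regular R\<^esub> = \<zero>\<^bsub>R\<^esub>"
  "x \<oplus>\<^bsub>right_regular R\<^esub> y = x \<oplus>\<^bsub>R\<^esub> y" "r \<odot>\<^bsub>right_regular R\<^esub> x = x \<otimes>\<^bsub>R\<^esub> r"
  by (simp_all add: right_regular_def)

text \<open>The domain is enlarged to \<open>N + y R\<close>. The scalars \<open>r\<close> with
  \<open>y r\<close> in \<open>N\<close> form a right ideal \<open>I\<close>, on which
  \<open>r \<mapsto> v (y r)\<close> is a functional. By injectivity it extends to \<open>R\<close>,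
  where it is left multiplication by some \<open>t\<close>; the new functional sends
  \<open>x + y r\<close> to \<open>v x + t r\<close>.\<close>

lemma partial_functional_extend:
  assumes si: "selfinjective R" and A: "right_module R A" and v: "partial_functional R A N v"
    and y: "y \<in> carrier A"
  shows "\<exists>N' v'. partial_functional R A N' v' \<and> N \<subseteq> N' \<and> y \<in> N' \<and> (\<forall>x\<in>N. v' x = v x)"
proof -
  interpret A: right_module R A by (rule A)
  let ?RR = "right_regular R"
  have rr: "right_module R ?RR" using si unfolding selfinjective_def injective_module_def by blast
  interpret RR: right_module R ?RR by (rule rr)
  have inj: "\<And>(A :: ('a, 'a) module) (B :: ('a, 'a) module) g f.
       right_module R A \<and> right_module R B \<and>
       g \<in> rmod_hom R A B \<and> inj_on g (carrier A) \<and> f \<in> rmod_hom R A ?RR \<Longrightarrow>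
       (\<exists>h\<in>rmod_hom R B ?RR. \<forall>x\<in>carrier A. h (g x) = f x)"
    using si unfolding selfinjective_def injective_module_def by blast
  have sg: "additive_subgroup N A" and act: "\<And>r x. \<lbrakk>r \<in> carrier R; x \<in> N\<rbrakk> \<Longrightarrow> r \<odot>\<^bsub>A\<^esub> x \<in> N"
    and vc: "\<And>x. x \<in> N \<Longrightarrow> v x \<in> carrier R"
    and vadd: "\<And>x y. \<lbrakk>x \<in> N; y \<in> N\<rbrakk> \<Longrightarrow> v (x \<oplus>\<^bsub>A\<^esub> y) = v x \<oplus>\<^bsub>R\<^esub> v y"
    and vact: "\<And>r x. \<lbrakk>r \<in> carrier R; x \<in> N\<rbrakk> \<Longrightarrow> v (r \<odot>\<^bsub>A\<^esub> x) = v x \<otimes>\<^bsub>R\<^esub> r"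
    using v unfolding partial_functional_def by blast+
  interpret N: additive_subgroup N A by (rule sg)
  have Nc: "x \<in> carrier A" if "x \<in> N" for x using that N.a_subset by auto
  define I where "I = {r \<in> carrier R. r \<odot>\<^bsub>A\<^esub> y \<in> N}"
  let ?I = "?RR\<lparr>carrier := I\<rparr>"
  have Iact: "r \<odot>\<^bsub>?RR\<^esub> x \<in> I" if "r \<in> carrier R" "x \<in> I" for r x
    using that act y unfolding I_def by (auto simp: A.act_mult)
  have "additive_subgroup I ?RR"
  proof (rule RR.M.additive_subgroupI')
    show "I \<subseteq> carrier ?RR" unfolding I_def by auto
    show "\<zero>\<^bsub>?RR\<^esub> \<in> I" using y unfolding I_def by simp
    fix x assume x: "x \<in> I"
    then have xc: "x \<in> carrier ?RR" unfolding I_def by simp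
    have "(\<ominus>\<^bsub>R\<^esub> \<one>\<^bsub>R\<^esub>) \<odot>\<^bsub>?RR\<^esub> x = \<ominus>\<^bsub>?RR\<^esub> x"
      using RR.neg_act[OF A.R.one_closed xc] RR.act_one[OF xc] by simp
    then show "\<ominus>\<^bsub>?RR\<^esub> x \<in> I" using Iact[OF _ x, of "\<ominus>\<^bsub>R\<^esub> \<one>\<^bsub>R\<^esub>"] by (metis A.R.a_inv_closed A.R.one_closed)
    fix z assume "z \<in> I"
    then show "x \<oplus>\<^bsub>?RR\<^esub> z \<in> I" using x y unfolding I_def by (simp add: A.act_add_ring)
  qed
  then have rI: "right_module R ?I" by (rule submodule_right_module[OF rr _ Iact])
  have "(\<lambda>r. v (r \<odot>\<^bsub>A\<^esub> y)) \<in> rmod_hom R ?I ?RR"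
    by (rule rmod_homI) (use y vc vadd vact in \<open>auto simp: I_def A.act_add_ring A.act_mult\<close>)
  moreover have "(\<lambda>x. x) \<in> rmod_hom R ?I ?RR" by (rule rmod_homI) (auto simp: I_def)
  ultimately obtain h where h: "h \<in> rmod_hom R ?RR ?RR" "\<And>x. x \<in> I \<Longrightarrow> h x = v (x \<odot>\<^bsub>A\<^esub> y)"
    using inj[of ?I ?RR "\<lambda>x. x" "\<lambda>r. v (r \<odot>\<^bsub>A\<^esub> y)"] rI rr by auto
  define t where "t = h \<one>\<^bsub>R\<^esub>"
  have tc: "t \<in> carrier R" using rmod_hom_closed[OF h(1), of "\<one>\<^bsub>R\<^esub>"] unfolding t_def by simp
  have ht: "t \<otimes>\<^bsub>R\<^esub> r = v (r \<odot>\<^bsub>A\<^esub> y)" if "r \<in> I" for r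
    using rmod_hom_act[OF h(1), of r "\<one>\<^bsub>R\<^esub>"] h(2)[OF that] that unfolding t_def I_def by simp
  \<comment> \<open>Two representations of the same element have scalars differing by an element of
    \<open>I\<close>, where \<open>t\<close> reproduces \<open>v\<close>. This makes the choice in
    \<open>v'\<close> below immaterial.\<close>
  have wd: "v x \<oplus>\<^bsub>R\<^esub> t \<otimes>\<^bsub>R\<^esub> r = v x' \<oplus>\<^bsub>R\<^esub> t \<otimes>\<^bsub>R\<^esub> r'"
    if x: "x \<in> N" "x' \<in> N" and r: "r \<in> carrier R" "r' \<in> carrier R"
      and eq: "x \<oplus>\<^bsub>A\<^esub> r \<odot>\<^bsub>A\<^esub> y = x' \<oplus>\<^bsub>A\<^esub> r' \<odot>\<^bsub>A\<^esub> y" for x x' r r'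
  proof -
    let ?d = "r \<ominus>\<^bsub>R\<^esub> r'"
    have xc: "x \<in> carrier A" "x' \<in> carrier A" using x Nc by auto
    have dy: "?d \<odot>\<^bsub>A\<^esub> y = r \<odot>\<^bsub>A\<^esub> y \<ominus>\<^bsub>A\<^esub> r' \<odot>\<^bsub>A\<^esub> y"
      using r y by (simp add: a_minus_def A.act_add_ring A.neg_act)
    have dyc: "?d \<odot>\<^bsub>A\<^esub> y \<in> carrier A" using r y A.act_closed by simp
    have "x \<oplus>\<^bsub>A\<^esub> ?d \<odot>\<^bsub>A\<^esub> y = (x \<oplus>\<^bsub>A\<^esub> r \<odot>\<^bsub>A\<^esub> y) \<ominus>\<^bsub>A\<^esub> r' \<odot>\<^bsub>A\<^esub> y"
      unfolding dy using xc r y A.act_closed by (simp add: a_minus_def A.M.a_assoc)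
    also have "\<dots> = x'"
      unfolding eq a_minus_def using xc r y A.act_closed by (simp add: A.M.a_assoc A.M.r_neg)
    finally have x': "x \<oplus>\<^bsub>A\<^esub> ?d \<odot>\<^bsub>A\<^esub> y = x'" .
    have "?d \<odot>\<^bsub>A\<^esub> y = \<ominus>\<^bsub>A\<^esub> x \<oplus>\<^bsub>A\<^esub> x'"
      unfolding x'[symmetric] using xc(1) dyc by (simp only: A.M.r_neg1)
    then have dN: "?d \<odot>\<^bsub>A\<^esub> y \<in> N" using x N.a_closed N.a_inv_closed by simp
    then have dI: "?d \<in> I" using r unfolding I_def by simp
    have "v x' = v x \<oplus>\<^bsub>R\<^esub> t \<otimes>\<^bsub>R\<^esub> ?d" using vadd[OF x(1) dN] ht[OF dI] x' by simp
    also have "\<dots> = v x \<oplus>\<^bsub>R\<^esub> (t \<otimes>\<^bsub>R\<^esub> r \<ominus>\<^bsub>R\<^esub> t \<otimes>\<^bsub>R\<^esub> r')"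
      using tc r by (simp add: a_minus_def A.R.r_distr A.R.r_minus)
    finally show ?thesis
      using tc r vc[OF x(1)] by (simp add: a_minus_def A.R.a_assoc A.R.l_neg)
  qed
  define N' where "N' = {x \<oplus>\<^bsub>A\<^esub> r \<odot>\<^bsub>A\<^esub> y | x r. x \<in> N \<and> r \<in> carrier R}"
  define v' where "v' = (\<lambda>z. SOME w. \<exists>x\<in>N. \<exists>r\<in>carrier R. z = x \<oplus>\<^bsub>A\<^esub> r \<odot>\<^bsub>A\<^esub> y \<and> w = v x \<oplus>\<^bsub>R\<^esub> t \<otimes>\<^bsub>R\<^esub> r)"
  have v': "v' (x \<oplus>\<^bsub>A\<^esub> r \<odot>\<^bsub>A\<^esub> y) = v x \<oplus>\<^bsub>R\<^esub> t \<otimes>\<^bsub>R\<^esub> r" if "x \<in> N" "r \<in> carrier R" for x r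
    unfolding v'_def
  proof (rule some_equality)
    show "\<exists>x'\<in>N. \<exists>r'\<in>carrier R. x \<oplus>\<^bsub>A\<^esub> r \<odot>\<^bsub>A\<^esub> y = x' \<oplus>\<^bsub>A\<^esub> r' \<odot>\<^bsub>A\<^esub> y \<and>
        v x \<oplus>\<^bsub>R\<^esub> t \<otimes>\<^bsub>R\<^esub> r = v x' \<oplus>\<^bsub>R\<^esub> t \<otimes>\<^bsub>R\<^esub> r'"
      using that by blast
    fix w assume "\<exists>x'\<in>N. \<exists>r'\<in>carrier R. x \<oplus>\<^bsub>A\<^esub> r \<odot>\<^bsub>A\<^esub> y = x' \<oplus>\<^bsub>A\<^esub> r' \<odot>\<^bsub>A\<^esub> y \<and>
        w = v x' \<oplus>\<^bsub>R\<^esub> t \<otimes>\<^bsub>R\<^esub> r'"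
    then obtain x' r' where x': "x' \<in> N" "r' \<in> carrier R"
      "x \<oplus>\<^bsub>A\<^esub> r \<odot>\<^bsub>A\<^esub> y = x' \<oplus>\<^bsub>A\<^esub> r' \<odot>\<^bsub>A\<^esub> y" "w = v x' \<oplus>\<^bsub>R\<^esub> t \<otimes>\<^bsub>R\<^esub> r'"
      by blast
    show "w = v x \<oplus>\<^bsub>R\<^esub> t \<otimes>\<^bsub>R\<^esub> r"
      unfolding x'(4) by (rule wd[OF x'(1) that(1) x'(2) that(2) x'(3)[symmetric]])
  qed
  have N'E: "\<exists>x r. x \<in> N \<and> r \<in> carrier R \<and> z = x \<oplus>\<^bsub>A\<^esub> r \<odot>\<^bsub>A\<^esub> y" if "z \<in> N'" for z
    using that unfolding N'_def by blast
  have N'I: "x \<oplus>\<^bsub>A\<^esub> r \<odot>\<^bsub>A\<^esub> y \<in> N'" if "x \<in> N" "r \<in> carrier R" for x r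
    using that unfolding N'_def by blast
  have plus: "(x \<oplus>\<^bsub>A\<^esub> r \<odot>\<^bsub>A\<^esub> y) \<oplus>\<^bsub>A\<^esub> (x' \<oplus>\<^bsub>A\<^esub> r' \<odot>\<^bsub>A\<^esub> y) = (x \<oplus>\<^bsub>A\<^esub> x') \<oplus>\<^bsub>A\<^esub> (r \<oplus>\<^bsub>R\<^esub> r') \<odot>\<^bsub>A\<^esub> y"
    if "x \<in> N" "x' \<in> N" "r \<in> carrier R" "r' \<in> carrier R" for x x' r r'
    using that Nc y A.act_closed by (simp add: A.act_add_ring A.M.a_ac)
  have acts: "s \<odot>\<^bsub>A\<^esub> (x \<oplus>\<^bsub>A\<^esub> r \<odot>\<^bsub>A\<^esub> y) = (s \<odot>\<^bsub>A\<^esub> x) \<oplus>\<^bsub>A\<^esub> (r \<otimes>\<^bsub>R\<^esub> s) \<odot>\<^bsub>A\<^esub> y"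
    if "x \<in> N" "r \<in> carrier R" "s \<in> carrier R" for x r s
    using that Nc y A.act_closed by (simp add: A.act_add_module A.act_mult)
  have NN': "x \<in> N'" "v' x = v x" if x: "x \<in> N" for x
  proof -
    have "x = x \<oplus>\<^bsub>A\<^esub> \<zero>\<^bsub>R\<^esub> \<odot>\<^bsub>A\<^esub> y" using Nc[OF x] y by simp
    then show "x \<in> N'" "v' x = v x"
      using N'I[OF x, of "\<zero>\<^bsub>R\<^esub>"] v'[OF x, of "\<zero>\<^bsub>R\<^esub>"] vc[OF x] tc by simp_all
  qed
  have y': "y \<in> N'"
    using N'I[OF N.zero_closed A.R.one_closed] A.act_one[OF y] y by simp
  have N'act: "r \<odot>\<^bsub>A\<^esub> z \<in> N'" "v' (r \<odot>\<^bsub>A\<^esub> z) = v' z \<otimes>\<^bsub>R\<^esub> r" if r: "r \<in> carrier R" and z: "z \<in> N'" for r z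
  proof -
    obtain x s where x: "x \<in> N" "s \<in> carrier R" "z = x \<oplus>\<^bsub>A\<^esub> s \<odot>\<^bsub>A\<^esub> y" using N'E[OF z] by blast
    show "r \<odot>\<^bsub>A\<^esub> z \<in> N'" unfolding x(3) acts[OF x(1,2) r] by (rule N'I) (use x r act in auto)
    have "v' (r \<odot>\<^bsub>A\<^esub> z) = v (r \<odot>\<^bsub>A\<^esub> x) \<oplus>\<^bsub>R\<^esub> t \<otimes>\<^bsub>R\<^esub> (s \<otimes>\<^bsub>R\<^esub> r)"
      unfolding x(3) acts[OF x(1,2) r] by (rule v') (use x r act in auto)
    then show "v' (r \<odot>\<^bsub>A\<^esub> z) = v' z \<otimes>\<^bsub>R\<^esub> r"
      unfolding x(3) v'[OF x(1,2)] using vact[OF r x(1)] tc r x vc by (simp add: A.R.l_distr A.R.m_assoc)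
  qed
  have N'add: "z \<oplus>\<^bsub>A\<^esub> z' \<in> N'" "v' (z \<oplus>\<^bsub>A\<^esub> z') = v' z \<oplus>\<^bsub>R\<^esub> v' z'" if z: "z \<in> N'" "z' \<in> N'" for z z'
  proof -
    obtain x s where x: "x \<in> N" "s \<in> carrier R" "z = x \<oplus>\<^bsub>A\<^esub> s \<odot>\<^bsub>A\<^esub> y" using N'E[OF z(1)] by blast
    obtain x' s' where x': "x' \<in> N" "s' \<in> carrier R" "z' = x' \<oplus>\<^bsub>A\<^esub> s' \<odot>\<^bsub>A\<^esub> y" using N'E[OF z(2)] by blast
    show "z \<oplus>\<^bsub>A\<^esub> z' \<in> N'"
      unfolding x(3) x'(3) plus[OF x(1) x'(1) x(2) x'(2)] by (rule N'I) (use x x' in auto)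
    have "v' (z \<oplus>\<^bsub>A\<^esub> z') = v (x \<oplus>\<^bsub>A\<^esub> x') \<oplus>\<^bsub>R\<^esub> t \<otimes>\<^bsub>R\<^esub> (s \<oplus>\<^bsub>R\<^esub> s')"
      unfolding x(3) x'(3) plus[OF x(1) x'(1) x(2) x'(2)] by (rule v') (use x x' in auto)
    then show "v' (z \<oplus>\<^bsub>A\<^esub> z') = v' z \<oplus>\<^bsub>R\<^esub> v' z'"
      unfolding x(3) x'(3) v'[OF x(1,2)] v'[OF x'(1,2)]
      using vadd[OF x(1) x'(1)] tc x x' vc by (simp add: A.R.r_distr A.R.a_ac)
  qed
  have N'c: "z \<in> carrier A" if z: "z \<in> N'" for z
  proof -
    obtain x r where "x \<in> N" "r \<in> carrier R" "z = x \<oplus>\<^bsub>A\<^esub> r \<odot>\<^bsub>A\<^esub> y" using N'E[OF z] by blast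
    then show ?thesis using Nc y A.act_closed by simp
  qed
  have "additive_subgroup N' A"
  proof (rule A.M.additive_subgroupI')
    show "N' \<subseteq> carrier A" using N'c by blast
    show "\<zero>\<^bsub>A\<^esub> \<in> N'" using NN'(1)[OF N.zero_closed] .
    fix z assume z: "z \<in> N'"
    have "(\<ominus>\<^bsub>R\<^esub> \<one>\<^bsub>R\<^esub>) \<odot>\<^bsub>A\<^esub> z = \<ominus>\<^bsub>A\<^esub> z"
      using A.neg_act[OF A.R.one_closed N'c[OF z]] A.act_one[OF N'c[OF z]] by simp
    then show "\<ominus>\<^bsub>A\<^esub> z \<in> N'" using N'act(1)[OF _ z, of "\<ominus>\<^bsub>R\<^esub> \<one>\<^bsub>R\<^esub>"] by simp
  qed (rule N'add)
  moreover have "v' z \<in> carrier R" if z: "z \<in> N'" for z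
  proof -
    obtain x r where "x \<in> N" "r \<in> carrier R" "z = x \<oplus>\<^bsub>A\<^esub> r \<odot>\<^bsub>A\<^esub> y" using N'E[OF z] by blast
    then show ?thesis using v' vc tc by simp
  qed
  ultimately have "partial_functional R A N' v'"
    unfolding partial_functional_def using N'act N'add by (intro conjI ballI)
  with NN' y' show ?thesis by blast
qed

text \<open>Baer's criterion; for finitely generated modules no transfinite induction is necessary.\<close>

lemma selfinjective_extend:
  assumes si: "selfinjective R" and A: "right_module R A" and fg: "finitely_generated R A"
    and v: "partial_functional R A N v"
  shows "\<exists>v'\<in>rmod_hom R A (right_regular R). \<forall>x\<in>N. v' x = v x"
proof -
  obtain S where S: "finite S" "S \<subseteq> carrier A" "rmod_span R A S = carrier A"
    using fg unfolding finitely_generated_def by blast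
  have "\<exists>N' v'. partial_functional R A N' v' \<and> N \<subseteq> N' \<and> S \<subseteq> N' \<and> (\<forall>x\<in>N. v' x = v x)"
    using S(1,2)
  proof (induction S rule: finite_induct)
    case empty
    then show ?case using v by blast
  next
    case (insert s S)
    then obtain N' v' where N': "partial_functional R A N' v'" "N \<subseteq> N'" "S \<subseteq> N'" "\<forall>x\<in>N. v' x = v x" by auto
    obtain N'' v'' where N'': "partial_functional R A N'' v''" "N' \<subseteq> N''" "s \<in> N''" "\<forall>x\<in>N'. v'' x = v' x"
      using partial_functional_extend[OF si A N'(1), of s] insert by auto
    with N' show ?case by (intro exI[of _ N''] exI[of _ v'']) auto
  qed
  then obtain N' v' where N': "partial_functional R A N' v'" "S \<subseteq> N'" "\<forall>x\<in>N. v' x = v x" by blast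
  have "submodule N' R A" using N'(1) unfolding partial_functional_def submodule_iff by blast
  then have c: "carrier A \<subseteq> N'" using submodule_rmod_span(3)[OF A S(2)] N'(2) S(3) by blast
  have "v' \<in> rmod_hom R A (right_regular R)"
    using N'(1) c unfolding partial_functional_def by (intro rmod_homI) (simp_all add: subset_iff)
  with N'(3) show ?thesis by blast
qed

context split_alg
begin

text \<open>By the condition on kernels \<open>u\<close> factors through the image of
  \<open>d\<close>. Each coordinate of the factor is a functional on a submodule of \<open>Q\<close>
  and extends to \<open>Q\<close> by selfinjectivity; the extensions are recombined over the dual
  basis of \<open>P\<close>, and the part of degree \<open>j\<close> is taken.\<close>

lemma linear_term_extend:
  assumes si: "selfinjective R" and gA: "graded_module R A"
    and Q: "graded_module R Q" and fg: "finitely_generated R Q" and P: "linear_term P n"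
    and d: "d \<in> graded_hom R 0 A Q" and u: "u \<in> graded_hom R j A P"
    and ker: "\<And>x. \<lbrakk>x \<in> carrier A; d x = \<zero>\<^bsub>Q\<^esub>\<rbrakk> \<Longrightarrow> u x = \<zero>\<^bsub>P\<^esub>"
  shows "\<exists>U\<in>graded_hom R j Q P. \<forall>x\<in>carrier A. U (d x) = u x"
proof -
  note gP = linear_termD(1)[OF P] and A = graded_right_module[OF gA]
  interpret A: right_module R A by (rule A)
  interpret Q: right_module R Q by (rule graded_right_module[OF Q])
  interpret P: right_module R P by (rule linear_termD(2)[OF P])
  note dh = graded_hom_rmod[OF d] and uh = graded_hom_rmod[OF u]
  let ?N = "d ` carrier A"
  note im = rmod_hom_image_subgroup[OF A Q.right_module_axioms dh]
  have "right_module R (Q\<lparr>carrier := ?N\<rparr>)" by (rule submodule_right_module[OF Q.right_module_axioms im])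
  then obtain w where w: "w \<in> rmod_hom R (Q\<lparr>carrier := ?N\<rparr>) P" "\<And>x. x \<in> carrier A \<Longrightarrow> w (d x) = u x"
    using rmod_hom_factor[OF A _ P.right_module_axioms rmod_hom_restrict[OF dh] _ uh] ker by auto
  obtain B \<iota> c where D: "dual_basis P n B \<iota> c"
    using linear_term_dual_basis_extends[OF P adapted_indep_empty[OF gP]] by blast
  have fB: "finite B" and c: "\<And>b. b \<in> B \<Longrightarrow> c b \<in> rmod_hom R P (graded_regular R)"
    and Bc: "\<And>b. b \<in> B \<Longrightarrow> b \<in> carrier P" and ex: "\<And>x. x \<in> carrier P \<Longrightarrow> x = (\<Oplus>\<^bsub>P\<^esub>b\<in>B. c b x \<odot>\<^bsub>P\<^esub> b)"
    using D graded_hom_rmod homog_closed[OF gP] unfolding dual_basis_def by blast+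
  have "\<exists>v\<in>rmod_hom R Q (right_regular R). \<forall>x\<in>?N. v x = c b (w x)" if b: "b \<in> B" for b
  proof (rule selfinjective_extend[OF si Q.right_module_axioms fg])
    have cw: "(\<lambda>x. c b (w x)) \<in> rmod_hom R (Q\<lparr>carrier := ?N\<rparr>) (graded_regular R)"
      by (rule rmod_hom_comp[OF w(1) c[OF b]])
    show "partial_functional R Q ?N (\<lambda>x. c b (w x))"
      unfolding partial_functional_def
      using im rmod_hom_closed[OF cw] rmod_hom_add[OF cw] rmod_hom_act[OF cw] by auto
  qed
  then obtain v where v: "\<And>b. b \<in> B \<Longrightarrow> v b \<in> rmod_hom R Q (right_regular R)"
    "\<And>b x. \<lbrakk>b \<in> B; x \<in> carrier A\<rbrakk> \<Longrightarrow> v b (d x) = c b (u x)"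
    using w(2) by (metis (no_types, lifting) imageI)
  have vc: "v b y \<in> carrier R" if "b \<in> B" "y \<in> carrier Q" for b y
    using rmod_hom_closed[OF v(1)[OF that(1)] that(2)] by simp
  define V where "V = (\<lambda>y. \<Oplus>\<^bsub>P\<^esub>b\<in>B. v b y \<odot>\<^bsub>P\<^esub> b)"
  have t: "(\<lambda>b. v b y \<odot>\<^bsub>P\<^esub> b) \<in> B \<rightarrow> carrier P" if "y \<in> carrier Q" for y
    using vc that Bc P.act_closed by auto
  have V: "V \<in> rmod_hom R Q P"
  proof (rule rmod_homI)
    fix y assume y: "y \<in> carrier Q"
    show "V y \<in> carrier P" unfolding V_def using t[OF y] by (rule P.M.finsum_closed)
    fix r assume r: "r \<in> carrier R"
    have "V (r \<odot>\<^bsub>Q\<^esub> y) = (\<Oplus>\<^bsub>P\<^esub>b\<in>B. r \<odot>\<^bsub>P\<^esub> (v b y \<odot>\<^bsub>P\<^esub> b))"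
      unfolding V_def using vc y r Bc P.act_closed rmod_hom_act[OF v(1)]
      by (intro P.M.finsum_cong') (auto simp: P.act_mult)
    then show "V (r \<odot>\<^bsub>Q\<^esub> y) = r \<odot>\<^bsub>P\<^esub> V y" unfolding V_def using P.act_finsum[OF fB t[OF y] r] by simp
  next
    fix x y assume x: "x \<in> carrier Q" and y: "y \<in> carrier Q"
    have "V (x \<oplus>\<^bsub>Q\<^esub> y) = (\<Oplus>\<^bsub>P\<^esub>b\<in>B. v b x \<odot>\<^bsub>P\<^esub> b \<oplus>\<^bsub>P\<^esub> v b y \<odot>\<^bsub>P\<^esub> b)"
      unfolding V_def using vc x y Bc P.act_closed rmod_hom_add[OF v(1)]
      by (intro P.M.finsum_cong') (auto simp: P.act_add_ring)
    then show "V (x \<oplus>\<^bsub>Q\<^esub> y) = V x \<oplus>\<^bsub>P\<^esub> V y" unfolding V_def using P.M.finsum_addf[OF t[OF x] t[OF y]] by simp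
  qed
  have Vd: "V (d x) = u x" if x: "x \<in> carrier A" for x
  proof -
    have ux: "u x \<in> carrier P" by (rule rmod_hom_closed[OF uh x])
    have "V (d x) = (\<Oplus>\<^bsub>P\<^esub>b\<in>B. c b (u x) \<odot>\<^bsub>P\<^esub> b)"
      unfolding V_def using v(2)[OF _ x] t[OF rmod_hom_closed[OF dh x]]
      by (intro P.M.finsum_cong') (auto simp: Pi_iff)
    then show ?thesis using ex[OF ux] by simp
  qed
  have "part j Q P V (d x) = u x" if x: "x \<in> carrier A" for x
  proof -
    have "part j A P (\<lambda>x. V (d x)) x = part j A P u x" by (rule part_cong[OF gA x Vd])
    then show ?thesis using part_precomp[OF gA Q gP d V x, of j] part_graded[OF gA gP u x] by simp
  qed
  then show ?thesis using part_graded_hom[OF Q gP V] by blast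
qed

end

section \<open>Linear resolutions\<close>

text \<open>All terms of a resolution share one type, so zero terms are obtained inside a given
  module of that type.\<close>

definition zero_submodule :: "('r, 'a) graded \<Rightarrow> ('r, 'a) graded"
  where "zero_submodule A = A\<lparr>carrier := {\<zero>\<^bsub>A\<^esub>}, homog := \<lambda>_. {\<zero>\<^bsub>A\<^esub>}\<rparr>"

lemma zero_submodule_simps [simp]:
  "carrier (zero_submodule A) = {\<zero>\<^bsub>A\<^esub>}" "homog (zero_submodule A) i = {\<zero>\<^bsub>A\<^esub>}"
  "\<zero>\<^bsub>zero_submodule A\<^esub> = \<zero>\<^bsub>A\<^esub>" "x \<oplus>\<^bsub>zero_submodule A\<^esub> y = x \<oplus>\<^bsub>A\<^esub> y"
  "r \<odot>\<^bsub>zero_submodule A\<^esub> x = r \<odot>\<^bsub>A\<^esub> x"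
  unfolding zero_submodule_def by simp_all

lemma (in graded_alg) zero_submodule_term:
  assumes gA: "graded_module R A"
  shows "graded_module R (zero_submodule A)" "projective_module R (zero_submodule A)"
    "finitely_generated R (zero_submodule A)"
proof -
  let ?Z = "zero_submodule A"
  interpret A: right_module R A by (rule graded_right_module[OF gA])
  have "right_module R (A\<lparr>carrier := {\<zero>\<^bsub>A\<^esub>}\<rparr>)"
    by (rule submodule_right_module[OF A.right_module_axioms]) (auto intro!: A.M.additive_subgroupI')
  then have rZ: "right_module R ?Z" by (rule right_module_cong) (simp_all add: zero_submodule_def)
  interpret Z: right_module R ?Z by (rule rZ)
  have sub: "additive_subgroup {\<zero>\<^bsub>A\<^esub>} ?Z"
    using Z.M.a_inv_closed[of "\<zero>\<^bsub>A\<^esub>"] by (intro Z.M.additive_subgroupI') auto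
  have "\<exists>!f. decomposes ?Z (homog ?Z) x f" if "x \<in> carrier ?Z" for x
  proof (rule ex1I[of _ "\<lambda>_. \<zero>\<^bsub>A\<^esub>"])
    show "decomposes ?Z (homog ?Z) x (\<lambda>_. \<zero>\<^bsub>A\<^esub>)"
      using that Z.M.finsum_empty[of "\<lambda>_. \<zero>\<^bsub>A\<^esub>"] unfolding decomposes_def by simp
    show "f = (\<lambda>_. \<zero>\<^bsub>A\<^esub>)" if "decomposes ?Z (homog ?Z) x f" for f
      using that unfolding decomposes_def by auto
  qed
  then show gZ: "graded_module R ?Z"
    unfolding graded_module_def direct_sum_decomposition_def
    using rZ sub homog_R_closed by auto
  show "finitely_generated R ?Z"
    unfolding finitely_generated_def
  proof (intro exI[of _ "{}"] conjI equalityI)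
    show "rmod_span R ?Z {} \<subseteq> carrier ?Z"
      using submodule_rmod_span(1)[OF rZ, of "{}"] additive_subgroup.a_subset
      unfolding submodule_iff by blast
    show "carrier ?Z \<subseteq> rmod_span R ?Z {}"
      using submodule_rmod_span(1)[OF rZ, of "{}"] additive_subgroup.zero_closed
      unfolding submodule_iff by fastforce
  qed auto
  show "projective_module R ?Z"
    unfolding projective_module_def
  proof (intro conjI rZ allI impI)
    fix B :: "('r, 'a \<Rightarrow> 'r) module" and C :: "('r, 'a) module" and g f
    assume a: "right_module R B \<and> right_module R C \<and> g \<in> rmod_hom R B C \<and>
      g ` carrier B = carrier C \<and> f \<in> rmod_hom R ?Z C"
    interpret B: right_module R B using a by blast
    have z: "g \<zero>\<^bsub>B\<^esub> = f \<zero>\<^bsub>A\<^esub>"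
      using a rmod_hom_zero[of R B C g] rmod_hom_zero[OF rZ, of C f] by simp
    have "(\<lambda>_. \<zero>\<^bsub>B\<^esub>) \<in> rmod_hom R ?Z B" by (rule rmod_homI) auto
    then show "\<exists>h\<in>rmod_hom R ?Z B. \<forall>x\<in>carrier ?Z. g (h x) = f x" using z by auto
  qed
qed

section \<open>Kernels and syzygies in a linear resolution\<close>

locale linear_res = split_alg K R m e
  for K :: "('k, 'e) ring_scheme" and R :: "('k, 'r, 'c) graded_scheme" and m :: nat and e :: "nat \<Rightarrow> 'r" +
  fixes M :: "('r, 'm, 'd) graded_scheme" and P :: "nat \<Rightarrow> ('r, 'p) graded" and \<epsilon> :: "'p \<Rightarrow> 'm"
    and d :: "nat \<Rightarrow> 'p \<Rightarrow> 'p"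
  assumes res: "linear_resolution R M P \<epsilon> d"
begin

lemma proj_res: "graded_projective_resolution R M P \<epsilon> d"
  using res unfolding linear_resolution_def by blast

lemma res_term: "linear_term (P n) (int n)"
  using res by (simp add: linear_resolution_def graded_projective_resolution_def linear_term_def)

lemmas gP = linear_termD(1)[OF res_term]
lemmas rP = linear_termD(2)[OF res_term]
lemmas genP = linear_termD(5)[OF res_term]

lemma gM: "graded_module R M"
  using proj_res by (simp add: graded_projective_resolution_def)

lemma rM: "right_module R M"
  using graded_right_module[OF gM] .

lemma eps_hom: "\<epsilon> \<in> graded_hom R 0 (P 0) M"
  using proj_res by (simp add: graded_projective_resolution_def)

lemma d_hom: "d (Suc n) \<in> graded_hom R 0 (P (Suc n)) (P n)"
  using proj_res by (simp add: graded_projective_resolution_def)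

lemmas eps_rmod = graded_hom_rmod[OF eps_hom]
lemmas d_rmod = graded_hom_rmod[OF d_hom]

lemma eps_onto: "\<epsilon> ` carrier (P 0) = carrier M"
  using proj_res by (simp add: graded_projective_resolution_def)

text \<open>The syzygy with index \<open>Suc n\<close>, indexed instead by the term
  \<open>P n\<close> that contains it.\<close>

definition Z :: "nat \<Rightarrow> 'p set"
  where "Z n = d (Suc n) ` carrier (P (Suc n))"

lemma ker_eps: "x \<in> carrier (P 0) \<Longrightarrow> \<epsilon> x = \<zero>\<^bsub>M\<^esub> \<longleftrightarrow> x \<in> Z 0"
  using proj_res unfolding graded_projective_resolution_def Z_def a_kernel_def kernel_def by auto

lemma ker_d: "x \<in> carrier (P (Suc n)) \<Longrightarrow> d (Suc n) x = \<zero>\<^bsub>P n\<^esub> \<longleftrightarrow> x \<in> Z (Suc n)"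
  using proj_res unfolding graded_projective_resolution_def Z_def a_kernel_def kernel_def by auto

lemma Z_closed: "x \<in> Z n \<Longrightarrow> x \<in> carrier (P n)"
  unfolding Z_def using rmod_hom_closed[OF d_rmod] by auto

text \<open>\<open>P (Suc n)\<close> begins in degree \<open>n + 1\<close> and the differential has
  degree 0, so its image has nothing in degree \<open>n\<close>. This is the form in which
  minimality is used.\<close>

lemma Z_lowest:
  assumes x: "x \<in> homog (P n) (int n)" and z: "x \<in> Z n"
  shows "x = \<zero>\<^bsub>P n\<^esub>"
proof -
  obtain y where y: "y \<in> carrier (P (Suc n))" "x = d (Suc n) y" using z unfolding Z_def by blast
  have "x = component (P n) (int n) x" using comp_homog[OF gP x, of "int n"] by simp
  also have "\<dots> = d (Suc n) (component (P (Suc n)) (int n) y)"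
    using graded_hom_component[OF gP gP d_hom y(1), of "int n"] y(2) by simp
  also have "\<dots> = \<zero>\<^bsub>P n\<^esub>"
    using comp_below[OF gP genP y(1), of "int n"] rmod_hom_zero[OF rP rP d_rmod] by simp
  finally show ?thesis .
qed

lemma syzygy_simps:
  "carrier (syzygy P d (Suc n)) = Z n" "\<zero>\<^bsub>syzygy P d (Suc n)\<^esub> = \<zero>\<^bsub>P n\<^esub>"
  "x \<oplus>\<^bsub>syzygy P d (Suc n)\<^esub> y = x \<oplus>\<^bsub>P n\<^esub> y" "r \<odot>\<^bsub>syzygy P d (Suc n)\<^esub> x = r \<odot>\<^bsub>P n\<^esub> x"
  unfolding syzygy_def Z_def by simp_all

lemma right_module_syzygy: "right_module R (syzygy P d (Suc n))"
proof -
  have "right_module R ((P n)\<lparr>carrier := Z n\<rparr>)"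
    unfolding Z_def by (rule submodule_right_module[OF rP rmod_hom_image_subgroup[OF rP rP d_rmod]])
  then show ?thesis by (rule right_module_cong) (simp_all add: syzygy_simps)
qed

lemma d_syzygy: "d (Suc n) \<in> rmod_hom R (P (Suc n)) (syzygy P d (Suc n))"
  "d (Suc n) ` carrier (P (Suc n)) = carrier (syzygy P d (Suc n))"
  using rmod_hom_add[OF d_rmod] rmod_hom_act[OF d_rmod]
  by (auto intro!: rmod_homI simp: syzygy_simps Z_def)

text \<open>\<open>P a\<close> modulo \<open>Z a\<close> is the syzygy of index \<open>a\<close>, or
  \<open>M\<close> if \<open>a = 0\<close>. So this is an isomorphism between the syzygies of index
  \<open>a + n\<close> and \<open>a\<close>, homogeneous of degree \<open>- n\<close>, recorded on
  their projective covers. On the covers \<open>a = 0\<close> is no exception, although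
  \<open>M\<close> lives on another type.\<close>

definition shift_iso :: "nat \<Rightarrow> nat \<Rightarrow> bool"
  where "shift_iso n a \<longleftrightarrow>
    (\<exists>\<phi>\<in>graded_hom R (- int n) (P (a + n)) (P a). \<exists>\<psi>\<in>graded_hom R (int n) (P a) (P (a + n)).
      (\<forall>x\<in>carrier (P (a + n)). \<psi> (\<phi> x) = x) \<and> (\<forall>y\<in>carrier (P a). \<phi> (\<psi> y) = y) \<and>
      \<phi> ` Z (a + n) \<subseteq> Z a \<and> \<psi> ` Z a \<subseteq> Z (a + n))"

lemma ker_d_homog:
  assumes x: "x \<in> carrier (P (Suc n))" and z: "d (Suc n) x = \<zero>\<^bsub>P n\<^esub>"
  shows "d (Suc n) (component (P (Suc n)) k x) = \<zero>\<^bsub>P n\<^esub>"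
  using graded_hom_component[OF gP gP d_hom x, of k] z comp_zero[OF gP] by simp

lemma ker_eps_homog:
  assumes x: "x \<in> carrier (P 0)" and z: "\<epsilon> x = \<zero>\<^bsub>M\<^esub>"
  shows "\<epsilon> (component (P 0) k x) = \<zero>\<^bsub>M\<^esub>"
  using graded_hom_component[OF gP gM eps_hom x, of k] z comp_zero[OF gM] by simp

lemma ker_d_lowest:
  "\<lbrakk>x \<in> homog (P (Suc n)) (int (Suc n)); d (Suc n) x = \<zero>\<^bsub>P n\<^esub>\<rbrakk> \<Longrightarrow> x = \<zero>\<^bsub>P (Suc n)\<^esub>"
  using Z_lowest ker_d homog_closed[OF gP] by blast

lemma ker_eps_lowest: "\<lbrakk>x \<in> homog (P 0) 0; \<epsilon> x = \<zero>\<^bsub>M\<^esub>\<rbrakk> \<Longrightarrow> x = \<zero>\<^bsub>P 0\<^esub>"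
  using Z_lowest[of x 0] ker_eps homog_closed[OF gP] by auto

text \<open>The covers are \<open>d (Suc k)\<close> onto the syzygy and \<open>\<epsilon>\<close>
  onto \<open>M\<close>. Exactness translates compatibility with their kernels into compatibility
  with \<open>Z\<close>.\<close>

lemma periodic_imp_shift_iso:
  assumes iso: "rmod_isomorphic R (syzygy P d (Suc k)) M"
  shows "shift_iso (Suc k) 0"
proof -
  have "\<exists>\<phi>\<in>graded_hom R (int 0 - int (Suc k)) (P (Suc k)) (P 0).
    \<exists>\<psi>\<in>graded_hom R (int (Suc k) - int 0) (P 0) (P (Suc k)).
    (\<forall>x\<in>carrier (P (Suc k)). \<psi> (\<phi> x) = x) \<and> (\<forall>y\<in>carrier (P 0). \<phi> (\<psi> y) = y) \<and>
    (\<forall>x\<in>carrier (P (Suc k)). d (Suc k) x = \<zero>\<^bsub>syzygy P d (Suc k)\<^esub> \<longrightarrow> \<epsilon> (\<phi> x) = \<zero>\<^bsub>M\<^esub>) \<and>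
    (\<forall>y\<in>carrier (P 0). \<epsilon> y = \<zero>\<^bsub>M\<^esub> \<longrightarrow> d (Suc k) (\<psi> y) = \<zero>\<^bsub>syzygy P d (Suc k)\<^esub>)"
    by (rule graded_iso_of_iso[OF res_term res_term right_module_syzygy rM d_syzygy eps_rmod eps_onto])
      (use ker_d_homog ker_eps_homog ker_d_lowest ker_eps_lowest iso in \<open>simp_all add: syzygy_simps\<close>)
  then obtain \<phi> \<psi> where \<phi>: "\<phi> \<in> graded_hom R (- int (Suc k)) (P (Suc k)) (P 0)"
    and \<psi>: "\<psi> \<in> graded_hom R (int (Suc k)) (P 0) (P (Suc k))"
    and i: "\<forall>x\<in>carrier (P (Suc k)). \<psi> (\<phi> x) = x" "\<forall>y\<in>carrier (P 0). \<phi> (\<psi> y) = y"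
    and k: "\<And>x. \<lbrakk>x \<in> carrier (P (Suc k)); d (Suc k) x = \<zero>\<^bsub>P k\<^esub>\<rbrakk> \<Longrightarrow> \<epsilon> (\<phi> x) = \<zero>\<^bsub>M\<^esub>"
      "\<And>y. \<lbrakk>y \<in> carrier (P 0); \<epsilon> y = \<zero>\<^bsub>M\<^esub>\<rbrakk> \<Longrightarrow> d (Suc k) (\<psi> y) = \<zero>\<^bsub>P k\<^esub>"
    by (auto simp: syzygy_simps)
  have "\<phi> x \<in> Z 0" if "x \<in> Z (Suc k)" for x
    using k(1) ker_d ker_eps Z_closed[OF that] that rmod_hom_closed[OF graded_hom_rmod[OF \<phi>]] by blast
  moreover have "\<psi> y \<in> Z (Suc k)" if "y \<in> Z 0" for y
    using k(2) ker_d ker_eps Z_closed[OF that] that rmod_hom_closed[OF graded_hom_rmod[OF \<psi>]] by blast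
  ultimately show ?thesis
    unfolding shift_iso_def using \<phi> \<psi> i by (intro bexI[of _ \<phi>] bexI[of _ \<psi>]) auto
qed

lemma syzygy_iso_imp_shift_iso:
  assumes iso: "rmod_isomorphic R (syzygy P d (Suc a + n)) (syzygy P d (Suc a))"
  shows "shift_iso n (Suc a)"
proof -
  let ?b = "a + n"
  have "\<exists>\<phi>\<in>graded_hom R (int (Suc a) - int (Suc ?b)) (P (Suc ?b)) (P (Suc a)).
    \<exists>\<psi>\<in>graded_hom R (int (Suc ?b) - int (Suc a)) (P (Suc a)) (P (Suc ?b)).
    (\<forall>x\<in>carrier (P (Suc ?b)). \<psi> (\<phi> x) = x) \<and> (\<forall>y\<in>carrier (P (Suc a)). \<phi> (\<psi> y) = y) \<and>
    (\<forall>x\<in>carrier (P (Suc ?b)). d (Suc ?b) x = \<zero>\<^bsub>syzygy P d (Suc ?b)\<^esub> \<longrightarrow> d (Suc a) (\<phi> x) = \<zero>\<^bsub>syzygy P d (Suc a)\<^esub>) \<and>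
    (\<forall>y\<in>carrier (P (Suc a)). d (Suc a) y = \<zero>\<^bsub>syzygy P d (Suc a)\<^esub> \<longrightarrow> d (Suc ?b) (\<psi> y) = \<zero>\<^bsub>syzygy P d (Suc ?b)\<^esub>)"
    by (rule graded_iso_of_iso[OF res_term res_term right_module_syzygy right_module_syzygy d_syzygy d_syzygy])
      (use ker_d_homog ker_d_lowest iso in \<open>simp_all add: syzygy_simps\<close>)
  then obtain \<phi> \<psi> where \<phi>: "\<phi> \<in> graded_hom R (- int n) (P (Suc ?b)) (P (Suc a))"
    and \<psi>: "\<psi> \<in> graded_hom R (int n) (P (Suc a)) (P (Suc ?b))"
    and i: "\<forall>x\<in>carrier (P (Suc ?b)). \<psi> (\<phi> x) = x" "\<forall>y\<in>carrier (P (Suc a)). \<phi> (\<psi> y) = y"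
    and k: "\<And>x. \<lbrakk>x \<in> carrier (P (Suc ?b)); d (Suc ?b) x = \<zero>\<^bsub>P ?b\<^esub>\<rbrakk> \<Longrightarrow> d (Suc a) (\<phi> x) = \<zero>\<^bsub>P a\<^esub>"
      "\<And>y. \<lbrakk>y \<in> carrier (P (Suc a)); d (Suc a) y = \<zero>\<^bsub>P a\<^esub>\<rbrakk> \<Longrightarrow> d (Suc ?b) (\<psi> y) = \<zero>\<^bsub>P ?b\<^esub>"
    by (auto simp: syzygy_simps)
  have "\<phi> x \<in> Z (Suc a)" if "x \<in> Z (Suc ?b)" for x
    using k(1) ker_d Z_closed[OF that] that rmod_hom_closed[OF graded_hom_rmod[OF \<phi>]] by blast
  moreover have "\<psi> y \<in> Z (Suc ?b)" if "y \<in> Z (Suc a)" for y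
    using k(2) ker_d Z_closed[OF that] that rmod_hom_closed[OF graded_hom_rmod[OF \<psi>]] by blast
  ultimately show ?thesis
    unfolding shift_iso_def using \<phi> \<psi> i by (intro bexI[of _ \<phi>] bexI[of _ \<psi>]) auto
qed

text \<open>\<open>\<phi>\<close> passes to the quotients by \<open>Z (Suc k)\<close> and
  \<open>Z 0\<close>. The induced map is injective because \<open>\<psi>\<close> maps
  \<open>Z 0\<close> back into \<open>Z (Suc k)\<close>.\<close>

lemma shift_iso_imp_periodic:
  assumes "shift_iso (Suc k) 0"
  shows "rmod_isomorphic R (syzygy P d (Suc k)) M"
proof -
  obtain \<phi> \<psi> where \<phi>: "\<phi> \<in> graded_hom R (- int (Suc k)) (P (Suc k)) (P 0)"
    and \<psi>: "\<psi> \<in> graded_hom R (int (Suc k)) (P 0) (P (Suc k))"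
    and i: "\<And>x. x \<in> carrier (P (Suc k)) \<Longrightarrow> \<psi> (\<phi> x) = x" "\<And>y. y \<in> carrier (P 0) \<Longrightarrow> \<phi> (\<psi> y) = y"
    and z: "\<phi> ` Z (Suc k) \<subseteq> Z 0" "\<psi> ` Z 0 \<subseteq> Z (Suc k)"
    using assms unfolding shift_iso_def by auto
  note \<phi>c = rmod_hom_closed[OF graded_hom_rmod[OF \<phi>]] and \<psi>c = rmod_hom_closed[OF graded_hom_rmod[OF \<psi>]]
  have "\<epsilon> (\<phi> x) = \<zero>\<^bsub>M\<^esub>" if "x \<in> carrier (P (Suc k))" "d (Suc k) x = \<zero>\<^bsub>syzygy P d (Suc k)\<^esub>" for x
    using that ker_d ker_eps \<phi>c z by (auto simp: syzygy_simps)
  then obtain f where f: "f \<in> rmod_hom R (syzygy P d (Suc k)) M"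
    "\<And>x. x \<in> carrier (P (Suc k)) \<Longrightarrow> f (d (Suc k) x) = \<epsilon> (\<phi> x)"
    using rmod_hom_factor[OF rP right_module_syzygy rM d_syzygy rmod_hom_comp[OF graded_hom_rmod[OF \<phi>] eps_rmod]] by blast
  have "inj_on f (carrier (syzygy P d (Suc k)))"
  proof (rule rmod_hom_inj_onI[OF right_module_syzygy rM f(1)])
    fix y assume y: "y \<in> carrier (syzygy P d (Suc k))" "f y = \<zero>\<^bsub>M\<^esub>"
    then obtain x where x: "x \<in> carrier (P (Suc k))" "y = d (Suc k) x" using d_syzygy(2) by blast
    then have "\<phi> x \<in> Z 0" using f(2)[OF x(1)] y ker_eps[OF \<phi>c[OF x(1)]] by simp
    then have "x \<in> Z (Suc k)" using z i(1)[OF x(1)] by force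
    then show "y = \<zero>\<^bsub>syzygy P d (Suc k)\<^esub>" using ker_d x by (simp add: syzygy_simps)
  qed
  moreover have "f ` carrier (syzygy P d (Suc k)) = carrier M"
  proof
    show "f ` carrier (syzygy P d (Suc k)) \<subseteq> carrier M" using rmod_hom_closed[OF f(1)] by blast
    show "carrier M \<subseteq> f ` carrier (syzygy P d (Suc k))"
    proof
      fix y assume "y \<in> carrier M"
      then obtain x where x: "x \<in> carrier (P 0)" "y = \<epsilon> x" using eps_onto by blast
      then have "y = f (d (Suc k) (\<psi> x))" using f(2)[OF \<psi>c] i(2) by simp
      then show "y \<in> f ` carrier (syzygy P d (Suc k))" using d_syzygy(2) \<psi>c[OF x(1)] by blast
    qed
  qed
  ultimately show ?thesis unfolding rmod_isomorphic_def bij_betw_def using f(1) by blast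
qed

section \<open>Liftings of classes, and the isomorphisms among them\<close>

lemma some_lifting_isomorphismI:
  assumes "n \<ge> 1" "\<eta> \<in> degree_cocycles R M P d n" "liftings R P \<epsilon> d n \<eta> l"
    "bij_betw (l i) (carrier (P (n + i))) (carrier (P i))"
  shows "some_lifting_isomorphism R M P \<epsilon> d"
proof -
  obtain k where k: "n = Suc k" using assms(1) by (cases n) auto
  interpret M: right_module R M by (rule rM)
  have \<eta>: "\<eta> \<in> cocycles R M P d n" "\<eta> \<in> rmod_hom R (P n) M"
    using assms(2) unfolding degree_cocycles_def cocycles_def by auto
  \<comment> \<open>The zero cochain shows that \<open>\<eta>\<close> belongs to its own
    class.\<close>
  have "(\<lambda>_. \<zero>\<^bsub>M\<^esub>) \<in> rmod_hom R (P k) M" by (rule rmod_homI) auto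
  then have "\<exists>\<zeta>\<in>rmod_hom R (P k) M. \<forall>x\<in>carrier (P n). \<eta> x = \<eta> x \<oplus>\<^bsub>M\<^esub> \<zeta> (d n x)"
    using rmod_hom_closed[OF \<eta>(2)] by (intro bexI[of _ "\<lambda>_. \<zero>\<^bsub>M\<^esub>"]) auto
  then have "\<eta> \<in> ext_class R M P d n \<eta>" using \<eta>(1) k unfolding ext_class_def by simp
  moreover have "ext_class R M P d n \<eta> \<in> Delta R M P d n" using assms(2) unfolding Delta_def by blast
  ultimately show ?thesis using assms unfolding some_lifting_isomorphism_def by blast
qed

text \<open>The class is that of \<open>\<epsilon>\<close> after \<open>\<phi>\<close>, a cocycle
  because \<open>\<phi>\<close> maps \<open>Z n\<close> into the kernel \<open>Z 0\<close> of
  \<open>\<epsilon>\<close>. Then the isomorphism \<open>\<phi>\<close> is itself the lifting of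
  index 0.\<close>

lemma shift_iso_imp_lifting:
  assumes n: "n \<ge> 1" and G: "shift_iso n 0"
  shows "some_lifting_isomorphism R M P \<epsilon> d"
proof -
  obtain \<phi> \<psi> where \<phi>: "\<phi> \<in> graded_hom R (- int n) (P n) (P 0)" and \<psi>: "\<psi> \<in> graded_hom R (int n) (P 0) (P n)"
    and i: "\<And>x. x \<in> carrier (P n) \<Longrightarrow> \<psi> (\<phi> x) = x" "\<And>y. y \<in> carrier (P 0) \<Longrightarrow> \<phi> (\<psi> y) = y"
    and z: "\<phi> ` Z n \<subseteq> Z 0"
    using G unfolding shift_iso_def by auto
  \<comment> \<open>Mapping \<open>Z\<close> into \<open>Z\<close> is the invariant of the
    recursion: it places the map to be lifted inside the image of \<open>d (Suc i)\<close>. The last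
    clause makes the sequence start with \<open>\<phi>\<close>.\<close>
  let ?Q = "\<lambda>i f. f \<in> graded_hom R (- int n) (P (n + i)) (P i) \<and> f ` Z (n + i) \<subseteq> Z i \<and> (i = 0 \<longrightarrow> f = \<phi>)"
  let ?S = "\<lambda>i f f'. \<forall>x\<in>carrier (P (n + Suc i)). d (Suc i) (f' x) = f (d (n + Suc i) x)"
  have "\<exists>l. \<forall>i. ?Q i (l i) \<and> ?S i (l i) (l (Suc i))"
  proof (rule dependent_nat_choice)
    show "\<exists>f. ?Q 0 f" using \<phi> z by auto
    fix f i assume "?Q i f"
    then have f: "f \<in> graded_hom R (- int n) (P (n + i)) (P i)" "f ` Z (n + i) \<subseteq> Z i" by auto
    have g: "(\<lambda>x. f (d (Suc (n + i)) x)) \<in> graded_hom R (- int n) (P (Suc (n + i))) (P i)"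
      by (rule graded_hom_comp'[OF d_hom f(1)]) simp
    have "(\<lambda>x. f (d (Suc (n + i)) x)) ` carrier (P (Suc (n + i))) \<subseteq> d (Suc i) ` carrier (P (Suc i))"
      using f(2) unfolding Z_def by auto
    then obtain h where h: "h \<in> graded_hom R (- int n) (P (Suc (n + i))) (P (Suc i))"
      "\<And>x. x \<in> carrier (P (Suc (n + i))) \<Longrightarrow> d (Suc i) (h x) = f (d (Suc (n + i)) x)"
      using linear_term_graded_lift[OF res_term gP gP d_hom g] by blast
    have "h y \<in> Z (Suc i)" if y: "y \<in> Z (Suc (n + i))" for y
    proof -
      have yc: "y \<in> carrier (P (Suc (n + i)))" by (rule Z_closed[OF y])
      then have "d (Suc i) (h y) = \<zero>\<^bsub>P i\<^esub>"
        using h(2)[OF yc] y ker_d[OF yc] rmod_hom_zero[OF rP rP graded_hom_rmod[OF f(1)]] by simp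
      then show ?thesis using ker_d rmod_hom_closed[OF graded_hom_rmod[OF h(1)] yc] by blast
    qed
    then show "\<exists>f'. ?Q (Suc i) f' \<and> ?S i f f'" using h by (intro exI[of _ h]) auto
  qed
  then obtain l where l: "\<And>i. ?Q i (l i)" "\<And>i. ?S i (l i) (l (Suc i))" by blast
  define \<eta> where "\<eta> = (\<lambda>x. \<epsilon> (\<phi> x))"
  have l0: "l 0 = \<phi>" using l(1)[of 0] by simp
  have "liftings R P \<epsilon> d n \<eta> l"
    unfolding liftings_def \<eta>_def using l l0 by simp
  moreover have "\<eta> \<in> degree_cocycles R M P d n"
  proof -
    have g: "\<eta> \<in> graded_hom R (- int n) (P n) M"
      unfolding \<eta>_def by (rule graded_hom_comp'[OF \<phi> eps_hom]) simp
    moreover have "\<eta> (d (Suc n) x) = \<zero>\<^bsub>M\<^esub>" if "x \<in> carrier (P (Suc n))" for x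
      unfolding \<eta>_def using z that ker_eps Z_closed[of "\<phi> (d (Suc n) x)" 0] unfolding Z_def by blast
    ultimately show ?thesis unfolding degree_cocycles_def cocycles_def using graded_hom_rmod by blast
  qed
  moreover have "bij_betw (l 0) (carrier (P (n + 0))) (carrier (P 0))"
    unfolding l0 by (rule bij_betw_byWitness[of _ \<psi>])
      (use i rmod_hom_closed[OF graded_hom_rmod[OF \<phi>]] rmod_hom_closed[OF graded_hom_rmod[OF \<psi>]] in auto)
  ultimately show ?thesis using some_lifting_isomorphismI[OF n] by blast
qed

text \<open>Only the generating degree matters, by \<open>linear_term_inj\<close>. If
  \<open>l (Suc j)\<close> kills \<open>x\<close> there, then \<open>l j\<close> kills
  \<open>d x\<close>, so \<open>d x\<close> is zero by injectivity, and \<open>x\<close> is zero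
  because the differential has no kernel in the generating degree.\<close>

lemma lifting_inj_Suc:
  assumes l: "liftings R P \<epsilon> d n \<eta> l" and inj: "inj_on (l j) (carrier (P (n + j)))"
  shows "inj_on (l (Suc j)) (carrier (P (n + Suc j)))"
    "hdim (P (n + Suc j)) (int (n + Suc j)) \<le> hdim (P (Suc j)) (int (Suc j))"
    "hdim (P (n + Suc j)) (int (n + Suc j)) = hdim (P (Suc j)) (int (Suc j)) \<Longrightarrow>
      l (Suc j) ` carrier (P (n + Suc j)) = carrier (P (Suc j))"
proof -
  have lh: "\<And>i. l i \<in> graded_hom R (- int n) (P (n + i)) (P i)"
    and ld: "\<And>x. x \<in> carrier (P (n + Suc j)) \<Longrightarrow> d (Suc j) (l (Suc j) x) = l j (d (n + Suc j) x)"
    using l unfolding liftings_def by blast+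
  interpret N: right_module R "P (n + Suc j)" by (rule rP)
  have z: "x = \<zero>\<^bsub>P (n + Suc j)\<^esub>"
    if x: "x \<in> homog (P (n + Suc j)) (int (n + Suc j))" and lx: "l (Suc j) x = \<zero>\<^bsub>P (Suc j)\<^esub>" for x
  proof -
    have xc: "x \<in> carrier (P (n + Suc j))" by (rule homog_closed[OF gP x])
    have dx: "d (Suc (n + j)) x \<in> carrier (P (n + j))" using rmod_hom_closed[OF d_rmod] xc by simp
    have "l j (d (Suc (n + j)) x) = l j \<zero>\<^bsub>P (n + j)\<^esub>"
      using ld[OF xc] lx rmod_hom_zero[OF rP rP d_rmod] rmod_hom_zero[OF rP rP graded_hom_rmod[OF lh]] by simp
    then have "d (Suc (n + j)) x = \<zero>\<^bsub>P (n + j)\<^esub>"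
      using inj_onD[OF inj _ dx] abelian_group.axioms(1)[OF graded_abelian[OF gP]] abelian_monoid.zero_closed by blast
    then show ?thesis using ker_d_lowest[of x "n + j"] x by simp
  qed
  have "inj_on (l (Suc j)) (homog (P (n + Suc j)) (int (n + Suc j)))"
  proof (rule inj_onI)
    fix x y assume x: "x \<in> homog (P (n + Suc j)) (int (n + Suc j))" "y \<in> homog (P (n + Suc j)) (int (n + Suc j))"
      and eq: "l (Suc j) x = l (Suc j) y"
    note xc = homog_closed[OF gP x(1)] homog_closed[OF gP x(2)]
    have "x \<ominus>\<^bsub>P (n + Suc j)\<^esub> y \<in> homog (P (n + Suc j)) (int (n + Suc j))"
      using x homog_subgroup[OF gP] unfolding a_minus_def
      by (blast intro: additive_subgroup.a_closed additive_subgroup.a_inv_closed)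
    then have "x \<ominus>\<^bsub>P (n + Suc j)\<^esub> y = \<zero>\<^bsub>P (n + Suc j)\<^esub>"
      using z eq rmod_hom_eq_iff_minus[OF rP rP graded_hom_rmod[OF lh] xc] by blast
    then show "x = y" using N.M.minus_eq_zero_iff xc by blast
  qed
  from linear_term_inj[OF res_term res_term lh _ this]
  show "inj_on (l (Suc j)) (carrier (P (n + Suc j)))"
    "hdim (P (n + Suc j)) (int (n + Suc j)) \<le> hdim (P (Suc j)) (int (Suc j))"
    "hdim (P (n + Suc j)) (int (n + Suc j)) = hdim (P (Suc j)) (int (Suc j)) \<Longrightarrow>
      l (Suc j) ` carrier (P (n + Suc j)) = carrier (P (Suc j))"
    by simp_all
qed

text \<open>
  All liftings beyond a monomorphism are monomorphisms, so along \<open>i, i + n, i + 2n, \<dots>\<close> the dimensions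
  of the generating spaces decrease and become stationary.
\<close>

lemma monomorphism_imp:
  assumes "some_lifting_monomorphism R M P \<epsilon> d"
  shows "some_lifting_isomorphism R M P \<epsilon> d" "eventually_periodic R M P d"
proof -
  obtain n \<eta> l i where n: "n \<ge> 1" and \<eta>: "\<eta> \<in> degree_cocycles R M P d n" and l: "liftings R P \<epsilon> d n \<eta> l"
    and inj: "inj_on (l i) (carrier (P (n + i)))"
    using assms unfolding some_lifting_monomorphism_def by blast
  have lh: "\<And>i. l i \<in> rmod_hom R (P (n + i)) (P i)"
    and ld: "\<And>i x. x \<in> carrier (P (n + Suc i)) \<Longrightarrow> d (Suc i) (l (Suc i) x) = l i (d (n + Suc i) x)"
    using l graded_hom_rmod unfolding liftings_def by blast+
  have inj: "inj_on (l (i + k)) (carrier (P (n + (i + k))))" for k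
    by (induction k) (use inj lifting_inj_Suc(1)[OF l] in auto)
  \<comment> \<open>The sequence starts at \<open>Suc i\<close>, because injectivity of a lifting
    bounds the dimension belonging to the next one.\<close>
  let ?D = "\<lambda>k. hdim (P (Suc i + k * n)) (int (Suc i + k * n))"
  obtain k where k: "\<And>k'. ?D k \<le> ?D k'"
    using ex_has_least_nat[of "\<lambda>_. True" 0 ?D] by blast
  \<comment> \<open>As \<open>?D k\<close> is minimal, the dimensions at \<open>Suc j\<close> and
    \<open>n + Suc j\<close> are equal, and this makes the injective map \<open>l (Suc j)\<close>
    surjective.\<close>
  define j where "j = i + k * n"
  have "?D (Suc k) \<le> ?D k"
    using lifting_inj_Suc(2)[OF l inj[of "k * n"]] by (simp add: ac_simps)
  then have "?D (Suc k) = ?D k" using k[of "Suc k"] by simp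
  then have on: "l (Suc j) ` carrier (P (n + Suc j)) = carrier (P (Suc j))"
    using lifting_inj_Suc(3)[OF l inj[of "k * n"]] unfolding j_def by (simp add: ac_simps)
  have injj: "inj_on (l j) (carrier (P (n + j)))" unfolding j_def by (rule inj)
  then have "bij_betw (l (Suc j)) (carrier (P (n + Suc j))) (carrier (P (Suc j)))"
    using lifting_inj_Suc(1)[OF l injj] on unfolding bij_betw_def by blast
  then show "some_lifting_isomorphism R M P \<epsilon> d" by (rule some_lifting_isomorphismI[OF n \<eta> l])
  have cz: "Z (n + j) \<subseteq> carrier (P (n + j))" using Z_closed by blast
  \<comment> \<open>Surjectivity of \<open>l (Suc j)\<close> is what carries one syzygy onto the
    other under \<open>l j\<close>; the resulting isomorphism is one of syzygies with indices
    \<open>Suc (n + j)\<close> and \<open>Suc j\<close>.\<close>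
  have im: "l j ` Z (n + j) = Z j"
  proof -
    have "l j ` Z (n + j) = (\<lambda>x. l j (d (n + Suc j) x)) ` carrier (P (n + Suc j))"
      unfolding Z_def by (simp add: image_image)
    also have "\<dots> = d (Suc j) ` (l (Suc j) ` carrier (P (n + Suc j)))"
      unfolding image_image using ld by (intro image_cong) simp_all
    also have "\<dots> = Z j" unfolding on Z_def ..
    finally show ?thesis .
  qed
  have "l j \<in> rmod_hom R (syzygy P d (Suc (n + j))) (syzygy P d (Suc j))"
    using rmod_hom_add[OF lh[of j] Z_closed Z_closed] rmod_hom_act[OF lh[of j] _ Z_closed] im
    by (intro rmod_homI) (auto simp: syzygy_simps)
  moreover have "bij_betw (l j) (carrier (syzygy P d (Suc (n + j)))) (carrier (syzygy P d (Suc j)))"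
    using inj_on_subset[OF injj cz] im by (simp add: bij_betw_def syzygy_simps)
  ultimately have "rmod_isomorphic R (syzygy P d (Suc j + n)) (syzygy P d (Suc j))"
    unfolding rmod_isomorphic_def by (auto simp: add.commute)
  then show "eventually_periodic R M P d"
    unfolding eventually_periodic_def using n by (intro exI[of _ "Suc j"] exI[of _ n]) auto
qed

section \<open>Sections of the augmentation and projective dimension\<close>

lemma eps_inj_of_section:
  assumes s: "s \<in> rmod_hom R M (P 0)" "\<And>y. y \<in> carrier M \<Longrightarrow> \<epsilon> (s y) = y"
  shows "inj_on \<epsilon> (carrier (P 0))"
proof -
  \<comment> \<open>The part of degree 0 of a section of \<open>\<epsilon>\<close> is again a
    section, and it preserves degrees.\<close>
  let ?s = "part 0 M (P 0) s"
  have gs: "?s \<in> graded_hom R 0 M (P 0)" by (rule part_graded_hom[OF gM gP s(1)])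
  have es: "\<epsilon> (?s y) = y" if y: "y \<in> carrier M" for y
  proof -
    have "\<epsilon> (?s y) = part 0 M M (\<lambda>y. \<epsilon> (s y)) y" using part_lift[OF gM gP gM s(1) eps_hom y, of 0] by simp
    also have "\<dots> = part 0 M M (\<lambda>y. y) y" by (rule part_cong[OF gM y s(2)])
    also have "\<dots> = y" by (rule part_graded[OF gM gM _ y]) (simp add: graded_hom_def rmod_hom_id)
    finally show ?thesis .
  qed
  have "?s (\<epsilon> x) = x" if "x \<in> carrier (P 0)" for x
  proof (rule rmod_hom_eqI[OF gP genP rP _ rmod_hom_id _ that])
    show "(\<lambda>x. ?s (\<epsilon> x)) \<in> rmod_hom R (P 0) (P 0)" by (rule rmod_hom_comp[OF eps_rmod graded_hom_rmod[OF gs]])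
    \<comment> \<open>Both \<open>?s (\<epsilon> v)\<close> and \<open>v\<close> lie in degree 0 and
      have the same image under \<open>\<epsilon>\<close>, which is injective in that
      degree.\<close>
    fix v assume v: "v \<in> homog (P 0) (int 0)"
    have vc: "v \<in> carrier (P 0)" by (rule homog_closed[OF gP v])
    have ev: "\<epsilon> v \<in> carrier M" by (rule rmod_hom_closed[OF eps_rmod vc])
    have w: "?s (\<epsilon> v) \<in> homog (P 0) 0"
      using graded_hom_homog[OF gs graded_hom_homog[OF eps_hom v]] by simp
    have wc: "?s (\<epsilon> v) \<in> carrier (P 0)" by (rule homog_closed[OF gP w])
    interpret Q: right_module R "P 0" by (rule rP)
    have "?s (\<epsilon> v) \<ominus>\<^bsub>P 0\<^esub> v \<in> homog (P 0) 0"
      using w v homog_subgroup[OF gP] unfolding a_minus_def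
      by (auto intro: additive_subgroup.a_closed additive_subgroup.a_inv_closed)
    then have "?s (\<epsilon> v) \<ominus>\<^bsub>P 0\<^esub> v = \<zero>\<^bsub>P 0\<^esub>"
      using ker_eps_lowest rmod_hom_eq_iff_minus[OF rP rM eps_rmod wc vc] es[OF ev] by blast
    then show "?s (\<epsilon> v) = v" using Q.M.minus_eq_zero_iff wc vc by blast
  qed
  then show ?thesis by (metis inj_on_inverseI)
qed

end

text \<open>If \<open>\<epsilon>\<close> is injective, \<open>P 0\<close> followed by zero modules
  resolves \<open>M\<close>. The terms are fixed to consist of sequences, as in
  \<open>infinite_projective_dimension\<close>.\<close>

lemma finite_projective_dimension:
  fixes P :: "nat \<Rightarrow> ('r, nat \<Rightarrow> 'r) graded"
  assumes L: "linear_res K R m e M P \<epsilon> d" and inj: "inj_on \<epsilon> (carrier (P 0))"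
  shows "\<not> infinite_projective_dimension R M"
proof -
  interpret linear_res K R m e M P \<epsilon> d by (rule L)
  let ?Z = "zero_submodule (P 0)"
  define P' where "P' = (\<lambda>n::nat. if n = 0 then P 0 else ?Z)"
  define d' :: "nat \<Rightarrow> (nat \<Rightarrow> 'r) \<Rightarrow> (nat \<Rightarrow> 'r)" where "d' = (\<lambda>_ _. \<zero>\<^bsub>P 0\<^esub>)"
  interpret Q: right_module R "P 0" by (rule rP)
  note zt = zero_submodule_term[OF gP[of 0]]
  interpret Z: right_module R ?Z by (rule graded_right_module[OF zt(1)])
  have P'_simps [simp]: "P' 0 = P 0" "P' (Suc n) = ?Z" for n unfolding P'_def by simp_all
  have P'_zero [simp]: "\<zero>\<^bsub>P' n\<^esub> = \<zero>\<^bsub>P 0\<^esub>" for n by (cases n) simp_all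
  have z: "\<zero>\<^bsub>P 0\<^esub> \<in> homog (P 0) k" for k
    by (rule additive_subgroup.zero_closed[OF homog_subgroup[OF gP]])
  have d'1: "d' n \<in> graded_hom R 0 ?Z (P 0)" "d' n \<in> graded_hom R 0 ?Z ?Z" for n
  proof -
    have "d' n \<in> rmod_hom R ?Z (P 0)" "d' n \<in> rmod_hom R ?Z ?Z"
      unfolding d'_def by (rule rmod_homI; simp)+
    then show "d' n \<in> graded_hom R 0 ?Z (P 0)" "d' n \<in> graded_hom R 0 ?Z ?Z"
      using z unfolding graded_hom_def d'_def by simp_all
  qed
  have ker: "a_kernel (P 0) M \<epsilon> = {\<zero>\<^bsub>P 0\<^esub>}"
  proof -
    have e0: "\<epsilon> \<zero>\<^bsub>P 0\<^esub> = \<zero>\<^bsub>M\<^esub>" by (rule rmod_hom_zero[OF rP rM eps_rmod])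
    have "x = \<zero>\<^bsub>P 0\<^esub>" if "x \<in> carrier (P 0)" "\<epsilon> x = \<zero>\<^bsub>M\<^esub>" for x
      by (rule inj_onD[OF inj _ that(1) Q.M.zero_closed]) (simp add: that e0)
    then show ?thesis using e0 unfolding a_kernel_def kernel_def by auto
  qed
  have "graded_module R (P' n) \<and> projective_module R (P' n) \<and> finitely_generated R (P' n)" for n
    using zt linear_termD(1,3,4)[OF res_term[of 0]] by (cases n) auto
  moreover have "d' (Suc n) \<in> graded_hom R 0 (P' (Suc n)) (P' n)" for n
    using d'1 by (cases n) auto
  ultimately have "graded_projective_resolution R M P' \<epsilon> d'"
    using gM eps_hom eps_onto ker
    by (simp add: graded_projective_resolution_def d'_def a_kernel_def kernel_def)
  moreover have "\<forall>n>0. carrier (P' n) = {\<zero>\<^bsub>P' n\<^esub>}" by (auto simp: P'_def)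
  ultimately show ?thesis unfolding infinite_projective_dimension_def by blast
qed

context linear_res
begin

text \<open>\<open>P\<close> may live on any type, so the section is composed with a comparison map
  \<open>t\<close> into a linear resolution by sequences, supplied by \<open>linear_module\<close>.
  There it forces the augmentation to be injective.\<close>

lemma no_section:
  assumes lin: "linear_module R M" and inf: "infinite_projective_dimension R M"
    and s: "s \<in> rmod_hom R M (P 0)" "\<And>y. y \<in> carrier M \<Longrightarrow> \<epsilon> (s y) = y"
  shows False
proof -
  obtain P' :: "nat \<Rightarrow> ('r, nat \<Rightarrow> 'r) graded" and \<epsilon>' d' where "linear_resolution R M P' \<epsilon>' d'"
    using lin unfolding linear_module_def by blast
  then have L: "linear_res K R m e M P' \<epsilon>' d'"
    by (simp add: linear_res_def linear_res_axioms_def split_alg_axioms)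
  interpret L: linear_res K R m e M P' \<epsilon>' d' by (rule L)
  obtain t where t: "t \<in> rmod_hom R (P 0) (P' 0)" "\<And>x. x \<in> carrier (P 0) \<Longrightarrow> \<epsilon>' (t x) = \<epsilon> x"
    using linear_term_lift[OF res_term L.rP rM L.eps_rmod eps_rmod] eps_onto L.eps_onto by auto
  have "inj_on \<epsilon>' (carrier (P' 0))"
    by (rule L.eps_inj_of_section[OF rmod_hom_comp[OF s(1) t(1)]])
      (use s t rmod_hom_closed[OF s(1)] in auto)
  then show False using finite_projective_dimension[OF L] inf by blast
qed

text \<open>
  For \<open>b > 0\<close> the map \<open>v\<close> factors through \<open>\<Omega>\<^sup>b M\<close> and extends to \<open>P (b - 1)\<close>, whose generators live in a
  degree where \<open>P b\<close> vanishes. For \<open>b = 0\<close> a nonzero \<open>v\<close> would split off a projective summand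
  \<open>e\<^sub>i R\<close> from \<open>M\<close>.
\<close>

lemma vanish_Suc:
  assumes si: "selfinjective R" and v: "v \<in> graded_hom R 0 (P (Suc k)) (P (Suc k))"
    and z: "\<And>x. x \<in> Z (Suc k) \<Longrightarrow> v x = \<zero>\<^bsub>P (Suc k)\<^esub>" and x: "x \<in> carrier (P (Suc k))"
  shows "v x = \<zero>\<^bsub>P (Suc k)\<^esub>"
proof -
  interpret Q: right_module R "P (Suc k)" by (rule rP)
  have ker: "v x = \<zero>\<^bsub>P (Suc k)\<^esub>" if "x \<in> carrier (P (Suc k))" "d (Suc k) x = \<zero>\<^bsub>P k\<^esub>" for x
    using z ker_d that by blast
  obtain U where U: "U \<in> graded_hom R 0 (P k) (P (Suc k))"
    "\<And>x. x \<in> carrier (P (Suc k)) \<Longrightarrow> U (d (Suc k) x) = v x"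
    using linear_term_extend[OF si gP gP linear_termD(4)[OF res_term] res_term d_hom v ker] by blast
  have "U y = \<zero>\<^bsub>P (Suc k)\<^esub>" if "y \<in> carrier (P k)" for y
  proof (rule rmod_hom_eqI[OF gP genP rP graded_hom_rmod[OF U(1)] _ _ that])
    show "(\<lambda>_. \<zero>\<^bsub>P (Suc k)\<^esub>) \<in> rmod_hom R (P k) (P (Suc k))" by (rule rmod_homI) auto
    fix y assume "y \<in> homog (P k) (int k)"
    then have "U y \<in> homog (P (Suc k)) (int k)" using graded_hom_homog[OF U(1)] by simp
    from homog_below[OF gP genP this] show "U y = \<zero>\<^bsub>P (Suc k)\<^esub>" by simp
  qed
  then show ?thesis using U(2)[OF x] rmod_hom_closed[OF d_rmod x] by simp
qed

lemma vanish_0: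
  assumes lin: "linear_module R M" and inf: "infinite_projective_dimension R M" and ind: "indecomposable R M"
    and v: "v \<in> graded_hom R 0 (P 0) (P 0)"
    and z: "\<And>x. x \<in> Z 0 \<Longrightarrow> v x = \<zero>\<^bsub>P 0\<^esub>" and x: "x \<in> carrier (P 0)"
  shows "v x = \<zero>\<^bsub>P 0\<^esub>"
proof -
  interpret Q: right_module R "P 0" by (rule rP)
  interpret M: right_module R M by (rule rM)
  note vh = graded_hom_rmod[OF v]
  \<comment> \<open>Adapted elements suffice: they span degree 0, which generates
    \<open>P 0\<close>.\<close>
  have t0: "v t = \<zero>\<^bsub>P 0\<^esub>" if t: "t \<in> adapted (P 0) 0" for t
  proof (rule ccontr)
    define w where "w = v t"
    assume "v t \<noteq> \<zero>\<^bsub>P 0\<^esub>"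
    then have w0: "w \<noteq> \<zero>\<^bsub>P 0\<^esub>" unfolding w_def .
    obtain i where i: "i < m" "e i \<odot>\<^bsub>P 0\<^esub> t = t" and th: "t \<in> homog (P 0) 0"
      using t unfolding adapted_def by blast
    have tc: "t \<in> carrier (P 0)" by (rule homog_closed[OF gP th])
    have wh: "w \<in> homog (P 0) 0" using graded_hom_homog[OF v th] unfolding w_def by simp
    have wc: "w \<in> carrier (P 0)" by (rule homog_closed[OF gP wh])
    have "e i \<odot>\<^bsub>P 0\<^esub> w = w" unfolding w_def using rmod_hom_act[OF vh idem_closed[OF i(1)] tc] i by simp
    \<comment> \<open>A nonzero adapted vector extends to an adapted basis, so \<open>w\<close>
      generates a direct summand of \<open>P 0\<close>. The degree is spelled \<open>int 0\<close>
      to match \<open>res_term\<close>.\<close>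
    then have "w \<in> adapted (P 0) (int 0)" using i wh unfolding adapted_def by auto
    from linear_term_dual_basis_extends[OF res_term adapted_indep_singleton[OF gP this w0]]
    obtain B \<iota> c where wB: "w \<in> B" and D: "dual_basis (P 0) (int 0) B \<iota> c" by auto
    have \<iota>: "\<And>b. b \<in> B \<Longrightarrow> \<iota> b < m" and eb: "\<And>b. b \<in> B \<Longrightarrow> e (\<iota> b) \<odot>\<^bsub>P 0\<^esub> b = b"
      using D unfolding dual_basis_def by blast+
    \<comment> \<open>Cutting \<open>t\<close> down to the idempotent that the basis assigns to
      \<open>w\<close> allows \<open>w\<close> to be mapped to \<open>t'\<close>; the value under
      \<open>v\<close> is still \<open>w\<close>.\<close>
    define t' where "t' = e (\<iota> w) \<odot>\<^bsub>P 0\<^esub> t"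
    have eiw: "e (\<iota> w) \<in> carrier R" by (rule idem_closed[OF \<iota>[OF wB]])
    have t'h: "t' \<in> homog (P 0) 0" unfolding t'_def by (rule homog_act0[OF gP idem_homog[OF \<iota>[OF wB]] th])
    have t'c: "t' \<in> carrier (P 0)" by (rule homog_closed[OF gP t'h])
    have et': "e (\<iota> w) \<odot>\<^bsub>P 0\<^esub> t' = t'"
      unfolding t'_def using Q.act_mult[OF eiw eiw tc] idem_mult[OF \<iota>[OF wB] \<iota>[OF wB]] by simp
    have vt': "v t' = w" unfolding t'_def using rmod_hom_act[OF vh eiw tc] eb[OF wB] w_def by simp
    define \<phi> where "\<phi> = (\<lambda>b. if b = w then t' else \<zero>\<^bsub>P 0\<^esub>)"
    \<comment> \<open>\<open>\<sigma>\<close> sends \<open>w\<close> back to \<open>t'\<close> and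
      kills the other basis vectors, so that \<open>v\<close> after \<open>\<sigma>\<close> is the
      projection onto the summand generated by \<open>w\<close>.\<close>
    define \<sigma> where "\<sigma> = (\<lambda>x. \<Oplus>\<^bsub>P 0\<^esub>b\<in>B. c b x \<odot>\<^bsub>P 0\<^esub> \<phi> b)"
    have \<phi>: "\<phi> b \<in> carrier (P 0)" "e (\<iota> b) \<odot>\<^bsub>P 0\<^esub> \<phi> b = \<phi> b" if "b \<in> B" for b
      using t'c et' idem_closed[OF \<iota>[OF that]] unfolding \<phi>_def by auto
    have \<sigma>: "\<sigma> \<in> rmod_hom R (P 0) (P 0)" and \<sigma>b: "\<And>b. b \<in> B \<Longrightarrow> \<sigma> b = \<phi> b"
      unfolding \<sigma>_def using dual_basis_homs[OF gP rP D \<phi>] by blast+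
    have \<sigma>w: "\<sigma> w = t'" using \<sigma>b[OF wB] unfolding \<phi>_def by simp
    have svs: "\<sigma> (v (\<sigma> x)) = \<sigma> x" if "x \<in> carrier (P 0)" for x
    proof (rule dual_basis_eqI[OF gP rP D rmod_hom_comp[OF rmod_hom_comp[OF \<sigma> vh] \<sigma>] \<sigma> _ that])
      fix b assume "b \<in> B"
      then show "\<sigma> (v (\<sigma> b)) = \<sigma> b"
        using \<sigma>b[of b] \<sigma>w vt' rmod_hom_zero[OF rP rP vh] rmod_hom_zero[OF rP rP \<sigma>] unfolding \<phi>_def by auto
    qed
    have "v x = \<zero>\<^bsub>P 0\<^esub>" if "x \<in> carrier (P 0)" "\<epsilon> x = \<zero>\<^bsub>M\<^esub>" for x using z ker_eps that by blast
    then obtain u where u: "u \<in> rmod_hom R M (P 0)" "\<And>x. x \<in> carrier (P 0) \<Longrightarrow> u (\<epsilon> x) = v x"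
      using rmod_hom_factor[OF rP rM rP eps_rmod eps_onto vh] by blast
    \<comment> \<open>Since \<open>v\<close> factors through \<open>\<epsilon>\<close> as
      \<open>u\<close>, the idempotent \<open>\<sigma>\<close> after \<open>v\<close> of
      \<open>P 0\<close> descends to the idempotent \<open>q\<close> of \<open>M\<close>.\<close>
    define q where "q = (\<lambda>y. \<epsilon> (\<sigma> (u y)))"
    have q: "q \<in> rmod_hom R M M"
      unfolding q_def by (rule rmod_hom_comp[OF rmod_hom_comp[OF u(1) \<sigma>] eps_rmod])
    have qq: "q (q y) = q y" if "y \<in> carrier M" for y
    proof -
      have uy: "u y \<in> carrier (P 0)" by (rule rmod_hom_closed[OF u(1) that])
      then show ?thesis unfolding q_def using u(2)[OF rmod_hom_closed[OF \<sigma> uy]] svs[OF uy] by simp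
    qed
    show False
      using indecomposable_idempotent[OF rM ind q qq]
    proof
      \<comment> \<open>\<open>q\<close> fixes \<open>\<epsilon> t'\<close>, because
        \<open>u (\<epsilon> t') = v t' = w\<close> and \<open>\<sigma> w = t'\<close>.\<close>
      assume "\<forall>y\<in>carrier M. q y = \<zero>\<^bsub>M\<^esub>"
      then have "\<epsilon> t' = \<zero>\<^bsub>M\<^esub>"
        using rmod_hom_closed[OF eps_rmod t'c] u(2)[OF t'c] vt' \<sigma>w unfolding q_def by force
      then have "t' = \<zero>\<^bsub>P 0\<^esub>" using ker_eps_lowest[OF t'h] by blast
      then show False using vt' w0 rmod_hom_zero[OF rP rP vh] by simp
    next
      \<comment> \<open>Now \<open>\<sigma>\<close> after \<open>u\<close> is a section of
        \<open>\<epsilon>\<close>.\<close>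
      assume "\<forall>y\<in>carrier M. q y = y"
      then show False
        using no_section[OF lin inf rmod_hom_comp[OF u(1) \<sigma>]] unfolding q_def by blast
    qed
  qed
  show ?thesis
  proof (rule rmod_hom_eqI[OF gP genP rP vh _ _ x])
    show "(\<lambda>_. \<zero>\<^bsub>P 0\<^esub>) \<in> rmod_hom R (P 0) (P 0)" by (rule rmod_homI) auto
    fix y assume "y \<in> homog (P 0) (int 0)"
    then have y: "y \<in> homog (P 0) 0" by simp
    have yc: "e i \<odot>\<^bsub>P 0\<^esub> y \<in> carrier (P 0)" "v (e i \<odot>\<^bsub>P 0\<^esub> y) = \<zero>\<^bsub>P 0\<^esub>" if "i < m" for i
      using adapted_decomp(1)[OF gP y that] t0 homog_closed[OF gP] unfolding adapted_def by blast+
    have "v y = v (\<Oplus>\<^bsub>P 0\<^esub>i\<in>{..<m}. e i \<odot>\<^bsub>P 0\<^esub> y)" using adapted_decomp(2)[OF gP y] by simp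
    also have "\<dots> = (\<Oplus>\<^bsub>P 0\<^esub>i\<in>{..<m}. v (e i \<odot>\<^bsub>P 0\<^esub> y))"
      using yc by (intro rmod_hom_finsum[OF rP rP vh]) auto
    also have "\<dots> = \<zero>\<^bsub>P 0\<^esub>" using yc by (intro Q.M.add.finprod_one_eqI) simp
    finally show "v y = \<zero>\<^bsub>P 0\<^esub>" .
  qed
qed

section \<open>Descent of periodicity over a selfinjective algebra\<close>

lemma identity_mod_syzygy:
  assumes si: "selfinjective R" and lin: "linear_module R M" and inf: "infinite_projective_dimension R M"
    and ind: "indecomposable R M" and f: "f \<in> graded_hom R 0 (P b) (P b)"
    and id: "\<And>x. x \<in> Z b \<Longrightarrow> f x = x" and x: "x \<in> carrier (P b)"
  shows "f x = x"
proof -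
  interpret Q: right_module R "P b" by (rule rP)
  let ?v = "\<lambda>x. f x \<ominus>\<^bsub>P b\<^esub> x"
  have "(\<lambda>x. x) \<in> graded_hom R 0 (P b) (P b)" by (simp add: graded_hom_def rmod_hom_id)
  then have v: "?v \<in> graded_hom R 0 (P b) (P b)" by (rule graded_hom_diff[OF gP gP f])
  have fc: "f x \<in> carrier (P b)" if "x \<in> carrier (P b)" for x by (rule rmod_hom_closed[OF graded_hom_rmod[OF f] that])
  have z: "?v x = \<zero>\<^bsub>P b\<^esub>" if "x \<in> Z b" for x
    using id[OF that] Z_closed[OF that] Q.M.minus_eq_zero_iff by simp
  have "?v x = \<zero>\<^bsub>P b\<^esub>"
  proof (cases b)
    case 0
    show ?thesis using vanish_0[OF lin inf ind, of ?v x] v z x unfolding 0 by blast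
  next
    case (Suc k)
    show ?thesis using vanish_Suc[OF si, of ?v k x] v z x unfolding Suc by blast
  qed
  then show ?thesis using Q.M.minus_eq_zero_iff[OF fc[OF x] x] by blast
qed

text \<open>The extensions \<open>F\<close> and \<open>G\<close> carry \<open>Z\<close> into
  \<open>Z\<close>, since on \<open>Z\<close> they agree with the maps induced by
  \<open>\<phi>\<close> and \<open>\<psi>\<close>. So the result has the same form one index lower,
  and the descent can be repeated.\<close>

lemma shift_iso_descend:
  assumes si: "selfinjective R" and lin: "linear_module R M" and inf: "infinite_projective_dimension R M"
    and ind: "indecomposable R M" and G: "shift_iso n (Suc a)"
  shows "shift_iso n a"
proof -
  let ?b = "a + n"
  obtain \<phi> \<psi> where \<phi>: "\<phi> \<in> graded_hom R (- int n) (P (Suc ?b)) (P (Suc a))"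
    and \<psi>: "\<psi> \<in> graded_hom R (int n) (P (Suc a)) (P (Suc ?b))"
    and i: "\<And>x. x \<in> carrier (P (Suc ?b)) \<Longrightarrow> \<psi> (\<phi> x) = x" "\<And>y. y \<in> carrier (P (Suc a)) \<Longrightarrow> \<phi> (\<psi> y) = y"
    and z: "\<phi> ` Z (Suc ?b) \<subseteq> Z (Suc a)" "\<psi> ` Z (Suc a) \<subseteq> Z (Suc ?b)"
    using G unfolding shift_iso_def by auto
  note \<phi>c = rmod_hom_closed[OF graded_hom_rmod[OF \<phi>]] and \<psi>c = rmod_hom_closed[OF graded_hom_rmod[OF \<psi>]]
  \<comment> \<open>\<open>F\<close> prolongs the map \<open>d x \<mapsto> d (\<chi> x)\<close> from
    \<open>Z s\<close> to \<open>P s\<close>; this map is well defined because \<open>\<chi>\<close>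
    respects \<open>Z\<close>.\<close>
  have ext: "\<exists>F\<in>graded_hom R j (P s) (P t). \<forall>x\<in>carrier (P (Suc s)). F (d (Suc s) x) = d (Suc t) (\<chi> x)"
    if \<chi>: "\<chi> \<in> graded_hom R j (P (Suc s)) (P (Suc t))" and z: "\<chi> ` Z (Suc s) \<subseteq> Z (Suc t)" for j s t \<chi>
  proof (rule linear_term_extend[OF si gP gP linear_termD(4)[OF res_term] res_term d_hom])
    show "(\<lambda>x. d (Suc t) (\<chi> x)) \<in> graded_hom R j (P (Suc s)) (P t)"
      by (rule graded_hom_comp'[OF \<chi> d_hom]) simp
    fix x assume x: "x \<in> carrier (P (Suc s))" "d (Suc s) x = \<zero>\<^bsub>P s\<^esub>"
    then have "\<chi> x \<in> Z (Suc t)" using ker_d[OF x(1)] z by blast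
    then show "d (Suc t) (\<chi> x) = \<zero>\<^bsub>P t\<^esub>" using ker_d Z_closed by blast
  qed
  obtain F where F: "F \<in> graded_hom R (- int n) (P ?b) (P a)"
    "\<And>x. x \<in> carrier (P (Suc ?b)) \<Longrightarrow> F (d (Suc ?b) x) = d (Suc a) (\<phi> x)"
    using ext[OF \<phi> z(1)] by blast
  obtain G where G: "G \<in> graded_hom R (int n) (P a) (P ?b)"
    "\<And>x. x \<in> carrier (P (Suc a)) \<Longrightarrow> G (d (Suc a) x) = d (Suc ?b) (\<psi> x)"
    using ext[OF \<psi> z(2)] by blast
  have ZE: "\<exists>y. y \<in> carrier (P (Suc k)) \<and> x = d (Suc k) y" if "x \<in> Z k" for x k
    using that unfolding Z_def by blast
  have "G (F x) = x" if "x \<in> carrier (P ?b)" for x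
  proof (rule identity_mod_syzygy[OF si lin inf ind _ _ that])
    show "(\<lambda>x. G (F x)) \<in> graded_hom R 0 (P ?b) (P ?b)" by (rule graded_hom_comp'[OF F(1) G(1)]) simp
    fix x assume "x \<in> Z ?b"
    then show "G (F x) = x" using ZE[of x ?b] F(2) G(2) \<phi>c i(1) by auto
  qed
  moreover have "F (G x) = x" if "x \<in> carrier (P a)" for x
  proof (rule identity_mod_syzygy[OF si lin inf ind _ _ that])
    show "(\<lambda>x. F (G x)) \<in> graded_hom R 0 (P a) (P a)" by (rule graded_hom_comp'[OF G(1) F(1)]) simp
    fix x assume "x \<in> Z a"
    then show "F (G x) = x" using ZE[of x a] F(2) G(2) \<psi>c i(2) by auto
  qed
  moreover have "F ` Z ?b \<subseteq> Z a" using F(2) \<phi>c unfolding Z_def by auto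
  moreover have "G ` Z a \<subseteq> Z ?b" using G(2) \<psi>c unfolding Z_def by auto
  ultimately show ?thesis
    unfolding shift_iso_def using F(1) G(1) by (intro bexI[of _ F] bexI[of _ G]) auto
qed

lemma periodic_iff_shift_iso: "periodic R M P d \<longleftrightarrow> (\<exists>n\<ge>1. shift_iso n 0)"
proof
  assume "periodic R M P d"
  then obtain n where n: "n \<ge> 1" "rmod_isomorphic R (syzygy P d n) M" unfolding periodic_def by blast
  then show "\<exists>n\<ge>1. shift_iso n 0" using periodic_imp_shift_iso[of "n - 1"] by auto
next
  assume "\<exists>n\<ge>1. shift_iso n 0"
  then obtain n where n: "n \<ge> 1" "shift_iso n 0" by blast
  then show "periodic R M P d"
    using shift_iso_imp_periodic[of "n - 1"] unfolding periodic_def by auto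
qed

lemma eventually_periodic_imp_shift_iso:
  assumes "eventually_periodic R M P d"
  shows "\<exists>a. \<exists>n\<ge>1. shift_iso n a"
proof -
  obtain a n where n: "n \<ge> 1" and iso: "if a = 0 then rmod_isomorphic R (syzygy P d (a + n)) M
      else rmod_isomorphic R (syzygy P d (a + n)) (syzygy P d a)"
    using assms unfolding eventually_periodic_def by blast
  show ?thesis
  proof (cases a)
    case 0
    then have "periodic R M P d" using n iso unfolding periodic_def by auto
    then show ?thesis using periodic_iff_shift_iso by blast
  next
    case (Suc b)
    then show ?thesis using syzygy_iso_imp_shift_iso[of b n] iso n by auto
  qed
qed

lemma eventually_periodic_imp_periodic:
  assumes "selfinjective R" "linear_module R M" "infinite_projective_dimension R M" "indecomposable R M"
    and "eventually_periodic R M P d"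
  shows "periodic R M P d"
proof -
  obtain a n where n: "n \<ge> 1" "shift_iso n a" using eventually_periodic_imp_shift_iso[OF assms(5)] by blast
  have "shift_iso n 0"
    using n(2) by (induction a) (use shift_iso_descend[OF assms(1-4)] in auto)
  then show ?thesis using n(1) periodic_iff_shift_iso by blast
qed

end

section \<open>The idempotents of the algebra, and the conclusion\<close>

lemma split_alg_exists:
  assumes A: "graded_algebra K R" and S: "split_degree_zero K R"
  shows "\<exists>m e. split_alg K R m e"
proof -
  interpret graded_alg K R by unfold_locales (rule A)
  interpret K: field K using A unfolding graded_algebra_def by blast
  obtain m :: nat and h where bij: "bij_betw h ({..<m} \<rightarrow>\<^sub>E carrier K) (homog R 0)"
    and h1: "h (\<lambda>i\<in>{..<m}. \<one>\<^bsub>K\<^esub>) = \<one>\<^bsub>R\<^esub>"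
    and ham: "\<forall>u\<in>{..<m} \<rightarrow>\<^sub>E carrier K. \<forall>v\<in>{..<m} \<rightarrow>\<^sub>E carrier K.
          h (\<lambda>i\<in>{..<m}. u i \<oplus>\<^bsub>K\<^esub> v i) = h u \<oplus>\<^bsub>R\<^esub> h v \<and>
          h (\<lambda>i\<in>{..<m}. u i \<otimes>\<^bsub>K\<^esub> v i) = h u \<otimes>\<^bsub>R\<^esub> h v"
    and hs: "\<forall>a\<in>carrier K. \<forall>u\<in>{..<m} \<rightarrow>\<^sub>E carrier K. h (\<lambda>i\<in>{..<m}. a \<otimes>\<^bsub>K\<^esub> u i) = a \<odot>\<^bsub>R\<^esub> h u"
    using S unfolding split_degree_zero_def by blast
  note hadd = conjunct1[OF bspec[OF bspec[OF ham]]] and hmult = conjunct2[OF bspec[OF bspec[OF ham]]]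
    and hsmult = bspec[OF bspec[OF hs]]
  \<comment> \<open>Indicator vectors: the singletons yield the idempotents, larger sets their
    partial sums in the induction below.\<close>
  define \<chi> where "\<chi> = (\<lambda>I. \<lambda>j\<in>{..<m}. if j \<in> I then \<one>\<^bsub>K\<^esub> else \<zero>\<^bsub>K\<^esub>)"
  have \<chi>: "\<chi> I \<in> {..<m} \<rightarrow>\<^sub>E carrier K" for I unfolding \<chi>_def by auto
  have hc: "h u \<in> homog R 0" if "u \<in> {..<m} \<rightarrow>\<^sub>E carrier K" for u using bij that bij_betwE by blast
  have hR: "h u \<in> carrier R" if "u \<in> {..<m} \<rightarrow>\<^sub>E carrier K" for u using hc[OF that] homog_R_closed by blast
  \<comment> \<open>\<open>h\<close> is given as compatible with sums, products, unity and scalars;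
    its value at zero follows by cancellation.\<close>
  have h0: "h (\<chi> {}) = \<zero>\<^bsub>R\<^esub>"
  proof -
    have "(\<lambda>i\<in>{..<m}. \<chi> {} i \<oplus>\<^bsub>K\<^esub> \<chi> {} i) = \<chi> {}" unfolding \<chi>_def by auto
    then have "h (\<chi> {}) \<oplus>\<^bsub>R\<^esub> h (\<chi> {}) = h (\<chi> {})" using hadd[OF \<chi> \<chi>, of "{}" "{}"] by simp
    then show ?thesis using R.add.l_cancel_one'[OF hR[OF \<chi>] hR[OF \<chi>]] by metis
  qed
  let ?e = "\<lambda>i. h (\<chi> {i})"
  have "split_alg K R m ?e"
  proof unfold_locales
    fix i assume i: "i < m"
    show "?e i \<in> homog R 0" by (rule hc[OF \<chi>])
    show "?e i \<otimes>\<^bsub>R\<^esub> ?e j = (if i = j then ?e i else \<zero>\<^bsub>R\<^esub>)" if "j < m" for j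
    proof -
      have "(\<lambda>k\<in>{..<m}. \<chi> {i} k \<otimes>\<^bsub>K\<^esub> \<chi> {j} k) = (if i = j then \<chi> {i} else \<chi> {})" unfolding \<chi>_def by auto
      then show ?thesis using hmult[OF \<chi> \<chi>, of "{i}" "{j}"] h0 by (simp split: if_splits)
    qed
    fix r assume "r \<in> homog R 0"
    then obtain u where u: "u \<in> {..<m} \<rightarrow>\<^sub>E carrier K" "r = h u" using bij unfolding bij_betw_def by blast
    \<comment> \<open>A product with a unit vector retains only coordinate \<open>i\<close>, so the
      scalar sought is \<open>u i\<close>.\<close>
    have "(\<lambda>k\<in>{..<m}. \<chi> {i} k \<otimes>\<^bsub>K\<^esub> u k) = (\<lambda>k\<in>{..<m}. u i \<otimes>\<^bsub>K\<^esub> \<chi> {i} k)"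
      using u i unfolding \<chi>_def by (auto simp: PiE_iff intro!: restrict_ext)
    moreover have "u i \<in> carrier K" using u i by auto
    ultimately show "\<exists>a\<in>carrier K. ?e i \<otimes>\<^bsub>R\<^esub> r = a \<odot>\<^bsub>R\<^esub> ?e i"
      using hmult[OF \<chi> u(1), of "{i}"] hsmult[OF _ \<chi>, of "u i" "{i}"] u(2)
      by (intro bexI[of _ "u i"]) simp_all
  next
    have "(\<Oplus>\<^bsub>R\<^esub>i\<in>I. ?e i) = h (\<chi> I)" if "finite I" "I \<subseteq> {..<m}" for I
      using that
    proof (induction I rule: finite_induct)
      case empty
      then show ?case using h0 by simp
    next
      case (insert i I)
      have "(\<lambda>k\<in>{..<m}. \<chi> {i} k \<oplus>\<^bsub>K\<^esub> \<chi> I k) = \<chi> (insert i I)" using insert unfolding \<chi>_def by auto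
      then show ?case using insert hadd[OF \<chi> \<chi>, of "{i}" I] hR[OF \<chi>] by simp
    qed
    then have "(\<Oplus>\<^bsub>R\<^esub>i\<in>{..<m}. ?e i) = h (\<chi> {..<m})" by simp
    moreover have "\<chi> {..<m} = (\<lambda>i\<in>{..<m}. \<one>\<^bsub>K\<^esub>)" unfolding \<chi>_def by auto
    ultimately show "(\<Oplus>\<^bsub>R\<^esub>i\<in>{..<m}. ?e i) = \<one>\<^bsub>R\<^esub>" using h1 by simp
  qed
  then show ?thesis by blast
qed

lemma isomorphism_imp_monomorphism:
  "some_lifting_isomorphism R M P \<epsilon> d \<Longrightarrow> some_lifting_monomorphism R M P \<epsilon> d"
  unfolding some_lifting_isomorphism_def some_lifting_monomorphism_def bij_betw_def by blast

theorem theorem4p13: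
  fixes K :: "('k, 'e) ring_scheme"
    and R :: "('k, 'r, 'c) graded_scheme"
    and M :: "('r, 'm, 'd) graded_scheme"
    and P :: "nat \<Rightarrow> ('r, 'p) graded"
    and \<epsilon> :: "'p \<Rightarrow> 'm"
    and d :: "nat \<Rightarrow> 'p \<Rightarrow> 'p"
  assumes "koszul_algebra K R"
    and "linear_module R M"
    and "indecomposable R M"
    and "infinite_projective_dimension R M"
    and "linear_resolution R M P \<epsilon> d"
  shows "(periodic R M P d \<longrightarrow> some_lifting_isomorphism R M P \<epsilon> d) \<and>
    (some_lifting_isomorphism R M P \<epsilon> d \<longleftrightarrow> some_lifting_monomorphism R M P \<epsilon> d) \<and>
    (some_lifting_monomorphism R M P \<epsilon> d \<longrightarrow> eventually_periodic R M P d) \<and>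
    (selfinjective R \<longrightarrow>
      (periodic R M P d \<longleftrightarrow> some_lifting_isomorphism R M P \<epsilon> d) \<and>
      (some_lifting_isomorphism R M P \<epsilon> d \<longleftrightarrow> some_lifting_monomorphism R M P \<epsilon> d) \<and>
      (some_lifting_monomorphism R M P \<epsilon> d \<longleftrightarrow> eventually_periodic R M P d))"
proof -
  obtain m e where "split_alg K R m e"
    using assms(1) split_alg_exists unfolding koszul_algebra_def by blast
  then interpret linear_res K R m e M P \<epsilon> d
    using assms(5) by (simp add: linear_res_def linear_res_axioms_def)
  have 12: "periodic R M P d \<Longrightarrow> some_lifting_isomorphism R M P \<epsilon> d"
    using periodic_iff_shift_iso shift_iso_imp_lifting by blast
  have 23: "some_lifting_isomorphism R M P \<epsilon> d \<longleftrightarrow> some_lifting_monomorphism R M P \<epsilon> d"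
    using isomorphism_imp_monomorphism monomorphism_imp(1) by blast
  have 34: "some_lifting_monomorphism R M P \<epsilon> d \<Longrightarrow> eventually_periodic R M P d"
    by (rule monomorphism_imp(2))
  have 41: "eventually_periodic R M P d \<Longrightarrow> periodic R M P d" if "selfinjective R"
    by (rule eventually_periodic_imp_periodic[OF that assms(2,4,3)])
  show ?thesis using 12 23 34 41 by blast
qed

end
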